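(* Let $\Omega$ be a compact Hausdorff space. Then there is a compact, connected group $\mathbb{G}$ and a cb-Helson subset of $\mathbb{G}$ that is homeomorphic to $\Omega$.
   Context: All topological groups are assumed Hausdorff. For a locally compact group $G$, $\operatorname{VN}(G)\subseteq\mathcal{B}(L^2(G))$ is the group von Neumann algebra (generated by the left regular representation $\lambda$) and $\operatorname{A}(G)$ is the Fourier algebra of $G$ in the sense of Eymard, which is the predual of $\operatorname{VN}(G)$ and carries the operator space structure of this predual (so that its operator space dual is $\operatorname{VN}(G)$ with its $\mathrm{C}^*$-algebra operator space structure). For a closed subset $E\subseteq G$, let $I_G(E)$ be the kernel of the restriction homomorphism $\operatorname{A}(G)\to C_0(E)$, and let $\operatorname{A}_G(E)=\operatorname{A}(G)/I_G(E)$ with the quotient operator space structure. $C_0(E)$ carries its canonical operator space structure as a $\mathrm{C}^*$-algebra. Let $\operatorname{inc}_{G,E}:\operatorname{A}_G(E)\to C_0(E)$ be the injective homomorphism induced by restriction. The closed set $E$ is called a cb-Helson subset of $G$ if $\operatorname{inc}_{G,E}$ is an isomorphism of operator spaces, i.e. it is a bijection which is completely bounded with completely bounded inverse (it is automatically completely contractive, so this means that it is surjective with completely bounded inverse). *)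

theory Defs
  imports "HOL-Analysis.Analysis" "HOL-Algebra.Group"
begin

section \<open>Topological groups and Haar measure\<close>

locale topological_group = group G for G :: "('g, 'm) monoid_scheme" (structure) +
  fixes T :: "'g topology"
  assumes topspace_eq: "topspace T = carrier G"
    and Hausdorff: "Hausdorff_space T"
    and continuous_mult: "continuous_map (prod_topology T T) T (\<lambda>(x, y). x \<otimes> y)"
    and continuous_inv: "continuous_map T T (\<lambda>x. inv x)"

text \<open>Left Haar measures: nonzero left-invariant Radon measures on the Borel sets of \<open>G\<close>.\<close>

definition is_haar_measure ::
    "('g, 'm) monoid_scheme \<Rightarrow> 'g topology \<Rightarrow> 'g measure \<Rightarrow> bool" where
  "is_haar_measure G T M \<longleftrightarrow>
     space M = carrier G \<and>
     sets M = sigma_sets (carrier G) {U. openin T U} \<and>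
     emeasure M (carrier G) \<noteq> 0 \<and>
     (\<forall>K. compactin T K \<longrightarrow> emeasure M K < \<infinity>) \<and>
     (\<forall>A\<in>sets M. emeasure M A = (INF U\<in>{U. openin T U \<and> A \<subseteq> U}. emeasure M U)) \<and>
     (\<forall>U. openin T U \<longrightarrow> emeasure M U = (SUP K\<in>{K. compactin T K \<and> K \<subseteq> U}. emeasure M K)) \<and>
     (\<forall>g\<in>carrier G. \<forall>A\<in>sets M. emeasure M ((\<lambda>x. g \<otimes>\<^bsub>G\<^esub> x) ` A) = emeasure M A)"

definition haar_measure :: "('g, 'm) monoid_scheme \<Rightarrow> 'g topology \<Rightarrow> 'g measure" where
  "haar_measure G T = (SOME M. is_haar_measure G T M)"


section \<open>Operators on \<open>L\<^sup>2\<close>\<close>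

text \<open>
  \<open>L\<^sup>2\<close> is represented by square-integrable functions rather than by their classes modulo null
  sets, and a bounded operator by a map on such functions that is linear almost everywhere and
  bounded. Linearity and boundedness force such a map to respect almost-everywhere equality.
  Equality of operators means almost-everywhere equality of their values; all notions below are
  invariant under it.
\<close>

definition L2 :: "'g measure \<Rightarrow> ('g \<Rightarrow> complex) set" where
  "L2 M = {f \<in> borel_measurable M. integrable M (\<lambda>x. (cmod (f x))\<^sup>2)}"

definition L2_inner :: "'g measure \<Rightarrow> ('g \<Rightarrow> complex) \<Rightarrow> ('g \<Rightarrow> complex) \<Rightarrow> complex" where
  "L2_inner M f h = (\<integral>x. f x * cnj (h x) \<partial>M)"

definition L2_norm :: "'g measure \<Rightarrow> ('g \<Rightarrow> complex) \<Rightarrow> real" where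
  "L2_norm M f = sqrt (\<integral>x. (cmod (f x))\<^sup>2 \<partial>M)"

type_synonym 'g operator = "('g \<Rightarrow> complex) \<Rightarrow> ('g \<Rightarrow> complex)"

definition bounded_ops :: "'g measure \<Rightarrow> 'g operator set" where
  "bounded_ops M = {S.
     (\<forall>f\<in>L2 M. S f \<in> L2 M) \<and>
     (\<forall>f\<in>L2 M. \<forall>h\<in>L2 M. \<forall>a b. AE x in M. S (\<lambda>y. a * f y + b * h y) x = a * S f x + b * S h x) \<and>
     (\<exists>C. \<forall>f\<in>L2 M. L2_norm M (S f) \<le> C * L2_norm M f)}"

definition commutant :: "'g measure \<Rightarrow> 'g operator set \<Rightarrow> 'g operator set" where
  "commutant M A =
     {S \<in> bounded_ops M. \<forall>R\<in>A. \<forall>f\<in>L2 M. AE x in M. S (R f) x = R (S f) x}"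

definition von_neumann_algebra :: "'g measure \<Rightarrow> 'g operator set \<Rightarrow> bool" where
  "von_neumann_algebra M A \<longleftrightarrow>
     A \<subseteq> bounded_ops M \<and>
     (\<forall>S\<in>A. \<forall>R\<in>bounded_ops M.
        (\<forall>f\<in>L2 M. \<forall>h\<in>L2 M. L2_inner M (S f) h = L2_inner M f (R h)) \<longrightarrow> R \<in> A) \<and>
     commutant M (commutant M A) = A"

definition left_regular :: "('g, 'm) monoid_scheme \<Rightarrow> 'g \<Rightarrow> 'g operator" where
  "left_regular G g f = (\<lambda>x. f (inv\<^bsub>G\<^esub> g \<otimes>\<^bsub>G\<^esub> x))"

definition group_VN :: "('g, 'm) monoid_scheme \<Rightarrow> 'g topology \<Rightarrow> 'g operator set" where
  "group_VN G T =
     \<Inter>{A. von_neumann_algebra (haar_measure G T) A \<and> left_regular G ` carrier G \<subseteq> A}"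


section \<open>Matrix norms\<close>

text \<open>
  An \<open>n \<times> n\<close> matrix is a function of two indices, of which only the values at indices below \<open>n\<close>
  matter. All norms take values in \<open>ennreal\<close>, so that suprema and infima need no side conditions.
\<close>

definition scalar_mat_norm :: "'i set \<Rightarrow> ('i \<Rightarrow> 'i \<Rightarrow> complex) \<Rightarrow> ennreal" where
  "scalar_mat_norm I a =
     (SUP v\<in>{v :: 'i \<Rightarrow> complex. (\<Sum>i\<in>I. (cmod (v i))\<^sup>2) \<le> 1}.
        ennreal (sqrt (\<Sum>i\<in>I. (cmod (\<Sum>j\<in>I. a i j * v j))\<^sup>2)))"

text \<open>The norm of a matrix of operators acting on the Hilbert space \<open>(L\<^sup>2)\<^sup>m\<close>.\<close>

definition op_mat_norm :: "'g measure \<Rightarrow> nat \<Rightarrow> (nat \<Rightarrow> nat \<Rightarrow> 'g operator) \<Rightarrow> ennreal" where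
  "op_mat_norm M m S =
     (SUP \<xi>\<in>{\<xi> :: nat \<Rightarrow> 'g \<Rightarrow> complex.
             (\<forall>l<m. \<xi> l \<in> L2 M) \<and> (\<Sum>l<m. (L2_norm M (\<xi> l))\<^sup>2) \<le> 1}.
        ennreal (sqrt (\<Sum>k<m. (L2_norm M (\<lambda>x. \<Sum>l<m. S k l (\<xi> l) x))\<^sup>2)))"

definition completely_bounded ::
    "'u set \<Rightarrow> (nat \<Rightarrow> (nat \<Rightarrow> nat \<Rightarrow> 'u) \<Rightarrow> ennreal) \<Rightarrow>
     (nat \<Rightarrow> (nat \<Rightarrow> nat \<Rightarrow> 'v) \<Rightarrow> ennreal) \<Rightarrow> ('u \<Rightarrow> 'v) \<Rightarrow> bool" where
  "completely_bounded V NV NW F \<longleftrightarrow>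
     (\<exists>C :: real. \<forall>n v. (\<forall>i<n. \<forall>j<n. v i j \<in> V) \<longrightarrow>
        NW n (\<lambda>i j. F (v i j)) \<le> ennreal C * NV n v)"

text \<open>Isomorphisms of operator spaces; the map \<open>F\<close> is understood to be linear.\<close>

definition cb_isomorphism ::
    "'u set \<Rightarrow> (nat \<Rightarrow> (nat \<Rightarrow> nat \<Rightarrow> 'u) \<Rightarrow> ennreal) \<Rightarrow>
     'v set \<Rightarrow> (nat \<Rightarrow> (nat \<Rightarrow> nat \<Rightarrow> 'v) \<Rightarrow> ennreal) \<Rightarrow> ('u \<Rightarrow> 'v) \<Rightarrow> bool" where
  "cb_isomorphism V NV W NW F \<longleftrightarrow>
     bij_betw F V W \<and> completely_bounded V NV NW F \<and>
     completely_bounded W NW NV (inv_into V F)"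


section \<open>The Fourier algebra\<close>

text \<open>
  The predual of \<open>VN(G)\<close>: the normal functionals, that is, the restrictions to \<open>VN(G)\<close> of
  \<open>S \<mapsto> \<Sum>k. \<langle>S \<xi>\<^sub>k, \<eta>\<^sub>k\<rangle>\<close> with \<open>(\<xi>\<^sub>k)\<close> and \<open>(\<eta>\<^sub>k)\<close> square-summable. Values outside \<open>VN(G)\<close> are
  irrelevant.
\<close>

definition VN_predual ::
    "('g, 'm) monoid_scheme \<Rightarrow> 'g topology \<Rightarrow> ('g operator \<Rightarrow> complex) set" where
  "VN_predual G T = (let M = haar_measure G T in
     {\<phi>. \<exists>\<xi> \<eta> :: nat \<Rightarrow> 'g \<Rightarrow> complex.
        (\<forall>k. \<xi> k \<in> L2 M \<and> \<eta> k \<in> L2 M) \<and>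
        summable (\<lambda>k. (L2_norm M (\<xi> k))\<^sup>2) \<and> summable (\<lambda>k. (L2_norm M (\<eta> k))\<^sup>2) \<and>
        (\<forall>S\<in>group_VN G T. \<phi> S = (\<Sum>k. L2_inner M (S (\<xi> k)) (\<eta> k)))})"

text \<open>
  The operator space structure of the predual: a matrix of functionals has the completely bounded
  norm of the induced map from \<open>VN(G)\<close> to the \<open>n \<times> n\<close> matrices.
\<close>

definition VN_predual_norm ::
    "('g, 'm) monoid_scheme \<Rightarrow> 'g topology \<Rightarrow> nat \<Rightarrow> (nat \<Rightarrow> nat \<Rightarrow> 'g operator \<Rightarrow> complex) \<Rightarrow> ennreal"
  where
  "VN_predual_norm G T n \<phi> =
     (SUP (m, S)\<in>{(m, S). (\<forall>k<m. \<forall>l<m. S k l \<in> group_VN G T) \<and>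
                          op_mat_norm (haar_measure G T) m S \<le> 1}.
        scalar_mat_norm ({..<n} \<times> {..<m}) (\<lambda>(i, k) (j, l). \<phi> i j (S k l)))"

definition predual_function ::
    "('g, 'm) monoid_scheme \<Rightarrow> ('g operator \<Rightarrow> complex) \<Rightarrow> 'g \<Rightarrow> complex" where
  "predual_function G \<phi> = (\<lambda>g\<in>carrier G. \<phi> (left_regular G g))"

definition fourier_algebra ::
    "('g, 'm) monoid_scheme \<Rightarrow> 'g topology \<Rightarrow> ('g \<Rightarrow> complex) set" where
  "fourier_algebra G T = predual_function G ` VN_predual G T"

text \<open>
  The identification of the predual with the Fourier algebra is one-to-one, since the operators
  \<open>\<lambda>(g)\<close> span an ultraweakly dense subspace of \<open>VN(G)\<close>. The infimum therefore merely transports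
  the norm: all matrices \<open>\<phi>\<close> over which it is taken coincide on \<open>VN(G)\<close>.
\<close>

definition fourier_norm ::
    "('g, 'm) monoid_scheme \<Rightarrow> 'g topology \<Rightarrow> nat \<Rightarrow> (nat \<Rightarrow> nat \<Rightarrow> 'g \<Rightarrow> complex) \<Rightarrow> ennreal" where
  "fourier_norm G T n u =
     (INF \<phi>\<in>{\<phi>. \<forall>i<n. \<forall>j<n. \<phi> i j \<in> VN_predual G T \<and> predual_function G (\<phi> i j) = u i j}.
        VN_predual_norm G T n \<phi>)"


section \<open>Restriction to a closed subset\<close>

definition fourier_ideal ::
    "('g, 'm) monoid_scheme \<Rightarrow> 'g topology \<Rightarrow> 'g set \<Rightarrow> ('g \<Rightarrow> complex) set" where
  "fourier_ideal G T E = {u \<in> fourier_algebra G T. \<forall>g\<in>E. u g = 0}"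

definition fourier_quotient ::
    "('g, 'm) monoid_scheme \<Rightarrow> 'g topology \<Rightarrow> 'g set \<Rightarrow> ('g \<Rightarrow> complex) set set" where
  "fourier_quotient G T E = fourier_algebra G T //
     {(u, v). u \<in> fourier_algebra G T \<and> v \<in> fourier_algebra G T \<and>
              (\<lambda>g\<in>carrier G. u g - v g) \<in> fourier_ideal G T E}"

definition fourier_quotient_norm ::
    "('g, 'm) monoid_scheme \<Rightarrow> 'g topology \<Rightarrow> nat \<Rightarrow> (nat \<Rightarrow> nat \<Rightarrow> ('g \<Rightarrow> complex) set) \<Rightarrow> ennreal"
  where
  "fourier_quotient_norm G T n U =
     (INF u\<in>{u. \<forall>i<n. \<forall>j<n. u i j \<in> U i j}. fourier_norm G T n u)"

definition C0 :: "'g topology \<Rightarrow> 'g set \<Rightarrow> ('g \<Rightarrow> complex) set" where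
  "C0 T E = {f \<in> extensional E.
     continuous_map (subtopology T E) euclidean f \<and>
     (\<forall>\<epsilon>>0. compactin T {x \<in> E. \<epsilon> \<le> cmod (f x)})}"

definition C0_norm :: "'g set \<Rightarrow> nat \<Rightarrow> (nat \<Rightarrow> nat \<Rightarrow> 'g \<Rightarrow> complex) \<Rightarrow> ennreal" where
  "C0_norm E n f = (SUP x\<in>E. scalar_mat_norm {..<n} (\<lambda>i j. f i j x))"

text \<open>A coset is sent to the common restriction of its members.\<close>

definition inc_map :: "'g set \<Rightarrow> ('g \<Rightarrow> complex) set \<Rightarrow> 'g \<Rightarrow> complex" where
  "inc_map E U = restrict (SOME u. u \<in> U) E"

definition cb_Helson :: "('g, 'm) monoid_scheme \<Rightarrow> 'g topology \<Rightarrow> 'g set \<Rightarrow> bool" where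
  "cb_Helson G T E \<longleftrightarrow> closedin T E \<and>
     cb_isomorphism (fourier_quotient G T E) (fourier_quotient_norm G T)
                    (C0 T E) (C0_norm E) (inc_map E)"

text \<open>
  HOL cannot quantify existentially over types, so the group has to be found inside a fixed type
  depending on the type of points of \<open>\<Omega>\<close>. The type below is large enough for products of matrix
  groups indexed by matrix-valued functions on \<open>\<Omega>\<close> together with their sizes.
\<close>

type_synonym 'a matrix_family =
  "nat \<times> ('a \<Rightarrow> nat \<Rightarrow> nat \<Rightarrow> complex) \<Rightarrow> nat \<Rightarrow> nat \<Rightarrow> complex"

end

theory Submission
  imports Defs
begin

text \<open>
  Let \<open>G\<close> be the identity component of a product of unitary groups, one factor \<open>U(n)\<close> for every
  continuous map \<open>h\<close> from \<open>\<Omega>\<close> to the self-adjoint \<open>n \<times> n\<close> matrices of norm at most \<open>1/2\<close>, and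
  embed \<open>\<Omega>\<close> by sending \<open>x\<close> to the family of the unitaries \<open>sqrt (1 - h(x)\<^sup>2) + i h(x)\<close>; the path
  \<open>t \<mapsto> t h\<close> shows that the image lies in \<open>G\<close>. The matrix of coefficients of a coordinate projection
  \<open>G \<rightarrow> U(n)\<close> has norm at most \<open>1\<close> over \<open>A(G)\<close>, because the corresponding map on \<open>VN(G)\<close> is a
  compression of \<open>S \<mapsto> S \<otimes> 1\<close> by an isometry. A continuous \<open>n \<times> n\<close> matrix-valued function \<open>F\<close>
  of norm less than \<open>c\<close>, multiplied by \<open>-i / 2c\<close> and placed with its adjoint in the off-diagonal blocks
  of a \<open>2n \<times> 2n\<close> matrix, gives an admissible \<open>h\<close>. As \<open>h\<^sup>2\<close> is block diagonal, \<open>F\<close> is \<open>2c\<close> times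
  the corner of the corresponding unitary, so it lifts to \<open>A(G)\<close> with norm at most \<open>2c\<close>.
  For the functions in \<open>A(G)\<close> to be continuous one needs a genuine Haar measure, which is constructed
  from covering numbers.
\<close>

section \<open>Haar measure on compact groups\<close>

text \<open>The obstacle is uniformity in the matrix size. A bound for the inverse of the
  restriction map on scalar functions says nothing about its amplifications, so every matrix-valued
  function gets a coordinate of its own, and coefficients of a unitary representation are bounded
  over A(G) by a constant independent of their number. This is why the factors are unitary groups of
  all sizes and not circles. A contraction is rarely unitary and has to be completed to a unitary in
  a larger block; self-adjointness of that block matrix is what makes the square root formula
  unitary. The radius 1/2 keeps the square within norm 1/4, where the square root is the limit of an
  iteration with a geometric rate uniform in h: continuity on \<Omega>, self-adjointness and block
  shape pass to the limit and no spectral theory enters. The inverse of this radius is the factor 2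
  lost in the lift. Passing to the identity component gives connectedness without analysing U(n), at
  the price of a path to the identity from every embedded point. Finally,
  \<open>haar_measure\<close> is given by Hilbert choice, so nothing is known of it before some Haar
  measure has been exhibited.\<close>

locale compact_group = topological_group +
  assumes compact: "compact_space T"
begin

section \<open>Left translates of sets\<close>

definition translate :: "'a \<Rightarrow> 'a set \<Rightarrow> 'a set" where
  "translate a A = (\<lambda>x. a \<otimes> x) ` A"

lemma translate_subset: "a \<in> carrier G \<Longrightarrow> A \<subseteq> carrier G \<Longrightarrow> translate a A \<subseteq> carrier G"
  by (auto simp: translate_def)

lemma translate_translate:
  "\<lbrakk>a \<in> carrier G; b \<in> carrier G; A \<subseteq> carrier G\<rbrakk> \<Longrightarrow> translate a (translate b A) = translate (a \<otimes> b) A"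
  by (force simp: translate_def image_image m_assoc subset_iff intro!: image_cong)

lemma translate_one: "A \<subseteq> carrier G \<Longrightarrow> translate \<one> A = A"
  by (force simp: translate_def)

lemma translate_inv:
  assumes "a \<in> carrier G" "A \<subseteq> carrier G"
  shows "translate (inv a) (translate a A) = A" "translate a (translate (inv a) A) = A"
  using assms by (simp_all add: translate_translate translate_one)

lemma in_translate_iff:
  assumes "a \<in> carrier G" "A \<subseteq> carrier G"
  shows "y \<in> translate a A \<longleftrightarrow> y \<in> carrier G \<and> inv a \<otimes> y \<in> A"
proof
  assume "y \<in> translate a A"
  then show "y \<in> carrier G \<and> inv a \<otimes> y \<in> A"
    using assms by (force simp: translate_def m_assoc[symmetric] subset_iff)
next
  assume "y \<in> carrier G \<and> inv a \<otimes> y \<in> A"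
  moreover have "y = a \<otimes> (inv a \<otimes> y)" if "y \<in> carrier G"
    using that assms by (simp add: m_assoc[symmetric])
  ultimately show "y \<in> translate a A"
    by (auto simp: translate_def)
qed

lemma translate_mono: "A \<subseteq> B \<Longrightarrow> translate a A \<subseteq> translate a B"
  by (auto simp: translate_def)

lemma continuous_left_mult: "a \<in> carrier G \<Longrightarrow> continuous_map T T (\<lambda>x. a \<otimes> x)"
proof -
  assume a: "a \<in> carrier G"
  have "continuous_map T (prod_topology T T) (\<lambda>x. (a, x))"
    using a by (simp add: continuous_map_pairwise o_def topspace_eq)
  from continuous_map_compose[OF this continuous_mult] show ?thesis
    by (simp add: o_def)
qed

lemma openin_translate: "a \<in> carrier G \<Longrightarrow> openin T U \<Longrightarrow> openin T (translate a U)"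
proof -
  assume a: "a \<in> carrier G" and U: "openin T U"
  have "U \<subseteq> carrier G" using openin_subset[OF U] topspace_eq by simp
  then have "translate a U = {y \<in> topspace T. inv a \<otimes> y \<in> U}"
    using in_translate_iff[OF a] topspace_eq by auto
  then show ?thesis
    using openin_continuous_map_preimage[OF continuous_left_mult U] a by simp
qed

lemma compactin_translate: "a \<in> carrier G \<Longrightarrow> compactin T K \<Longrightarrow> compactin T (translate a K)"
  unfolding translate_def using image_compactin continuous_left_mult by blast

lemma compactin_carrier: "compactin T (carrier G)"
  using compact topspace_eq by (simp add: compact_space_def)

lemma compactin_subset: "compactin T K \<Longrightarrow> K \<subseteq> carrier G"
  using compactin_subset_topspace topspace_eq by blast

lemma openin_subset_carrier: "openin T U \<Longrightarrow> U \<subseteq> carrier G"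
  using openin_subset topspace_eq by blast

lemma compactin_iff_closedin: "compactin T K \<longleftrightarrow> closedin T K"
  using compact Hausdorff closedin_compact_space compactin_imp_closedin by blast

section \<open>Covering numbers and approximate contents\<close>

definition nbhds :: "'a set set" where
  "nbhds = {V. openin T V \<and> \<one> \<in> V}"

text \<open>This is Haar's index (K : V). The centres range over the whole group and need not lie in
  K. For V a neighbourhood of the identity and K inside the group, compactness makes the minimum one
  over a nonempty set.\<close>

definition covering_number :: "'a set \<Rightarrow> 'a set \<Rightarrow> nat" where
  "covering_number V K =
     (LEAST n. \<exists>A. finite A \<and> A \<subseteq> carrier G \<and> card A = n \<and> K \<subseteq> (\<Union>a\<in>A. translate a V))"

lemma carrier_in_nbhds: "carrier G \<in> nbhds"
  using openin_topspace[of T] by (simp add: nbhds_def topspace_eq)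

lemma nbhds_Int: "V \<in> nbhds \<Longrightarrow> W \<in> nbhds \<Longrightarrow> V \<inter> W \<in> nbhds"
  by (auto simp: nbhds_def)

lemma nbhds_subset: "V \<in> nbhds \<Longrightarrow> V \<subseteq> carrier G"
  using openin_subset_carrier by (auto simp: nbhds_def)

text \<open>The finite cover is extracted for the whole group, which is compact, so K may be an
  arbitrary subset.\<close>

lemma finite_cover_ex:
  assumes V: "V \<in> nbhds" and K: "K \<subseteq> carrier G"
  obtains A where "finite A" "A \<subseteq> carrier G" "K \<subseteq> (\<Union>a\<in>A. translate a V)"
proof -
  have op: "\<forall>U\<in>(\<lambda>a. translate a V) ` carrier G. openin T U"
    using V openin_translate by (auto simp: nbhds_def)
  have "x \<in> translate x V" if "x \<in> carrier G" for x
    using that V by (force simp: translate_def nbhds_def)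
  then have "carrier G \<subseteq> \<Union>((\<lambda>a. translate a V) ` carrier G)" by blast
  with op compactin_carrier obtain F where F: "finite F" "F \<subseteq> (\<lambda>a. translate a V) ` carrier G" "carrier G \<subseteq> \<Union>F"
    unfolding compactin_def by metis
  then obtain A where "A \<subseteq> carrier G" "finite A" "F = (\<lambda>a. translate a V) ` A"
    by (meson finite_subset_image)
  with F K show ?thesis by (intro that[of A]) auto
qed

lemma covering_number_attained:
  assumes "V \<in> nbhds" "K \<subseteq> carrier G"
  obtains A where "finite A" "A \<subseteq> carrier G" "card A = covering_number V K"
    "K \<subseteq> (\<Union>a\<in>A. translate a V)"
proof -
  have "\<exists>n A. finite A \<and> A \<subseteq> carrier G \<and> card A = n \<and> K \<subseteq> (\<Union>a\<in>A. translate a V)"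
    using finite_cover_ex[OF assms] by metis
  from LeastI_ex[OF this] show ?thesis
    using that unfolding covering_number_def by blast
qed

lemma covering_number_le:
  "\<lbrakk>finite A; A \<subseteq> carrier G; K \<subseteq> (\<Union>a\<in>A. translate a V)\<rbrakk> \<Longrightarrow> covering_number V K \<le> card A"
  unfolding covering_number_def by (rule Least_le) blast

lemma covering_number_mono:
  assumes "V \<in> nbhds" "K \<subseteq> L" "L \<subseteq> carrier G"
  shows "covering_number V K \<le> covering_number V L"
  using covering_number_attained[OF assms(1,3)] covering_number_le assms(2) by (metis order_trans)

lemma covering_number_Un_le:
  assumes V: "V \<in> nbhds" and K: "K \<subseteq> carrier G" and L: "L \<subseteq> carrier G"
  shows "covering_number V (K \<union> L) \<le> covering_number V K + covering_number V L"
proof -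
  obtain A where A: "finite A" "A \<subseteq> carrier G" "card A = covering_number V K"
    "K \<subseteq> (\<Union>a\<in>A. translate a V)" using covering_number_attained[OF V K] .
  obtain B where B: "finite B" "B \<subseteq> carrier G" "card B = covering_number V L"
    "L \<subseteq> (\<Union>a\<in>B. translate a V)" using covering_number_attained[OF V L] .
  have "covering_number V (K \<union> L) \<le> card (A \<union> B)"
    by (rule covering_number_le) (use A B in auto)
  also have "\<dots> \<le> card A + card B" by (rule card_Un_le)
  finally show ?thesis using A B by simp
qed

text \<open>In an optimal cover of the union no translate of V serves both sets, so the translates
  meeting K and those meeting L form disjoint subfamilies, each covering its own set.\<close>

lemma covering_number_Un_eq:
  assumes V: "V \<in> nbhds" and K: "K \<subseteq> carrier G" and L: "L \<subseteq> carrier G"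
    and sep: "\<And>a. a \<in> carrier G \<Longrightarrow> translate a V \<inter> K = {} \<or> translate a V \<inter> L = {}"
  shows "covering_number V (K \<union> L) = covering_number V K + covering_number V L"
proof (rule antisym[OF covering_number_Un_le[OF V K L]])
  obtain A where A: "finite A" "A \<subseteq> carrier G" "card A = covering_number V (K \<union> L)"
    "K \<union> L \<subseteq> (\<Union>a\<in>A. translate a V)" using covering_number_attained[OF V] K L by (metis Un_least)
  define A1 where "A1 = {a \<in> A. translate a V \<inter> K \<noteq> {}}"
  define A2 where "A2 = {a \<in> A. translate a V \<inter> L \<noteq> {}}"
  have "covering_number V K \<le> card A1" "covering_number V L \<le> card A2"
    using A by (auto intro!: covering_number_le simp: A1_def A2_def) blast+
  moreover have "A1 \<inter> A2 = {}" using sep A by (auto simp: A1_def A2_def)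
  then have "card A1 + card A2 = card (A1 \<union> A2)"
    using A by (simp add: card_Un_disjoint A1_def A2_def)
  moreover have "card (A1 \<union> A2) \<le> card A"
    using A by (intro card_mono) (auto simp: A1_def A2_def)
  ultimately show "covering_number V K + covering_number V L \<le> covering_number V (K \<union> L)"
    using A by linarith
qed

text \<open>Left multiplication by g carries a cover by translates of V to another one of no larger
  cardinality; the reverse inequality is the same fact for \<open>inv g\<close>.\<close>

lemma covering_number_translate:
  assumes V: "V \<in> nbhds" and K: "K \<subseteq> carrier G" and g: "g \<in> carrier G"
  shows "covering_number V (translate g K) = covering_number V K"
proof -
  have le: "covering_number V (translate g K) \<le> covering_number V K"
    if K: "K \<subseteq> carrier G" and g: "g \<in> carrier G" for g K
  proof -
    obtain A where A: "finite A" "A \<subseteq> carrier G" "card A = covering_number V K"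
      "K \<subseteq> (\<Union>a\<in>A. translate a V)" using covering_number_attained[OF V K] .
    have "translate g K \<subseteq> translate g (\<Union>a\<in>A. translate a V)"
      using A by (intro translate_mono)
    also have "\<dots> = (\<Union>a\<in>A. translate g (translate a V))"
      by (auto simp: translate_def)
    also have "\<dots> = (\<Union>b\<in>(\<otimes>) g ` A. translate b V)"
      using A g nbhds_subset[OF V] by (auto simp: translate_translate subset_iff)
    finally have "covering_number V (translate g K) \<le> card ((\<otimes>) g ` A)"
      using A g by (intro covering_number_le) auto
    also have "\<dots> \<le> card A" using A by (intro card_image_le)
    finally show ?thesis using A by simp
  qed
  have "covering_number V K = covering_number V (translate (inv g) (translate g K))"
    using K g by (simp add: translate_inv)
  also have "\<dots> \<le> covering_number V (translate g K)"
    using K g translate_subset by (intro le) auto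
  finally show ?thesis using le[OF K g] by simp
qed

lemma covering_number_empty: "covering_number V {} = 0"
  using covering_number_le[of "{}" "{}" V] by simp

lemma covering_number_carrier_pos:
  assumes "V \<in> nbhds" shows "covering_number V (carrier G) > 0"
proof (rule ccontr)
  assume "\<not> ?thesis"
  then have "covering_number V (carrier G) = 0" by simp
  then obtain A where "finite A" "card A = 0" "carrier G \<subseteq> (\<Union>a\<in>A. translate a V)"
    using covering_number_attained[OF assms, of "carrier G"] by (metis order_refl)
  then show False using one_closed by auto
qed

text \<open>The products of an inverse from K with an element of L form a compact set that omits the
  identity, so \<open>inv x \<otimes> y\<close> avoids this set for x, y in some neighbourhood W of
  the identity. Since \<open>inv x \<otimes> y\<close> does not change when x and y are both
  multiplied by a on the left, no translate of W can meet both K and L.\<close>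

lemma separating_nbhd:
  assumes K: "compactin T K" and L: "compactin T L" and disj: "K \<inter> L = {}"
  obtains W where "W \<in> nbhds"
    "\<And>a V. \<lbrakk>a \<in> carrier G; V \<subseteq> W\<rbrakk> \<Longrightarrow> translate a V \<inter> K = {} \<or> translate a V \<inter> L = {}"
proof -
  define q where "q = (\<lambda>(x, y). inv x \<otimes> y)"
  have q: "continuous_map (prod_topology T T) T q"
  proof -
    have "continuous_map (prod_topology T T) (prod_topology T T) (\<lambda>(x, y). (inv x, y))"
      using continuous_map_compose[OF continuous_map_fst continuous_inv, of T]
      by (auto simp: continuous_map_pairwise o_def case_prod_unfold continuous_map_snd)
    from continuous_map_compose[OF this continuous_mult] show ?thesis
      by (simp add: o_def q_def case_prod_unfold)
  qed
  have Ks: "K \<subseteq> carrier G" and Ls: "L \<subseteq> carrier G"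
    using K L by (auto dest: compactin_subset)
  have "compactin T (q ` (K \<times> L))"
    using K L by (intro image_compactin[OF _ q]) (simp add: compactin_Times)
  then have op: "openin T (carrier G - q ` (K \<times> L))"
    using compactin_iff_closedin topspace_eq by (metis closedin_def)
  have "\<one> \<notin> q ` (K \<times> L)"
  proof
    assume "\<one> \<in> q ` (K \<times> L)"
    then obtain x y where xy: "x \<in> K" "y \<in> L" "inv x \<otimes> y = \<one>" by (auto simp: q_def)
    then have "y = x" using Ks Ls by (metis inv_closed inv_equality inv_inv subsetD)
    with xy disj show False by auto
  qed
  then have one: "(\<one>, \<one>) \<in> {p \<in> topspace (prod_topology T T). q p \<in> carrier G - q ` (K \<times> L)}"
    by (simp add: topspace_eq q_def)
  have "openin (prod_topology T T) {p \<in> topspace (prod_topology T T). q p \<in> carrier G - q ` (K \<times> L)}"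
    by (rule openin_continuous_map_preimage[OF q op])
  from this[unfolded openin_prod_topology_alt, rule_format, OF one]
  obtain U1 U2 where U: "openin T U1" "openin T U2" "\<one> \<in> U1" "\<one> \<in> U2"
    "U1 \<times> U2 \<subseteq> {p \<in> topspace (prod_topology T T). q p \<in> carrier G - q ` (K \<times> L)}"
    by blast
  show ?thesis
  proof (rule that[of "U1 \<inter> U2"])
    show "U1 \<inter> U2 \<in> nbhds" using U by (auto simp: nbhds_def)
    fix a V assume a: "a \<in> carrier G" and V: "V \<subseteq> U1 \<inter> U2"
    show "translate a V \<inter> K = {} \<or> translate a V \<inter> L = {}"
    proof (rule ccontr)
      assume "\<not> ?thesis"
      then obtain x y where xy: "x \<in> V" "y \<in> V" "a \<otimes> x \<in> K" "a \<otimes> y \<in> L"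
        by (auto simp: translate_def)
      have xyc: "x \<in> carrier G" "y \<in> carrier G"
        using xy V U(1) openin_subset_carrier by blast+
      have "inv x \<otimes> y = inv (a \<otimes> x) \<otimes> (a \<otimes> y)"
        using xyc a by (simp add: inv_mult_group m_assoc[symmetric])
          (simp add: m_assoc)
      also have "\<dots> = q (a \<otimes> x, a \<otimes> y)" by (simp add: q_def)
      finally have "q (x, y) \<in> q ` (K \<times> L)" using xy by (auto simp: q_def)
      moreover have "(x, y) \<in> U1 \<times> U2" using xy V by auto
      ultimately show False using U(5) by blast
    qed
  qed
qed

text \<open>Intersecting with the carrier keeps the quotient in the unit interval for every
  argument, so that all approximate contents lie in one compact cube.\<close>

definition approx_content :: "'a set \<Rightarrow> 'a set \<Rightarrow> real" where
  "approx_content V K = real (covering_number V (K \<inter> carrier G)) / real (covering_number V (carrier G))"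

lemma approx_content_bounds: "V \<in> nbhds \<Longrightarrow> approx_content V K \<in> {0..1}"
  using covering_number_mono[of V "K \<inter> carrier G" "carrier G"]
  by (auto simp: approx_content_def divide_simps)

end

text \<open>Additivity is asked for disjoint compact sets only: these are the pairs that all small
  neighbourhoods of the identity separate, so that their covering numbers add up.\<close>

locale invariant_content = compact_group +
  fixes h :: "'a set \<Rightarrow> real"
  assumes h_nonneg: "\<And>K. 0 \<le> h K" and h_le_1: "\<And>K. h K \<le> 1"
    and h_empty: "h {} = 0" and h_carrier: "h (carrier G) = 1"
    and h_mono: "\<And>K L. \<lbrakk>K \<subseteq> L; L \<subseteq> carrier G\<rbrakk> \<Longrightarrow> h K \<le> h L"
    and h_Un_le: "\<And>K L. \<lbrakk>K \<subseteq> carrier G; L \<subseteq> carrier G\<rbrakk> \<Longrightarrow> h (K \<union> L) \<le> h K + h L"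
    and h_Un_eq: "\<And>K L. \<lbrakk>compactin T K; compactin T L; K \<inter> L = {}\<rbrakk> \<Longrightarrow> h (K \<union> L) = h K + h L"
    and h_translate: "\<And>g K. \<lbrakk>g \<in> carrier G; K \<subseteq> carrier G\<rbrakk> \<Longrightarrow> h (translate g K) = h K"

text \<open>The approximate contents are points of a cube that is compact by Tychonoff, indexed by
  the neighbourhoods of the identity. No sequence of neighbourhoods need be cofinal, so instead of a
  limit of a sequence h is a point common to the closures of all tails.\<close>

lemma (in compact_group) invariant_content_exists: "\<exists>h. invariant_content G T h"
proof -
  define C where "C V = closure (approx_content ` {W \<in> nbhds. W \<subseteq> V})" for V
  have box: "compact (PiE UNIV (\<lambda>_::'a set. {0..1::real}))"
    by (metis (no_types, lifting) compact_space_subtopology compactin_PiE compactin_euclidean_iff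
        compact_Icc euclidean_product_topology UNIV_I)
  have "PiE UNIV (\<lambda>_::'a set. {0..1::real}) \<inter> (\<Inter>V\<in>nbhds. C V) \<noteq> {}"
  proof (rule compact_imp_fip_image[OF box])
    show "closed (C V)" for V by (simp add: C_def)
    fix I assume I: "finite I" "I \<subseteq> nbhds"
    \<comment> \<open>Finitely many neighbourhoods contain a common one, whose approximate content
      lies in all the corresponding tails.\<close>
    have "\<exists>W\<in>nbhds. \<forall>V\<in>I. W \<subseteq> V" using I
    proof (induction I rule: finite_induct)
      case empty then show ?case using carrier_in_nbhds by auto
    next
      case (insert V I)
      then obtain W where W: "W \<in> nbhds" "\<forall>V\<in>I. W \<subseteq> V" by auto
      then show ?case using insert nbhds_Int[of V W]
        by (intro bexI[of _ "V \<inter> W"]) auto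
    qed
    then obtain W where W: "W \<in> nbhds" "\<forall>V\<in>I. W \<subseteq> V" by blast
    then have "approx_content W \<in> C V" if "V \<in> I" for V
      unfolding C_def using that by (intro subsetD[OF closure_subset]) auto
    moreover have "approx_content W \<in> PiE UNIV (\<lambda>_::'a set. {0..1::real})"
      using approx_content_bounds[OF W(1)] by auto
    ultimately show "PiE UNIV (\<lambda>_::'a set. {0..1::real}) \<inter> (\<Inter>V\<in>I. C V) \<noteq> {}" by blast
  qed
  then obtain h where hb: "h \<in> PiE UNIV (\<lambda>_::'a set. {0..1::real})" and hC: "\<And>V. V \<in> nbhds \<Longrightarrow> h \<in> C V"
    by blast
  \<comment> \<open>Each axiom of a content is a closed condition in the product topology, so h
    inherits it as soon as it holds for all sufficiently small neighbourhoods.\<close>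
  have limit: "P h" if "closed {h. P h}" "V \<in> nbhds" "\<And>W. W \<in> nbhds \<Longrightarrow> W \<subseteq> V \<Longrightarrow> P (approx_content W)"
    for P :: "('a set \<Rightarrow> real) \<Rightarrow> bool" and V
  proof -
    have "C V \<subseteq> {h. P h}" unfolding C_def by (rule closure_minimal) (use that in auto)
    with hC[OF that(2)] show ?thesis by blast
  qed
  have int: "K \<inter> carrier G = K" if "K \<subseteq> carrier G" for K using that by blast
  note cl = closed_Collect_eq closed_Collect_le continuous_on_add continuous_on_product_coordinates continuous_on_const
  have "invariant_content G T h"
  proof
    show "0 \<le> h K" "h K \<le> 1" for K using hb by (auto simp: PiE_iff)
    show "h {} = 0"
      by (rule limit[OF _ carrier_in_nbhds]) (intro cl, simp add: approx_content_def covering_number_empty)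
    show "h (carrier G) = 1"
      by (rule limit[OF _ carrier_in_nbhds])
        (intro cl, use covering_number_carrier_pos in \<open>force simp: approx_content_def\<close>)
    show "h K \<le> h L" if "K \<subseteq> L" "L \<subseteq> carrier G" for K L
      by (rule limit[OF _ carrier_in_nbhds])
        (intro cl, use that in \<open>auto simp: approx_content_def int intro!: divide_right_mono covering_number_mono\<close>)
    show "h (K \<union> L) \<le> h K + h L" if "K \<subseteq> carrier G" "L \<subseteq> carrier G" for K L
    proof (rule limit[OF _ carrier_in_nbhds])
      fix W assume "W \<in> nbhds"
      from covering_number_Un_le[OF this that]
      show "approx_content W (K \<union> L) \<le> approx_content W K + approx_content W L"
        using that by (simp add: approx_content_def int add_divide_distrib[symmetric] divide_right_mono)
    qed (intro cl)
    show "h (translate g K) = h K" if "g \<in> carrier G" "K \<subseteq> carrier G" for g K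
      by (rule limit[OF _ carrier_in_nbhds])
        (intro cl, use that translate_subset in \<open>simp add: approx_content_def int covering_number_translate\<close>)
    show "h (K \<union> L) = h K + h L" if KL: "compactin T K" "compactin T L" "K \<inter> L = {}" for K L
    proof -
      \<comment> \<open>Additivity is the one axiom whose tail depends on the sets: it holds from a
        neighbourhood separating K and L onwards.\<close>
      obtain V where V: "V \<in> nbhds"
        and sep: "\<And>a W. \<lbrakk>a \<in> carrier G; W \<subseteq> V\<rbrakk> \<Longrightarrow> translate a W \<inter> K = {} \<or> translate a W \<inter> L = {}"
        using separating_nbhd[OF KL] by metis
      have s: "K \<subseteq> carrier G" "L \<subseteq> carrier G" using KL by (auto dest: compactin_subset)
      show ?thesis
      proof (rule limit[OF _ V])
        fix W assume W: "W \<in> nbhds" "W \<subseteq> V"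
        from covering_number_Un_eq[OF W(1) s sep[OF _ W(2)]]
        show "approx_content W (K \<union> L) = approx_content W K + approx_content W L"
          using s by (simp add: approx_content_def int add_divide_distrib[symmetric])
      qed (intro cl)
    qed
  qed
  then show ?thesis by blast
qed

section \<open>From the content to a Borel measure\<close>

context invariant_content
begin

text \<open>A cluster point of the approximate contents need not be regular, so the measure is built
  from values on open sets; on a compact set the resulting measure may exceed h.\<close>

definition inner_content :: "'a set \<Rightarrow> ennreal" where
  "inner_content U = (SUP K\<in>{K. compactin T K \<and> K \<subseteq> U}. ennreal (h K))"

definition outer_content :: "'a set \<Rightarrow> ennreal" where
  "outer_content A = (INF U\<in>{U. openin T U \<and> A \<subseteq> U}. inner_content U)"

lemma content_le_inner: "compactin T K \<Longrightarrow> K \<subseteq> U \<Longrightarrow> ennreal (h K) \<le> inner_content U"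
  unfolding inner_content_def by (rule SUP_upper) simp

lemma inner_content_mono: "U \<subseteq> V \<Longrightarrow> inner_content U \<le> inner_content V"
  unfolding inner_content_def by (rule SUP_subset_mono) auto

lemma inner_content_le_1: "inner_content U \<le> 1"
  unfolding inner_content_def by (rule SUP_least) (simp add: h_le_1)

text \<open>The closed sets \<open>K - U\<close> and \<open>K - V\<close> are disjoint, and compact
  Hausdorff spaces are normal; removing disjoint neighbourhoods of them from K leaves the two
  pieces.\<close>

lemma compact_split:
  assumes K: "compactin T K" and U: "openin T U" and V: "openin T V" and sub: "K \<subseteq> U \<union> V"
  obtains K1 K2 where "compactin T K1" "compactin T K2" "K1 \<subseteq> U" "K2 \<subseteq> V" "K = K1 \<union> K2"
proof -
  have n: "normal_space T"
    using compact Hausdorff compact_Hausdorff_or_regular_imp_normal_space by blast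
  have "closedin T (K - U)" "closedin T (K - V)" "disjnt (K - U) (K - V)"
    using K U V sub by (auto simp: compactin_iff_closedin closedin_diff disjnt_def)
  with n obtain A B where AB: "openin T A" "openin T B" "K - U \<subseteq> A" "K - V \<subseteq> B" "disjnt A B"
    unfolding normal_space_def by metis
  show ?thesis
    by (rule that[of "K - A" "K - B"])
      (use K AB in \<open>auto simp: compactin_iff_closedin closedin_diff disjnt_def\<close>)
qed

lemma inner_content_Un:
  assumes U: "openin T U" and V: "openin T V"
  shows "inner_content (U \<union> V) \<le> inner_content U + inner_content V"
  unfolding inner_content_def[of "U \<union> V"]
proof (rule SUP_least)
  fix K assume "K \<in> {K. compactin T K \<and> K \<subseteq> U \<union> V}"
  then obtain K1 K2 where K: "compactin T K1" "compactin T K2" "K1 \<subseteq> U" "K2 \<subseteq> V" "K = K1 \<union> K2"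
    using compact_split[OF _ U V] by (metis mem_Collect_eq)
  then have "ennreal (h K) \<le> ennreal (h K1 + h K2)"
    using h_Un_le compactin_subset by (simp add: ennreal_leI)
  also have "\<dots> = ennreal (h K1) + ennreal (h K2)" by (simp add: h_nonneg)
  also have "\<dots> \<le> inner_content U + inner_content V"
    using K by (intro add_mono content_le_inner)
  finally show "ennreal (h K) \<le> inner_content U + inner_content V" .
qed

lemma inner_content_empty: "inner_content {} = 0"
  by (simp add: inner_content_def h_empty)

lemma inner_content_finite_UN:
  assumes "\<And>i::nat. openin T (U i)"
  shows "inner_content (\<Union>i<n. U i) \<le> (\<Sum>i<n. inner_content (U i))"
proof (induction n)
  case 0 then show ?case by (simp add: inner_content_empty)
next
  case (Suc n)
  have "inner_content (\<Union>i<Suc n. U i) \<le> inner_content (\<Union>i<n. U i) + inner_content (U n)"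
    using inner_content_Un[OF openin_Union assms, of "U ` {..<n}" n] assms
    by (auto simp: lessThan_Suc Un_commute)
  also have "\<dots> \<le> (\<Sum>i<n. inner_content (U i)) + inner_content (U n)"
    by (intro add_mono Suc order_refl)
  finally show ?case by simp
qed

lemma inner_content_UN:
  assumes U: "\<And>i::nat. openin T (U i)"
  shows "inner_content (\<Union>i. U i) \<le> (\<Sum>i. inner_content (U i))"
  unfolding inner_content_def[of "\<Union>i. U i"]
proof (rule SUP_least)
  fix K assume "K \<in> {K. compactin T K \<and> K \<subseteq> (\<Union>i. U i)}"
  then have K: "compactin T K" "K \<subseteq> \<Union>(range U)" by auto
  then obtain F where F: "finite F" "F \<subseteq> range U" "K \<subseteq> \<Union>F"
    unfolding compactin_def using U by (metis imageE)
  then obtain I where I: "finite I" "F = U ` I" by (meson finite_subset_image)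
  obtain n where "I \<subseteq> {..<n}" using I finite_nat_iff_bounded by metis
  then have "K \<subseteq> (\<Union>i<n. U i)" using I F by blast
  then have "ennreal (h K) \<le> inner_content (\<Union>i<n. U i)" using K content_le_inner by blast
  also have "\<dots> \<le> (\<Sum>i<n. inner_content (U i))" by (rule inner_content_finite_UN[OF U])
  also have "\<dots> \<le> (\<Sum>i. inner_content (U i))" by (rule sum_le_suminf) auto
  finally show "ennreal (h K) \<le> (\<Sum>i. inner_content (U i))" .
qed

lemma outer_content_le: "openin T U \<Longrightarrow> A \<subseteq> U \<Longrightarrow> outer_content A \<le> inner_content U"
  unfolding outer_content_def by (rule INF_lower) simp

lemma outer_content_open: "openin T U \<Longrightarrow> outer_content U = inner_content U"
  by (rule antisym, simp add: outer_content_le)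
    (auto simp: outer_content_def intro!: INF_greatest inner_content_mono)

lemma outer_content_mono: "A \<subseteq> B \<Longrightarrow> outer_content A \<le> outer_content B"
  unfolding outer_content_def by (rule INF_superset_mono) auto

lemma outer_content_approx:
  assumes A: "A \<subseteq> carrier G" and e: "e > 0"
  obtains U where "openin T U" "A \<subseteq> U" "inner_content U \<le> outer_content A + ennreal e"
proof -
  have "outer_content A \<le> 1"
    using outer_content_le[of "carrier G" A] A openin_topspace[of T] topspace_eq inner_content_le_1 order_trans by metis
  \<comment> \<open>Strictness rests on the outer content being finite, here at most 1.\<close>
  then have "outer_content A < outer_content A + ennreal e"
    using e by (cases "outer_content A") (auto simp: ennreal_plus[symmetric] ennreal_lessI top_unique simp del: ennreal_plus)
  then show ?thesis
    using that unfolding outer_content_def[of A] INF_less_iff by (auto dest: less_imp_le)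
qed

lemma outer_measure: "outer_measure_space (Pow (carrier G)) outer_content"
  unfolding outer_measure_space_def
proof (intro conjI)
  show "positive (Pow (carrier G)) outer_content"
    by (simp add: positive_def outer_content_open inner_content_empty)
  show "increasing (Pow (carrier G)) outer_content"
    by (simp add: increasing_def outer_content_mono)
  show "countably_subadditive (Pow (carrier G)) outer_content"
    unfolding countably_subadditive_def
  proof (intro allI impI)
    fix A :: "nat \<Rightarrow> 'a set" assume A: "range A \<subseteq> Pow (carrier G)"
    show "outer_content (\<Union>i. A i) \<le> (\<Sum>i. outer_content (A i))"
    proof (rule ennreal_le_epsilon)
      fix e :: real assume e: "0 < e"
      have "\<exists>U. openin T U \<and> A i \<subseteq> U \<and> inner_content U \<le> outer_content (A i) + ennreal (e * (1/2)^Suc i)" for i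
      proof -
        have "A i \<subseteq> carrier G" "0 < e * (1/2)^Suc i" using A e by auto
        then show ?thesis using outer_content_approx by metis
      qed
      then obtain U where U: "\<And>i. openin T (U i)" "\<And>i. A i \<subseteq> U i"
        "\<And>i. inner_content (U i) \<le> outer_content (A i) + ennreal (e * (1/2)^Suc i)"
        by metis
      have "outer_content (\<Union>i. A i) \<le> inner_content (\<Union>i. U i)"
        using U by (intro outer_content_le) (auto intro!: openin_Union)
      also have "\<dots> \<le> (\<Sum>i. inner_content (U i))" by (rule inner_content_UN[OF U(1)])
      also have "\<dots> \<le> (\<Sum>i. outer_content (A i) + ennreal (e * (1/2)^Suc i))"
        by (intro suminf_le U) auto
      also have "\<dots> = (\<Sum>i. outer_content (A i)) + (\<Sum>i. ennreal (e * (1/2)^Suc i))"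
        by (rule suminf_add[symmetric]) auto
      also have "(\<Sum>i. ennreal (e * (1/2)^Suc i)) = ennreal e"
        using sums_mult[OF power_half_series, of e] e by (intro suminf_ennreal_eq) auto
      finally show "outer_content (\<Union>i. A i) \<le> (\<Sum>i. outer_content (A i)) + ennreal e" .
    qed
  qed
qed

text \<open>Caratheodory's criterion is checked on open test sets W: a compact K inside
  \<open>W \<inter> U\<close> and then a compact L inside \<open>W - K\<close> are disjoint, so
  additivity of h bounds the sum of their contents by the inner content of W. As the outer content
  is an infimum over open sets, this extends to all test sets.\<close>

lemma open_in_lambda_system:
  assumes U: "openin T U"
  shows "U \<in> lambda_system (carrier G) (Pow (carrier G)) outer_content"
proof -
  have Uc: "U \<subseteq> carrier G" using U by (rule openin_subset_carrier)
  interpret sigma_algebra "carrier G" "Pow (carrier G)" by (rule sigma_algebra_Pow)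
  have *: "inner_content (W \<inter> U) + outer_content (W - U) \<le> inner_content W" if W: "openin T W" for W
    unfolding inner_content_def[of "W \<inter> U"]
  proof (subst ennreal_SUP_add_left[symmetric])
    show "{K. compactin T K \<and> K \<subseteq> W \<inter> U} \<noteq> {}" using compactin_empty by blast
    show "(SUP K\<in>{K. compactin T K \<and> K \<subseteq> W \<inter> U}. ennreal (h K) + outer_content (W - U)) \<le> inner_content W"
    proof (rule SUP_least)
      fix K assume "K \<in> {K. compactin T K \<and> K \<subseteq> W \<inter> U}"
      then have K: "compactin T K" "K \<subseteq> W \<inter> U" by auto
      have "outer_content (W - U) \<le> inner_content (W - K)"
        using K W by (intro outer_content_le) (auto simp: compactin_iff_closedin openin_diff)
      then have "ennreal (h K) + outer_content (W - U) \<le> ennreal (h K) + inner_content (W - K)"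
        by (rule add_left_mono)
      also have "\<dots> = (SUP L\<in>{L. compactin T L \<and> L \<subseteq> W - K}. ennreal (h K) + ennreal (h L))"
        unfolding inner_content_def by (rule ennreal_SUP_add_right) (use compactin_empty in blast)
      also have "\<dots> \<le> inner_content W"
      proof (rule SUP_least)
        fix L assume "L \<in> {L. compactin T L \<and> L \<subseteq> W - K}"
        then have L: "compactin T L" "L \<subseteq> W - K" by auto
        have "ennreal (h K) + ennreal (h L) = ennreal (h (K \<union> L))"
          using h_Un_eq[OF K(1) L(1)] L(2) h_nonneg by (subst h_Un_eq) (use K L in auto)
        also have "\<dots> \<le> inner_content W"
          using K L by (intro content_le_inner compactin_Un) auto
        finally show "ennreal (h K) + ennreal (h L) \<le> inner_content W" .
      qed
      finally show "ennreal (h K) + outer_content (W - U) \<le> inner_content W" .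
    qed
  qed
  have ge: "outer_content (A \<inter> U) + outer_content (A - U) \<le> outer_content A" for A
    unfolding outer_content_def[of A]
  proof (rule INF_greatest)
    fix W assume "W \<in> {W. openin T W \<and> A \<subseteq> W}"
    then have W: "openin T W" "A \<subseteq> W" by auto
    have "outer_content (A \<inter> U) + outer_content (A - U) \<le> inner_content (W \<inter> U) + outer_content (W - U)"
      using W U by (intro add_mono outer_content_le outer_content_mono) auto
    also have "\<dots> \<le> inner_content W" by (rule *[OF W(1)])
    finally show "outer_content (A \<inter> U) + outer_content (A - U) \<le> inner_content W" .
  qed
  have sa: "subadditive (Pow (carrier G)) outer_content"
    using outer_measure countably_subadditive_subadditive unfolding outer_measure_space_def by blast
  have le: "outer_content A \<le> outer_content (A \<inter> U) + outer_content (A - U)" if "A \<subseteq> carrier G" for A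
  proof -
    have "outer_content ((A \<inter> U) \<union> (A - U)) \<le> outer_content (A \<inter> U) + outer_content (A - U)"
      by (rule subadditiveD[OF sa]) (use that in auto)
    then show ?thesis by (simp add: Int_Diff_Un)
  qed
  have e: "U \<inter> A = A \<inter> U" "(carrier G - U) \<inter> A = A - U" if "A \<subseteq> carrier G" for A using that by auto
  show ?thesis
    unfolding lambda_system_def using Uc ge le by (auto simp: e intro!: antisym)
qed

lemma inner_content_translate_le:
  assumes g: "g \<in> carrier G" and U: "openin T U"
  shows "inner_content (translate g U) \<le> inner_content U"
  unfolding inner_content_def[of "translate g U"]
proof (rule SUP_least)
  fix K assume "K \<in> {K. compactin T K \<and> K \<subseteq> translate g U}"
  then have K: "compactin T K" "K \<subseteq> translate g U" by auto
  have "translate (inv g) K \<subseteq> translate (inv g) (translate g U)"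
    using K by (intro translate_mono)
  also have "\<dots> = U" using g openin_subset_carrier[OF U] by (simp add: translate_inv)
  finally have "ennreal (h (translate (inv g) K)) \<le> inner_content U"
    using K g by (intro content_le_inner compactin_translate) auto
  then show "ennreal (h K) \<le> inner_content U"
    using h_translate[of "inv g" K] g compactin_subset[OF K(1)] by simp
qed

lemma outer_content_translate:
  assumes g: "g \<in> carrier G" and A: "A \<subseteq> carrier G"
  shows "outer_content (translate g A) = outer_content A"
proof -
  have le: "outer_content (translate g A) \<le> outer_content A"
    if g: "g \<in> carrier G" and A: "A \<subseteq> carrier G" for g A
    unfolding outer_content_def[of A]
  proof (rule INF_greatest)
    fix U assume "U \<in> {U. openin T U \<and> A \<subseteq> U}"
    then have U: "openin T U" "A \<subseteq> U" by auto
    have "outer_content (translate g A) \<le> inner_content (translate g U)"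
      using U g by (intro outer_content_le openin_translate translate_mono)
    also have "\<dots> \<le> inner_content U" by (rule inner_content_translate_le[OF g U(1)])
    finally show "outer_content (translate g A) \<le> inner_content U" .
  qed
  have "outer_content A = outer_content (translate (inv g) (translate g A))"
    using g A by (simp add: translate_inv)
  also have "\<dots> \<le> outer_content (translate g A)"
    using g A translate_subset by (intro le) auto
  finally show ?thesis using le[OF g A] by simp
qed

theorem is_haar_measure_outer_content:
  "is_haar_measure G T (measure_of (carrier G) {U. openin T U} outer_content)"
proof -
  let ?M = "measure_of (carrier G) {U. openin T U} outer_content"
  let ?L = "lambda_system (carrier G) (Pow (carrier G)) outer_content"
  interpret sigma_algebra "carrier G" "Pow (carrier G)" by (rule sigma_algebra_Pow)
  have sub: "{U. openin T U} \<subseteq> Pow (carrier G)"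
    using openin_subset_carrier by auto
  have ms: "measure_space (carrier G) ?L outer_content"
    by (rule caratheodory_lemma[OF outer_measure])
  then have L: "sigma_algebra (carrier G) ?L" by (simp add: measure_space_def)
  have sL: "sigma_sets (carrier G) {U. openin T U} \<subseteq> ?L"
    using sigma_algebra.sigma_sets_subset[OF L, of "{U. openin T U}"] open_in_lambda_system by auto
  have space: "space ?M = carrier G" using sub by (rule space_measure_of)
  have sets: "sets ?M = sigma_sets (carrier G) {U. openin T U}" using sub by (rule sets_measure_of)
  have em: "emeasure ?M A = outer_content A" if "A \<in> sets ?M" for A
  proof (rule emeasure_measure_of[OF refl sub _ _ that])
    show "positive (sets ?M) outer_content"
      using ms by (simp add: measure_space_def positive_def)
    have "countably_additive ?L outer_content" using ms by (simp add: measure_space_def)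
    then show "countably_additive (sets ?M) outer_content"
      unfolding countably_additive_def sets by (meson sL order_trans subsetD)
  qed
  have op: "U \<in> sets ?M" if "openin T U" for U
    using that by (simp add: sets sigma_sets.Basic)
  have cpt: "K \<in> sets ?M" if "compactin T K" for K
  proof -
    have "carrier G - (carrier G - K) \<in> sigma_sets (carrier G) {U. openin T U}"
      using that by (intro sigma_sets.Compl sigma_sets.Basic)
        (simp add: compactin_iff_closedin closedin_def topspace_eq)
    then show ?thesis using compactin_subset[OF that] by (simp add: sets double_diff)
  qed
  have emo: "emeasure ?M U = inner_content U" if "openin T U" for U
    using em[OF op[OF that]] outer_content_open[OF that] by simp
  have carr: "openin T (carrier G)" using openin_topspace[of T] topspace_eq by simp
  \<comment> \<open>The content of a compact set is at most its measure. This inequality suffices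
    for inner regularity on open sets, because \<open>inner_content\<close> is a supremum of
    contents.\<close>
  have hle: "ennreal (h K) \<le> outer_content K" if "compactin T K" for K
    unfolding outer_content_def using that by (auto intro!: INF_greatest content_le_inner)
  have "emeasure ?M (carrier G) \<noteq> 0"
    using content_le_inner[OF compactin_carrier, of "carrier G"] emo[OF carr] by (auto simp: h_carrier)
  moreover have "emeasure ?M K < \<infinity>" if "compactin T K" for K
  proof -
    have "emeasure ?M K \<le> emeasure ?M (carrier G)"
      using op[OF carr] compactin_subset[OF that] by (rule emeasure_mono[rotated])
    also have "\<dots> \<le> 1" using emo[OF carr] inner_content_le_1 by simp
    finally show ?thesis using ennreal_one_less_top le_less_trans by (metis infinity_ennreal_def)
  qed
  moreover have "emeasure ?M A = (INF U\<in>{U. openin T U \<and> A \<subseteq> U}. emeasure ?M U)"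
    if "A \<in> sets ?M" for A
    unfolding em[OF that] outer_content_def[of A] using emo by (intro INF_cong) auto
  moreover have "emeasure ?M U = (SUP K\<in>{K. compactin T K \<and> K \<subseteq> U}. emeasure ?M K)"
    if U: "openin T U" for U
  proof (rule antisym)
    show "emeasure ?M U \<le> (SUP K\<in>{K. compactin T K \<and> K \<subseteq> U}. emeasure ?M K)"
      unfolding emo[OF U] inner_content_def[of U] using em cpt hle by (intro SUP_mono) force
    show "(SUP K\<in>{K. compactin T K \<and> K \<subseteq> U}. emeasure ?M K) \<le> emeasure ?M U"
      using op[OF U] by (intro SUP_least emeasure_mono) auto
  qed
  moreover have "emeasure ?M ((\<lambda>x. g \<otimes> x) ` A) = emeasure ?M A"
    if g: "g \<in> carrier G" and A: "A \<in> sets ?M" for g A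
  proof -
    \<comment> \<open>The outer content is invariant on all subsets; to read this as invariance of
      \<open>emeasure\<close>, translates of Borel sets must be known to be Borel.\<close>
    have *: "translate g A \<in> sigma_sets (carrier G) {U. openin T U}"
      if "A \<in> sigma_sets (carrier G) {U. openin T U}" for A
      using that
    proof (induction rule: sigma_sets.induct)
      case (Basic U)
      then show ?case using openin_translate[OF g] by (auto intro: sigma_sets.Basic)
    next
      case Empty
      then show ?case by (simp add: translate_def sigma_sets.Empty)
    next
      case (Compl A)
      then have "A \<subseteq> carrier G" using sub sigma_sets_into_sp by blast
      then have "translate g (carrier G - A) = carrier G - translate g A"
        using g by (auto simp: in_translate_iff)
      then show ?case using Compl by (simp add: sigma_sets.Compl)
    next
      case (Union A)
      moreover have "translate g (\<Union>i. A i) = (\<Union>i. translate g (A i))"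
        by (auto simp: translate_def)
      ultimately show ?case by (simp add: sigma_sets.Union)
    qed
    have "A \<subseteq> carrier G" using sets.sets_into_space[OF A] space by simp
    then show ?thesis
      using em[OF A] em[of "translate g A"] * A outer_content_translate[OF g]
      by (simp add: sets translate_def[symmetric])
  qed
  ultimately show ?thesis
    unfolding is_haar_measure_def using space sets by blast
qed

end

text \<open>Existence is all that is required to know that the chosen measure is a Haar measure; no
  uniqueness enters, and every later fact about \<open>haar_measure\<close> comes from here.\<close>

theorem (in compact_group) is_haar_measure_haar_measure: "is_haar_measure G T (haar_measure G T)"
proof -
  obtain h where "invariant_content G T h" using invariant_content_exists by blast
  from invariant_content.is_haar_measure_outer_content[OF this] show ?thesis
    unfolding haar_measure_def by (rule someI)
qed

section \<open>Square-integrable functions and bounded operators\<close>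

lemma borel_measurable_cnj [measurable (raw)]:
  "f \<in> borel_measurable M \<Longrightarrow> (\<lambda>x. cnj (f x)) \<in> borel_measurable M"
  by (rule measurable_compose[OF _ borel_measurable_continuous_onI]) (auto intro: continuous_intros)

lemma L2_measurable: "f \<in> L2 M \<Longrightarrow> f \<in> borel_measurable M"
  by (simp add: L2_def)

lemma L2_integrable: "f \<in> L2 M \<Longrightarrow> integrable M (\<lambda>x. (cmod (f x))\<^sup>2)"
  by (simp add: L2_def)

lemma L2_dominated:
  assumes "f \<in> borel_measurable M" "integrable M h" "\<And>x. x \<in> space M \<Longrightarrow> (cmod (f x))\<^sup>2 \<le> h x"
  shows "f \<in> L2 M"
proof -
  have "integrable M (\<lambda>x. (cmod (f x))\<^sup>2)"
    using assms(1) by (intro Bochner_Integration.integrable_bound[OF assms(2)])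
      (auto intro!: AE_I2 order_trans[OF assms(3)])
  with assms(1) show ?thesis by (simp add: L2_def)
qed

lemma cmod_add_power2_le: "(cmod (a + b))\<^sup>2 \<le> 2 * (cmod a)\<^sup>2 + 2 * (cmod b)\<^sup>2"
proof -
  have "(cmod (a + b))\<^sup>2 \<le> (cmod a + cmod b)\<^sup>2"
    by (intro power_mono norm_triangle_ineq) auto
  also have "\<dots> \<le> 2 * (cmod a)\<^sup>2 + 2 * (cmod b)\<^sup>2"
    using sum_squares_bound[of "cmod a" "cmod b"] by (simp add: power2_sum)
  finally show ?thesis .
qed

lemma L2_add: "f \<in> L2 M \<Longrightarrow> h \<in> L2 M \<Longrightarrow> (\<lambda>x. f x + h x) \<in> L2 M"
  by (rule L2_dominated[where h = "\<lambda>x. 2 * (cmod (f x))\<^sup>2 + 2 * (cmod (h x))\<^sup>2"])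
    (auto simp: L2_def intro: cmod_add_power2_le)

lemma L2_mult: "f \<in> L2 M \<Longrightarrow> (\<lambda>x. a * f x) \<in> L2 M"
  by (auto simp: L2_def norm_mult power_mult_distrib)

lemma L2_zero: "(\<lambda>x. 0) \<in> L2 M"
  by (simp add: L2_def)

lemma L2_uminus: "f \<in> L2 M \<Longrightarrow> (\<lambda>x. - f x) \<in> L2 M"
  using L2_mult[of f M "-1"] by simp

lemma L2_diff: "f \<in> L2 M \<Longrightarrow> h \<in> L2 M \<Longrightarrow> (\<lambda>x. f x - h x) \<in> L2 M"
  using L2_add[OF _ L2_uminus, of f M h] by simp

lemma L2_sum: "(\<And>i. i \<in> I \<Longrightarrow> f i \<in> L2 M) \<Longrightarrow> (\<lambda>x. \<Sum>i\<in>I. f i x) \<in> L2 M"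
  by (induction I rule: infinite_finite_induct) (auto simp: L2_zero L2_add)

lemma L2_norm_nonneg [simp]: "0 \<le> L2_norm M f"
  by (simp add: L2_norm_def)

lemma L2_norm_power2: "(L2_norm M f)\<^sup>2 = (\<integral>x. (cmod (f x))\<^sup>2 \<partial>M)"
  by (simp add: L2_norm_def)

lemma L2_norm_mult: "L2_norm M (\<lambda>x. a * f x) = cmod a * L2_norm M f"
  by (simp add: L2_norm_def norm_mult power_mult_distrib real_sqrt_mult)

lemma L2_norm_zero: "L2_norm M (\<lambda>x. 0) = 0"
  by (simp add: L2_norm_def)

lemma L2_norm_cong_AE:
  assumes "f \<in> borel_measurable M" "h \<in> borel_measurable M" "AE x in M. f x = h x"
  shows "L2_norm M f = L2_norm M h"
proof -
  have "(\<integral>x. (cmod (f x))\<^sup>2 \<partial>M) = (\<integral>x. (cmod (h x))\<^sup>2 \<partial>M)"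
    by (rule integral_cong_AE) (use assms in auto)
  then show ?thesis by (simp add: L2_norm_def)
qed

lemma L2_inner_cong_AE:
  assumes "f \<in> borel_measurable M" "f' \<in> borel_measurable M" "h \<in> borel_measurable M"
    and "AE x in M. f x = f' x"
  shows "L2_inner M f h = L2_inner M f' h"
proof -
  have [measurable]: "f \<in> borel_measurable M" "f' \<in> borel_measurable M" "h \<in> borel_measurable M"
    by fact+
  show ?thesis
    unfolding L2_inner_def by (rule integral_cong_AE) (use assms(4) in auto)
qed

lemma L2_mult_integrable:
  assumes f: "f \<in> L2 M" and h: "h \<in> L2 M"
  shows "integrable M (\<lambda>x. f x * cnj (h x))" "integrable M (\<lambda>x. cmod (f x) * cmod (h x))"
proof -
  have "integrable M (\<lambda>x. (cmod (f x))\<^sup>2 + (cmod (h x))\<^sup>2)"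
    using f h by (simp add: L2_def)
  moreover have "cmod (f x) * cmod (h x) \<le> (cmod (f x))\<^sup>2 + (cmod (h x))\<^sup>2" for x
  proof -
    have "0 \<le> cmod (f x) * cmod (h x)" by simp
    then show ?thesis using sum_squares_bound[of "cmod (f x)" "cmod (h x)"] by linarith
  qed
  moreover have [measurable]: "f \<in> borel_measurable M" "h \<in> borel_measurable M"
    using f h by (auto simp: L2_def)
  ultimately show "integrable M (\<lambda>x. f x * cnj (h x))" "integrable M (\<lambda>x. cmod (f x) * cmod (h x))"
    by (auto intro!: Bochner_Integration.integrable_bound[where f = "\<lambda>x. (cmod (f x))\<^sup>2 + (cmod (h x))\<^sup>2"]
        AE_I2 simp: norm_mult)
qed

text \<open>With absolute values inside the integral the estimate serves both the Cauchy-Schwarz and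
  the triangle inequality; it is transferred from extended nonnegative integrals.\<close>

lemma L2_abs_inner_le:
  assumes f: "f \<in> L2 M" and h: "h \<in> L2 M"
  shows "(\<integral>x. cmod (f x) * cmod (h x) \<partial>M) \<le> L2_norm M f * L2_norm M h"
proof -
  have [measurable]: "f \<in> borel_measurable M" "h \<in> borel_measurable M"
    using f h by (auto simp: L2_def)
  have nn: "(\<integral>\<^sup>+x. ennreal (cmod (k x)) ^ 2 \<partial>M) = ennreal ((L2_norm M k)\<^sup>2)" if "k \<in> L2 M" for k
    unfolding L2_norm_power2 by (subst nn_integral_eq_integral[symmetric])
      (use that in \<open>auto simp: L2_def ennreal_power intro!: nn_integral_cong\<close>)
  have "ennreal ((\<integral>x. cmod (f x) * cmod (h x) \<partial>M)\<^sup>2) = (\<integral>\<^sup>+x. ennreal (cmod (f x)) * ennreal (cmod (h x)) \<partial>M)\<^sup>2"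
    using nn_integral_eq_integral[OF L2_mult_integrable(2)[OF f h]]
    by (simp add: ennreal_mult[symmetric] ennreal_power)
  also have "\<dots> \<le> (\<integral>\<^sup>+x. ennreal (cmod (f x)) ^ 2 \<partial>M) * (\<integral>\<^sup>+x. ennreal (cmod (h x)) ^ 2 \<partial>M)"
    by (rule Cauchy_Schwarz_nn_integral) auto
  also have "\<dots> = ennreal ((L2_norm M f * L2_norm M h)\<^sup>2)"
    by (simp add: nn f h ennreal_mult[symmetric] power_mult_distrib)
  finally have "(\<integral>x. cmod (f x) * cmod (h x) \<partial>M)\<^sup>2 \<le> (L2_norm M f * L2_norm M h)\<^sup>2"
    by (simp add: ennreal_le_iff)
  then show ?thesis by (rule power2_le_imp_le) simp
qed

lemma L2_Cauchy_Schwarz: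
  assumes f: "f \<in> L2 M" and h: "h \<in> L2 M"
  shows "cmod (L2_inner M f h) \<le> L2_norm M f * L2_norm M h"
proof -
  have "cmod (L2_inner M f h) \<le> (\<integral>x. cmod (f x * cnj (h x)) \<partial>M)"
    unfolding L2_inner_def by (rule integral_norm_bound)
  also have "\<dots> \<le> L2_norm M f * L2_norm M h"
    using L2_abs_inner_le[OF f h] by (simp add: norm_mult)
  finally show ?thesis .
qed

lemma L2_norm_triangle:
  assumes f: "f \<in> L2 M" and h: "h \<in> L2 M"
  shows "L2_norm M (\<lambda>x. f x + h x) \<le> L2_norm M f + L2_norm M h"
proof -
  have i: "integrable M (\<lambda>x. (cmod (f x))\<^sup>2)" "integrable M (\<lambda>x. (cmod (h x))\<^sup>2)"
    "integrable M (\<lambda>x. cmod (f x) * cmod (h x))"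
    using f h by (auto intro: L2_mult_integrable L2_integrable)
  have "(L2_norm M (\<lambda>x. f x + h x))\<^sup>2 \<le> (\<integral>x. (cmod (f x))\<^sup>2 + (cmod (h x))\<^sup>2 + 2 * (cmod (f x) * cmod (h x)) \<partial>M)"
    unfolding L2_norm_power2
  proof (rule integral_mono)
    show "integrable M (\<lambda>x. (cmod (f x + h x))\<^sup>2)" using L2_add[OF f h] by (simp add: L2_def)
    show "integrable M (\<lambda>x. (cmod (f x))\<^sup>2 + (cmod (h x))\<^sup>2 + 2 * (cmod (f x) * cmod (h x)))"
      using i by simp
    show "(cmod (f x + h x))\<^sup>2 \<le> (cmod (f x))\<^sup>2 + (cmod (h x))\<^sup>2 + 2 * (cmod (f x) * cmod (h x))" for x
      using power_mono[OF norm_triangle_ineq[of "f x" "h x"] norm_ge_zero, of 2]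
      by (simp add: power2_sum mult.assoc)
  qed
  also have "\<dots> = (L2_norm M f)\<^sup>2 + (L2_norm M h)\<^sup>2 + 2 * (\<integral>x. cmod (f x) * cmod (h x) \<partial>M)"
    using i by (simp add: L2_norm_power2)
  also have "\<dots> \<le> (L2_norm M f + L2_norm M h)\<^sup>2"
    using L2_abs_inner_le[OF f h] by (simp add: power2_sum)
  finally show ?thesis by (rule power2_le_imp_le) simp
qed

lemma L2_inner_diff_left:
  "\<lbrakk>f \<in> L2 M; f' \<in> L2 M; h \<in> L2 M\<rbrakk> \<Longrightarrow> L2_inner M (\<lambda>x. f x - f' x) h = L2_inner M f h - L2_inner M f' h"
  by (simp add: L2_inner_def L2_mult_integrable algebra_simps)

lemma L2_inner_mult_right: "L2_inner M f (\<lambda>x. a * h x) = cnj a * L2_inner M f h"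
  unfolding L2_inner_def by (subst integral_mult_right_zero[symmetric]) (simp add: algebra_simps)

lemma L2_inner_mult_left: "L2_inner M (\<lambda>x. a * f x) h = a * L2_inner M f h"
  unfolding L2_inner_def by (subst integral_mult_right_zero[symmetric]) (simp add: algebra_simps)

lemma L2_inner_sum_left:
  "\<lbrakk>\<And>i. i \<in> I \<Longrightarrow> f i \<in> L2 M; h \<in> L2 M\<rbrakk> \<Longrightarrow>
   L2_inner M (\<lambda>x. \<Sum>i\<in>I. f i x) h = (\<Sum>i\<in>I. L2_inner M (f i) h)"
  by (simp add: L2_inner_def L2_mult_integrable sum_distrib_right)

lemma L2_inner_sum_right:
  "\<lbrakk>\<And>i. i \<in> I \<Longrightarrow> h i \<in> L2 M; f \<in> L2 M\<rbrakk> \<Longrightarrow>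
   L2_inner M f (\<lambda>x. \<Sum>i\<in>I. h i x) = (\<Sum>i\<in>I. L2_inner M f (h i))"
  by (simp add: L2_inner_def L2_mult_integrable sum_distrib_left)

section \<open>Operators that are linear almost everywhere\<close>

lemma bounded_ops_L2: "S \<in> bounded_ops M \<Longrightarrow> f \<in> L2 M \<Longrightarrow> S f \<in> L2 M"
  by (auto simp: bounded_ops_def)

lemma bounded_ops_linear:
  "\<lbrakk>S \<in> bounded_ops M; f \<in> L2 M; h \<in> L2 M\<rbrakk> \<Longrightarrow>
   AE x in M. S (\<lambda>y. a * f y + b * h y) x = a * S f x + b * S h x"
  by (auto simp: bounded_ops_def)

lemma bounded_ops_bound:
  assumes "S \<in> bounded_ops M"
  obtains C where "C \<ge> 0" "\<And>f. f \<in> L2 M \<Longrightarrow> L2_norm M (S f) \<le> C * L2_norm M f"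
proof -
  obtain C where C: "\<forall>f\<in>L2 M. L2_norm M (S f) \<le> C * L2_norm M f"
    using assms by (auto simp: bounded_ops_def)
  show ?thesis
  proof (rule that[of "max C 0"])
    fix f assume "f \<in> L2 M"
    then have "L2_norm M (S f) \<le> C * L2_norm M f" using C by blast
    also have "\<dots> \<le> max C 0 * L2_norm M f" by (intro mult_right_mono) auto
    finally show "L2_norm M (S f) \<le> max C 0 * L2_norm M f" .
  qed simp
qed

lemma bounded_ops_mult:
  assumes S: "S \<in> bounded_ops M" and f: "f \<in> L2 M"
  shows "AE x in M. S (\<lambda>y. a * f y) x = a * S f x"
  using bounded_ops_linear[OF S f f, of a 0] by simp

lemma bounded_ops_sum:
  fixes I :: "'i set"
  assumes S: "S \<in> bounded_ops M" and f: "\<And>j. j \<in> I \<Longrightarrow> f j \<in> L2 M"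
  shows "AE x in M. S (\<lambda>y. \<Sum>j\<in>I. v j * f j y) x = (\<Sum>j\<in>I. v j * S (f j) x)"
  using f
proof (induction I rule: infinite_finite_induct)
  case (insert j I)
  have 1: "AE x in M. S (\<lambda>y. v j * f j y + 1 * (\<Sum>j\<in>I. v j * f j y)) x = v j * S (f j) x + 1 * S (\<lambda>y. \<Sum>j\<in>I. v j * f j y) x"
    using insert by (intro bounded_ops_linear[OF S] L2_sum L2_mult) auto
  have 2: "AE x in M. S (\<lambda>y. \<Sum>j\<in>I. v j * f j y) x = (\<Sum>j\<in>I. v j * S (f j) x)"
    using insert by auto
  show ?case using 1 2 insert by (auto elim: eventually_elim2)
\<comment> \<open>For an empty or infinite index set both sums are 0 by convention, and S maps the
  zero function to 0 almost everywhere because it is homogeneous with factor 0.\<close>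
qed (use bounded_ops_mult[OF S L2_zero, of 0] in auto)

text \<open>This gives a member of the family intersected in \<open>group_VN\<close>, so that the
  elements of \<open>group_VN\<close> are bounded operators.\<close>

lemma von_neumann_algebra_bounded_ops: "von_neumann_algebra M (bounded_ops M)"
proof -
  have "bounded_ops M \<subseteq> commutant M (commutant M (bounded_ops M))"
    by (fastforce simp: commutant_def eq_commute)
  moreover have "commutant M A \<subseteq> bounded_ops M" for A by (auto simp: commutant_def)
  ultimately show ?thesis unfolding von_neumann_algebra_def by blast
qed

text \<open>Homogeneity extends the contraction property from the unit ball to all vectors. The
  operators are homogeneous only almost everywhere, and the finitely many exceptional sets are
  discarded together.\<close>

lemma op_mat_norm_le_oneD:
  assumes S: "\<And>k l. k < m \<Longrightarrow> l < m \<Longrightarrow> S k l \<in> bounded_ops M" and le: "op_mat_norm M m S \<le> 1"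
    and f: "\<And>l. l < m \<Longrightarrow> f l \<in> L2 M"
  shows "(\<Sum>k<m. (L2_norm M (\<lambda>x. \<Sum>l<m. S k l (f l) x))\<^sup>2) \<le> (\<Sum>l<m. (L2_norm M (f l))\<^sup>2)"
proof -
  define q where "q = (\<Sum>k<m. (L2_norm M (\<lambda>x. \<Sum>l<m. S k l (f l) x))\<^sup>2)"
  define s where "s = (\<Sum>l<m. (L2_norm M (f l))\<^sup>2)"
  have q0: "0 \<le> q" and s0: "0 \<le> s" by (auto simp: q_def s_def intro: sum_nonneg)
  have scaled: "t\<^sup>2 * q \<le> 1" if t: "t\<^sup>2 * s \<le> 1" for t :: real
  proof -
    let ?f = "\<lambda>l y. complex_of_real t * f l y"
    have eq: "L2_norm M (\<lambda>x. \<Sum>l<m. S k l (?f l) x) = \<bar>t\<bar> * L2_norm M (\<lambda>x. \<Sum>l<m. S k l (f l) x)" if k: "k < m" for k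
    proof -
      have "AE x in M. \<forall>l\<in>{..<m}. S k l (?f l) x = complex_of_real t * S k l (f l) x"
        by (rule AE_finite_allI) (auto intro: bounded_ops_mult[OF S[OF k] f])
      then have "AE x in M. (\<Sum>l<m. S k l (?f l) x) = complex_of_real t * (\<Sum>l<m. S k l (f l) x)"
        by (auto simp: sum_distrib_left elim!: eventually_mono)
      then have "L2_norm M (\<lambda>x. \<Sum>l<m. S k l (?f l) x) = L2_norm M (\<lambda>x. complex_of_real t * (\<Sum>l<m. S k l (f l) x))"
        using S[OF k] f by (intro L2_norm_cong_AE L2_measurable L2_sum L2_mult) (auto intro: bounded_ops_L2 L2_mult)
      then show ?thesis by (simp add: L2_norm_mult)
    qed
    have "ennreal (sqrt (\<Sum>k<m. (L2_norm M (\<lambda>x. \<Sum>l<m. S k l (?f l) x))\<^sup>2)) \<le> op_mat_norm M m S"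
      unfolding op_mat_norm_def
    proof (rule SUP_upper2[OF _ order_refl], intro CollectI conjI allI impI)
      show "?f l \<in> L2 M" if "l < m" for l using f[OF that] by (rule L2_mult)
      show "(\<Sum>l<m. (L2_norm M (?f l))\<^sup>2) \<le> 1"
        using t by (simp add: L2_norm_mult power_mult_distrib s_def sum_distrib_left)
    qed
    then have "ennreal (sqrt (\<Sum>k<m. (L2_norm M (\<lambda>x. \<Sum>l<m. S k l (?f l) x))\<^sup>2)) \<le> ennreal 1"
      using le by (simp only: ennreal_1)
    then have "(\<Sum>k<m. (L2_norm M (\<lambda>x. \<Sum>l<m. S k l (?f l) x))\<^sup>2) \<le> 1"
      by (simp add: ennreal_le_iff del: ennreal_1)
    then show ?thesis by (simp add: eq power_mult_distrib q_def sum_distrib_left)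
  qed
  have "q \<le> s"
  proof (cases "s = 0")
    case True
    \<comment> \<open>With s = 0 every scaling factor is allowed, and this one would turn a nonzero
      q into 2.\<close>
    then show ?thesis using scaled[of "sqrt (2 / q)"] q0 by (cases "q = 0") auto
  next
    case False
    then show ?thesis using scaled[of "sqrt (1 / s)"] s0 by (auto simp: field_simps)
  qed
  then show ?thesis by (simp add: q_def s_def)
qed

section \<open>The Fourier algebra of a compact group\<close>

context compact_group
begin

abbreviation haar :: "'a measure" where
  "haar \<equiv> haar_measure G T"

abbreviation norm2 :: "('a \<Rightarrow> complex) \<Rightarrow> real" where
  "norm2 \<equiv> L2_norm haar"

abbreviation inner2 :: "('a \<Rightarrow> complex) \<Rightarrow> ('a \<Rightarrow> complex) \<Rightarrow> complex" where
  "inner2 \<equiv> L2_inner haar"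

lemma space_haar: "space haar = carrier G"
  and sets_haar: "sets haar = sigma_sets (carrier G) {U. openin T U}"
  using is_haar_measure_haar_measure by (simp_all add: is_haar_measure_def)

lemma emeasure_haar_carrier: "emeasure haar (carrier G) \<noteq> 0" "emeasure haar (carrier G) < \<infinity>"
  using is_haar_measure_haar_measure compactin_carrier by (simp_all add: is_haar_measure_def)

lemma emeasure_haar_translate:
  "g \<in> carrier G \<Longrightarrow> A \<in> sets haar \<Longrightarrow> emeasure haar (translate g A) = emeasure haar A"
  using is_haar_measure_haar_measure by (simp add: is_haar_measure_def translate_def)

lemma outer_regular_haar:
  "A \<in> sets haar \<Longrightarrow> emeasure haar A = (INF U\<in>{U. openin T U \<and> A \<subseteq> U}. emeasure haar U)"
  using is_haar_measure_haar_measure by (simp add: is_haar_measure_def)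

sublocale haar: finite_measure haar
  using emeasure_haar_carrier by (intro finite_measureI) (simp add: space_haar)

text \<open>The chosen Haar measure need not be normalised; its total mass therefore appears as a
  divisor in the coefficient functionals.\<close>

definition mass :: real where
  "mass = measure haar (carrier G)"

lemma mass_pos: "mass > 0"
proof -
  have "mass \<noteq> 0"
    using emeasure_haar_carrier haar.emeasure_eq_measure[of "carrier G"] by (auto simp: mass_def)
  then show ?thesis by (simp add: mass_def less_le)
qed

lemma sets_haar_open: "openin T U \<Longrightarrow> U \<in> sets haar"
  by (simp add: sets_haar sigma_sets.Basic)

lemma measurable_left_mult: "g \<in> carrier G \<Longrightarrow> (\<lambda>x. g \<otimes> x) \<in> measurable haar haar"
proof (rule measurable_sigma_sets[OF sets_haar])
  assume g: "g \<in> carrier G"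
  show "{U. openin T U} \<subseteq> Pow (carrier G)" using openin_subset_carrier by auto
  show "(\<otimes>) g \<in> space haar \<rightarrow> carrier G" using g by (simp add: space_haar)
  fix U assume "U \<in> {U. openin T U}"
  then have "openin T {x \<in> topspace T. g \<otimes> x \<in> U}"
    using openin_continuous_map_preimage[OF continuous_left_mult[OF g]] by simp
  moreover have "(\<otimes>) g -` U \<inter> space haar = {x \<in> topspace T. g \<otimes> x \<in> U}"
    by (auto simp: space_haar topspace_eq)
  ultimately show "(\<otimes>) g -` U \<inter> space haar \<in> sets haar" by (simp add: sets_haar_open)
qed

lemma distr_haar_left_mult:
  assumes g: "g \<in> carrier G"
  shows "distr haar haar (\<lambda>x. g \<otimes> x) = haar"
proof (rule measure_eqI)
  show "sets (distr haar haar ((\<otimes>) g)) = sets haar" by simp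
  fix A assume "A \<in> sets (distr haar haar ((\<otimes>) g))"
  then have A: "A \<in> sets haar" by simp
  then have Ac: "A \<subseteq> carrier G" using sets.sets_into_space space_haar by blast
  have "(\<otimes>) g -` A \<inter> space haar = translate (inv g) A"
    using g Ac by (auto simp: space_haar in_translate_iff)
  then show "emeasure (distr haar haar ((\<otimes>) g)) A = emeasure haar A"
    using emeasure_distr[OF measurable_left_mult[OF g] A] emeasure_haar_translate[OF _ A] g by simp
qed

lemma integral_left_mult:
  fixes f :: "'a \<Rightarrow> 'c::{banach, second_countable_topology}"
  assumes "g \<in> carrier G" "f \<in> borel_measurable haar"
  shows "(\<integral>x. f (g \<otimes> x) \<partial>haar) = (\<integral>x. f x \<partial>haar)"
  using integral_distr[OF measurable_left_mult[OF assms(1)] assms(2)] distr_haar_left_mult[OF assms(1)] by simp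

lemma integrable_left_mult:
  fixes f :: "'a \<Rightarrow> 'c::{banach, second_countable_topology}"
  assumes "g \<in> carrier G" "f \<in> borel_measurable haar"
  shows "integrable haar (\<lambda>x. f (g \<otimes> x)) \<longleftrightarrow> integrable haar f"
  using integrable_distr_eq[OF measurable_left_mult[OF assms(1)] assms(2)] distr_haar_left_mult[OF assms(1)] by simp

lemma continuous_map_measurable:
  fixes f :: "'a \<Rightarrow> 'c::topological_space"
  assumes "continuous_map T euclidean f"
  shows "f \<in> borel_measurable haar"
proof (rule borel_measurableI)
  fix S :: "'c set" assume "open S"
  then have "openin T {x \<in> topspace T. f x \<in> S}"
    using openin_continuous_map_preimage[OF assms] by simp
  moreover have "f -` S \<inter> space haar = {x \<in> topspace T. f x \<in> S}"
    by (auto simp: space_haar topspace_eq)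
  ultimately show "f -` S \<inter> space haar \<in> sets haar" by (simp add: sets_haar_open)
qed

lemma left_regular_L2:
  assumes g: "g \<in> carrier G" and f: "f \<in> L2 haar"
  shows "left_regular G g f \<in> L2 haar"
  using g measurable_compose[OF measurable_left_mult[of "inv g"] L2_measurable[OF f]]
    integrable_left_mult[of "inv g" "\<lambda>x. (cmod (f x))\<^sup>2"] L2_measurable[OF f] L2_integrable[OF f]
  by (simp add: L2_def left_regular_def)

lemma L2_norm_left_regular:
  assumes g: "g \<in> carrier G" and f: "f \<in> borel_measurable haar"
  shows "norm2 (left_regular G g f) = norm2 f"
  using integral_left_mult[of "inv g" "\<lambda>x. (cmod (f x))\<^sup>2"] g f
  by (simp add: L2_norm_def left_regular_def)

lemma left_regular_bounded_ops: "g \<in> carrier G \<Longrightarrow> left_regular G g \<in> bounded_ops haar"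
  unfolding bounded_ops_def
  by (auto simp: left_regular_L2 L2_norm_left_regular L2_measurable intro!: exI[of _ 1])
    (simp add: left_regular_def)

lemma left_regular_group_VN: "g \<in> carrier G \<Longrightarrow> left_regular G g \<in> group_VN G T"
  by (auto simp: group_VN_def)

lemma group_VN_bounded_ops: "group_VN G T \<subseteq> bounded_ops haar"
  unfolding group_VN_def
  using von_neumann_algebra_bounded_ops left_regular_bounded_ops by (intro Inter_lower) auto

lemma op_mat_norm_left_regular:
  assumes g: "g \<in> carrier G"
  shows "op_mat_norm haar 1 (\<lambda>k l. left_regular G g) \<le> 1"
  unfolding op_mat_norm_def
proof (rule SUP_least)
  fix f :: "nat \<Rightarrow> 'a \<Rightarrow> complex"
  assume "f \<in> {f. (\<forall>l<1. f l \<in> L2 haar) \<and> (\<Sum>l<1. (norm2 (f l))\<^sup>2) \<le> 1}"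
  then have f: "f 0 \<in> L2 haar" "(norm2 (f 0))\<^sup>2 \<le> 1" by auto
  then have "(norm2 (left_regular G g (f 0)))\<^sup>2 \<le> 1"
    using L2_norm_left_regular[OF g] L2_measurable by metis
  then show "ennreal (sqrt (\<Sum>k<(1::nat). (norm2 (\<lambda>x. \<Sum>l<1. left_regular G g (f l) x))\<^sup>2)) \<le> 1"
    by (simp add: ennreal_le_1 power_le_one_iff)
qed

text \<open>Translation by g is a 1 x 1 operator matrix of norm at most 1, hence a competitor with m
  = 1 in the supremum defining the predual norm. This is complete contractivity of evaluation at
  g.\<close>

lemma scalar_mat_norm_le_fourier_norm:
  assumes g: "g \<in> carrier G"
  shows "scalar_mat_norm {..<n} (\<lambda>i j. u i j g) \<le> fourier_norm G T n u"
  unfolding fourier_norm_def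
proof (rule INF_greatest)
  fix \<phi> assume \<phi>: "\<phi> \<in> {\<phi>. \<forall>i<n. \<forall>j<n. \<phi> i j \<in> VN_predual G T \<and> predual_function G (\<phi> i j) = u i j}"
  have u: "u i j g = \<phi> i j (left_regular G g)" if "i < n" "j < n" for i j
  proof -
    have "predual_function G (\<phi> i j) g = u i j g" using \<phi> that by simp
    then show ?thesis using g by (simp add: predual_function_def)
  qed
  have "scalar_mat_norm {..<n} (\<lambda>i j. u i j g) \<le>
      scalar_mat_norm ({..<n} \<times> {..<Suc 0}) (\<lambda>(i, k) (j, l). \<phi> i j (left_regular G g))"
    unfolding scalar_mat_norm_def[of "{..<n}"]
  proof (rule SUP_least)
    fix v :: "nat \<Rightarrow> complex" assume v: "v \<in> {v. (\<Sum>i<n. (cmod (v i))\<^sup>2) \<le> 1}"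
    have p: "(\<Sum>p\<in>{..<n} \<times> {..<Suc 0}. F p) = (\<Sum>i<n. F (i, 0))" for F :: "nat \<times> nat \<Rightarrow> 'z::comm_monoid_add"
    proof -
      have "{..<n} \<times> {..<Suc 0} = (\<lambda>i. (i, 0)) ` {..<n}" by auto
      then show ?thesis by (simp add: sum.reindex inj_on_def)
    qed
    have "ennreal (sqrt (\<Sum>i<n. (cmod (\<Sum>j<n. u i j g * v j))\<^sup>2)) =
      ennreal (sqrt (\<Sum>p\<in>{..<n} \<times> {..<Suc 0}. (cmod (\<Sum>q\<in>{..<n} \<times> {..<Suc 0}.
        (\<lambda>(i, k) (j, l). \<phi> i j (left_regular G g)) p q * (\<lambda>(j, l). v j) q))\<^sup>2))"
      by (simp add: p u)
    also have "\<dots> \<le> scalar_mat_norm ({..<n} \<times> {..<Suc 0}) (\<lambda>(i, k) (j, l). \<phi> i j (left_regular G g))"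
      unfolding scalar_mat_norm_def by (rule SUP_upper2[OF _ order_refl]) (use v in \<open>simp add: p\<close>)
    finally show "ennreal (sqrt (\<Sum>i<n. (cmod (\<Sum>j<n. u i j g * v j))\<^sup>2))
      \<le> scalar_mat_norm ({..<n} \<times> {..<Suc 0}) (\<lambda>(i, k) (j, l). \<phi> i j (left_regular G g))" .
  qed
  also have "\<dots> \<le> VN_predual_norm G T n \<phi>"
    unfolding VN_predual_norm_def
    by (rule SUP_upper2[where i = "(1, \<lambda>k l. left_regular G g)"])
      (use g op_mat_norm_left_regular left_regular_group_VN in auto)
  finally show "scalar_mat_norm {..<n} (\<lambda>i j. u i j g) \<le> VN_predual_norm G T n \<phi>" .
qed

end

section \<open>Differences in the predual and in the Fourier algebra\<close>

text \<open>Two series are merged into one so that a combination of two normal functionals is again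
  given by a single pair of sequences of vectors. Real and imaginary parts are treated
  separately.\<close>

lemma sums_interleave:
  fixes f g :: "nat \<Rightarrow> complex"
  assumes "f sums a" "g sums b"
  shows "(\<lambda>n. if even n then f (n div 2) else g (n div 2)) sums (a + b)"
proof -
  have r: "(\<lambda>n. if even n then f (n div 2) else g (n div 2)) sums (a + b)"
    if "f sums a" "g sums b" for f g :: "nat \<Rightarrow> real" and a b
  proof -
    have "(\<lambda>n. if even n then f (n div 2) else g ((n - 1) div 2)) sums (b + a)"
      using that by (intro sums_if)
    moreover have "(\<lambda>n. if even n then f (n div 2) else g ((n - 1) div 2)) =
        (\<lambda>n. if even n then f (n div 2) else g (n div 2))"
      by (auto simp: fun_eq_iff elim!: oddE)
    ultimately show ?thesis by (simp add: add.commute)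
  qed
  show ?thesis
    using r[of "\<lambda>n. Re (f n)" "Re a" "\<lambda>n. Re (g n)" "Re b"]
      r[of "\<lambda>n. Im (f n)" "Im a" "\<lambda>n. Im (g n)" "Im b"] assms
    by (simp add: sums_complex_iff if_distrib[of Re] if_distrib[of Im] cong: if_cong)
qed

context compact_group
begin

text \<open>The product of norms is relaxed to a sum of squares: this majorant is summable along the
  sequences of a normal functional and depends on S only through C.\<close>

lemma L2_inner_bound:
  assumes S: "\<And>f. f \<in> L2 haar \<Longrightarrow> norm2 (S f) \<le> C * norm2 f" "C \<ge> 0"
    and f: "f \<in> L2 haar" "S f \<in> L2 haar" and h: "h \<in> L2 haar"
  shows "cmod (inner2 (S f) h) \<le> C * ((norm2 f)\<^sup>2 + (norm2 h)\<^sup>2)"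
proof -
  have "cmod (inner2 (S f) h) \<le> norm2 (S f) * norm2 h"
    using f h by (intro L2_Cauchy_Schwarz)
  also have "\<dots> \<le> C * norm2 f * norm2 h"
    using S f by (intro mult_right_mono) auto
  also have "\<dots> = C * (norm2 f * norm2 h)" by simp
  also have "\<dots> \<le> C * ((norm2 f)\<^sup>2 + (norm2 h)\<^sup>2)"
  proof (intro mult_left_mono S)
    have "0 \<le> norm2 f * norm2 h" by simp
    then show "norm2 f * norm2 h \<le> (norm2 f)\<^sup>2 + (norm2 h)\<^sup>2"
      using sum_squares_bound[of "norm2 f" "norm2 h"] by linarith
  qed
  finally show ?thesis .
qed

lemma VN_predual_summable:
  assumes "S \<in> group_VN G T" "\<And>k. \<xi> k \<in> L2 haar" "\<And>k. \<eta> k \<in> L2 haar"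
    and sm: "summable (\<lambda>k. (norm2 (\<xi> k))\<^sup>2)" "summable (\<lambda>k. (norm2 (\<eta> k))\<^sup>2)"
  shows "summable (\<lambda>k. inner2 (S (\<xi> k)) (\<eta> k))"
proof -
  have S: "S \<in> bounded_ops haar" using assms(1) group_VN_bounded_ops by blast
  obtain C where C: "C \<ge> 0" "\<And>f. f \<in> L2 haar \<Longrightarrow> norm2 (S f) \<le> C * norm2 f"
    using bounded_ops_bound[OF S] by metis
  show ?thesis
  proof (rule summable_comparison_test')
    show "summable (\<lambda>k. C * ((norm2 (\<xi> k))\<^sup>2 + (norm2 (\<eta> k))\<^sup>2))"
      using sm by (intro summable_mult summable_add)
    show "norm (inner2 (S (\<xi> k)) (\<eta> k)) \<le> C * ((norm2 (\<xi> k))\<^sup>2 + (norm2 (\<eta> k))\<^sup>2)" for k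
      using assms bounded_ops_L2[OF S] C by (intro L2_inner_bound) auto
  qed
qed

text \<open>The representing sequences are interleaved and the minus sign is put on the vectors
  \<open>\<eta>'\<close>. Differences are needed to see that functions with equal restrictions
  differ by an element of the ideal.\<close>

lemma VN_predual_diff:
  assumes "\<phi> \<in> VN_predual G T" "\<psi> \<in> VN_predual G T"
  shows "(\<lambda>S. \<phi> S - \<psi> S) \<in> VN_predual G T"
proof -
  obtain \<xi> \<eta> where 1: "\<And>k::nat. \<xi> k \<in> L2 haar" "\<And>k. \<eta> k \<in> L2 haar"
    "summable (\<lambda>k. (norm2 (\<xi> k))\<^sup>2)" "summable (\<lambda>k. (norm2 (\<eta> k))\<^sup>2)"
    "\<And>S. S \<in> group_VN G T \<Longrightarrow> \<phi> S = (\<Sum>k. inner2 (S (\<xi> k)) (\<eta> k))"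
    using assms(1) unfolding VN_predual_def Let_def by blast
  obtain \<xi>' \<eta>' where 2: "\<And>k::nat. \<xi>' k \<in> L2 haar" "\<And>k. \<eta>' k \<in> L2 haar"
    "summable (\<lambda>k. (norm2 (\<xi>' k))\<^sup>2)" "summable (\<lambda>k. (norm2 (\<eta>' k))\<^sup>2)"
    "\<And>S. S \<in> group_VN G T \<Longrightarrow> \<psi> S = (\<Sum>k. inner2 (S (\<xi>' k)) (\<eta>' k))"
    using assms(2) unfolding VN_predual_def Let_def by blast
  define X where "X k = (if even k then \<xi> (k div 2) else \<xi>' (k div 2))" for k
  define Y where "Y k = (if even k then \<eta> (k div 2) else (\<lambda>x. - 1 * \<eta>' (k div 2) x))" for k
  have summ: "summable (\<lambda>n. if even n then a (n div 2) else b (n div 2))"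
    if "summable a" "summable b" for a b :: "nat \<Rightarrow> real"
  proof -
    have "(\<lambda>n. if even n then complex_of_real (a (n div 2)) else complex_of_real (b (n div 2)))
        sums (complex_of_real (suminf a) + complex_of_real (suminf b))"
      by (rule sums_interleave) (use that in \<open>auto intro: sums_of_real summable_sums\<close>)
    then have "summable (\<lambda>n. Re (if even n then complex_of_real (a (n div 2)) else complex_of_real (b (n div 2))))"
      by (intro summable_Re sums_summable)
    then show ?thesis by (simp add: if_distrib[of Re] cong: if_cong)
  qed
  have "X k \<in> L2 haar" "Y k \<in> L2 haar" for k
    using 1 2 L2_mult[OF 2(2), of "-1"] by (auto simp: X_def Y_def)
  moreover have "summable (\<lambda>k. (norm2 (X k))\<^sup>2)"
    using summ[OF 1(3) 2(3)] by (simp add: X_def if_distrib[of "norm2"] if_distrib[of "\<lambda>x. x\<^sup>2"] cong: if_cong)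
  moreover have "(\<lambda>k. (norm2 (Y k))\<^sup>2) =
    (\<lambda>k. if even k then (norm2 (\<eta> (k div 2)))\<^sup>2 else (norm2 (\<eta>' (k div 2)))\<^sup>2)"
    unfolding Y_def using L2_norm_mult[of haar "-1"] by auto
  then have "summable (\<lambda>k. (norm2 (Y k))\<^sup>2)"
    using summ[OF 1(4) 2(4)] by simp
  moreover have "\<phi> S - \<psi> S = (\<Sum>k. inner2 (S (X k)) (Y k))" if S: "S \<in> group_VN G T" for S
  proof -
    have a: "(\<lambda>k. inner2 (S (\<xi> k)) (\<eta> k)) sums \<phi> S"
      using 1(5)[OF S] VN_predual_summable[OF S 1(1-4)] by (simp add: sums_iff)
    have "(\<lambda>k. inner2 (S (\<xi>' k)) (\<eta>' k)) sums \<psi> S"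
      using 2(5)[OF S] VN_predual_summable[OF S 2(1-4)] by (simp add: sums_iff)
    then have b: "(\<lambda>k. - inner2 (S (\<xi>' k)) (\<eta>' k)) sums (- \<psi> S)"
      by (rule sums_minus)
    have "(\<lambda>k. inner2 (S (X k)) (Y k)) =
      (\<lambda>k. if even k then inner2 (S (\<xi> (k div 2))) (\<eta> (k div 2)) else - inner2 (S (\<xi>' (k div 2))) (\<eta>' (k div 2)))"
      unfolding X_def Y_def using L2_inner_mult_right[of haar _ "-1"] by auto
    with sums_interleave[OF a b] show ?thesis by (simp add: sums_iff)
  qed
  ultimately show ?thesis unfolding VN_predual_def Let_def by blast
qed

lemma fourier_algebra_diff:
  assumes "u \<in> fourier_algebra G T" "v \<in> fourier_algebra G T"
  shows "(\<lambda>g\<in>carrier G. u g - v g) \<in> fourier_algebra G T"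
proof -
  obtain \<phi> \<psi> where uv: "\<phi> \<in> VN_predual G T" "u = predual_function G \<phi>"
    "\<psi> \<in> VN_predual G T" "v = predual_function G \<psi>"
    using assms by (auto simp: fourier_algebra_def)
  have "(\<lambda>g\<in>carrier G. u g - v g) = predual_function G (\<lambda>S. \<phi> S - \<psi> S)"
    by (auto simp: uv predual_function_def fun_eq_iff)
  then show ?thesis
    using VN_predual_diff uv by (auto simp: fourier_algebra_def)
qed

section \<open>Strong continuity of the left regular representation\<close>

lemma inverse_nbhds:
  assumes "V \<in> nbhds"
  shows "{g \<in> carrier G. inv g \<in> V} \<in> nbhds"
  using openin_continuous_map_preimage[OF continuous_inv, of V] assms
  by (simp add: nbhds_def topspace_eq)

text \<open>The separating neighbourhood acts by right translations; inversion converts these to left ones.\<close>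

lemma translate_subset_nbhd:
  assumes K: "compactin T K" and U: "openin T U" and KU: "K \<subseteq> U"
  obtains V where "V \<in> nbhds" "\<And>g. g \<in> V \<Longrightarrow> translate g K \<subseteq> U \<and> translate (inv g) K \<subseteq> U"
proof -
  have Kc: "K \<subseteq> carrier G" using K by (rule compactin_subset)
  have "compactin T (carrier G - U)"
    using U by (simp add: compactin_iff_closedin topspace_eq[symmetric] openin_closedin_eq)
  then have c: "compactin T ((\<lambda>x. inv x) ` K)" "compactin T ((\<lambda>x. inv x) ` (carrier G - U))"
    using K continuous_inv by (auto intro: image_compactin)
  have "(\<lambda>x. inv x) ` K \<inter> (\<lambda>x. inv x) ` (carrier G - U) = {}"
    using KU Kc by auto (metis DiffI inv_inv subsetD)
  with c obtain W where W: "W \<in> nbhds"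
    "\<And>a V. \<lbrakk>a \<in> carrier G; V \<subseteq> W\<rbrakk> \<Longrightarrow>
      translate a V \<inter> (\<lambda>x. inv x) ` K = {} \<or> translate a V \<inter> (\<lambda>x. inv x) ` (carrier G - U) = {}"
    by (rule separating_nbhd) blast
  have sub: "translate g K \<subseteq> U" if g: "g \<in> carrier G" "inv g \<in> W" for g
  proof
    fix y assume "y \<in> translate g K"
    then obtain x where x: "x \<in> K" "y = g \<otimes> x" by (auto simp: translate_def)
    then have xc: "x \<in> carrier G" using Kc by blast
    have "inv x \<in> translate (inv x) W \<inter> (\<lambda>x. inv x) ` K"
      using x xc W(1) by (force simp: translate_def nbhds_def)
    with W(2)[of "inv x" W] xc have "translate (inv x) W \<inter> (\<lambda>x. inv x) ` (carrier G - U) = {}" by auto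
    moreover have "inv y \<in> translate (inv x) W"
      using g xc x by (auto simp: translate_def inv_mult_group)
    ultimately show "y \<in> U" using g xc x by auto
  qed
  show ?thesis
  proof (rule that[of "W \<inter> {g \<in> carrier G. inv g \<in> W}"])
    show "W \<inter> {g \<in> carrier G. inv g \<in> W} \<in> nbhds"
      using W(1) inverse_nbhds nbhds_Int by blast
    show "translate g K \<subseteq> U \<and> translate (inv g) K \<subseteq> U" if "g \<in> W \<inter> {g \<in> carrier G. inv g \<in> W}" for g
      using that sub[of g] sub[of "inv g"] by simp
  qed
qed

lemma measure_approx_open:
  assumes A: "A \<in> sets haar" and e: "e > 0"
  obtains U where "openin T U" "A \<subseteq> U" "measure haar U < measure haar A + e"
proof -
  have "emeasure haar A < ennreal (measure haar A + e)"
    using e by (simp add: haar.emeasure_eq_measure ennreal_lessI)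
  then obtain U where U: "openin T U" "A \<subseteq> U" "emeasure haar U < ennreal (measure haar A + e)"
    unfolding outer_regular_haar[OF A] INF_less_iff by auto
  then have "measure haar U < measure haar A + e"
    using e by (simp add: haar.emeasure_eq_measure ennreal_less_iff del: ennreal_plus)
  with U that show ?thesis by blast
qed

text \<open>Outer regularity is used for A and for its complement, each with error e / 2; the
  complement of an open set is compact because the group is.\<close>

lemma measure_approx_compact_open:
  assumes A: "A \<in> sets haar" and e: "e > 0"
  obtains K U where "compactin T K" "openin T U" "K \<subseteq> A" "A \<subseteq> U" "measure haar (U - K) < e"
proof -
  have Ac: "A \<subseteq> carrier G" using sets.sets_into_space[OF A] by (simp add: space_haar)
  obtain U where U: "openin T U" "A \<subseteq> U" "measure haar U < measure haar A + e / 2"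
    using measure_approx_open[OF A] e by (metis half_gt_zero)
  have A': "carrier G - A \<in> sets haar" using sets.compl_sets[OF A] by (simp add: space_haar)
  obtain W where W: "openin T W" "carrier G - A \<subseteq> W" "measure haar W < measure haar (carrier G - A) + e / 2"
    using measure_approx_open[OF A'] e by (metis half_gt_zero)
  have Wc: "W \<subseteq> carrier G" using W openin_subset_carrier by blast
  show ?thesis
  proof (rule that[of "carrier G - W" U])
    show "compactin T (carrier G - W)"
      using W(1) by (simp add: compactin_iff_closedin topspace_eq[symmetric] openin_closedin_eq)
    show "openin T U" "A \<subseteq> U" "carrier G - W \<subseteq> A" using U W by auto
    have s: "carrier G - W \<in> sets haar" using sets.compl_sets[OF sets_haar_open[OF W(1)]] by (simp add: space_haar)
    have "measure haar (U - (carrier G - W)) = measure haar U - measure haar (carrier G - W)"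
      by (rule haar.finite_measure_Diff[OF sets_haar_open[OF U(1)] s]) (use U W in auto)
    moreover have "measure haar (carrier G - W) = mass - measure haar W"
      using haar.finite_measure_compl[OF sets_haar_open[OF W(1)]] by (simp add: space_haar mass_def)
    moreover have "measure haar (carrier G - A) = mass - measure haar A"
      using haar.finite_measure_compl[OF A] by (simp add: space_haar mass_def)
    ultimately show "measure haar (U - (carrier G - W)) < e" using U W by simp
  qed
qed

abbreviation shift_norm :: "'a \<Rightarrow> ('a \<Rightarrow> complex) \<Rightarrow> real" where
  "shift_norm g f \<equiv> norm2 (\<lambda>x. left_regular G g f x - f x)"

text \<open>Continuity of the orbit is required at the identity only. The functions with this
  property turn out to form a closed subspace containing all indicators, hence all of
  \<open>L2 haar\<close>.\<close>

definition L2_continuous :: "('a \<Rightarrow> complex) \<Rightarrow> bool" where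
  "L2_continuous f \<longleftrightarrow> f \<in> L2 haar \<and>
     (\<forall>e>0. \<exists>V\<in>nbhds. \<forall>g\<in>V. shift_norm g f < e)"

lemma translate_sets: "g \<in> carrier G \<Longrightarrow> A \<in> sets haar \<Longrightarrow> translate g A \<in> sets haar"
proof -
  assume g: "g \<in> carrier G" and A: "A \<in> sets haar"
  have "A \<subseteq> carrier G" using sets.sets_into_space[OF A] by (simp add: space_haar)
  then have "translate g A = (\<lambda>x. inv g \<otimes> x) -` A \<inter> space haar"
    using g by (auto simp: in_translate_iff space_haar)
  then show ?thesis using measurable_sets[OF measurable_left_mult A, of "inv g"] g by simp
qed

text \<open>If g and its inverse both move K into U, then for a point x of the symmetric difference
  of A and its translate either x or \<open>inv g \<otimes> x\<close> lies in \<open>U - K\<close>,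
  which has small measure.\<close>

lemma L2_continuous_indicator:
  assumes A: "A \<in> sets haar"
  shows "L2_continuous (indicator A)"
  unfolding L2_continuous_def
proof (intro conjI allI impI)
  have ind: "indicator B \<in> L2 haar" if "B \<in> sets haar" for B
    by (rule L2_dominated[where h = "\<lambda>_. 1"]) (use that in \<open>auto simp: indicator_def\<close>)
  then show "indicator A \<in> L2 haar" using A by simp
  have Ac: "A \<subseteq> carrier G" using sets.sets_into_space[OF A] by (simp add: space_haar)
  fix e :: real assume e: "e > 0"
  \<comment> \<open>The squared norm is the measure of a symmetric difference, and this will be
    covered by two sets of measure below e^2 / 2.\<close>
  then have e2: "e\<^sup>2 / 2 > 0" by simp
  obtain K U where KU: "compactin T K" "openin T U" "K \<subseteq> A" "A \<subseteq> U" "measure haar (U - K) < e\<^sup>2 / 2"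
    using measure_approx_compact_open[OF A e2] by metis
  obtain V where V: "V \<in> nbhds" "\<And>g. g \<in> V \<Longrightarrow> translate g K \<subseteq> U \<and> translate (inv g) K \<subseteq> U"
    using translate_subset_nbhd[OF KU(1,2)] KU by (metis order_trans)
  have Kc: "K \<subseteq> carrier G" and Uc: "U \<subseteq> carrier G"
    using KU compactin_subset openin_subset_carrier by auto
  have "carrier G - (carrier G - K) \<in> sets haar"
    using KU(1) by (intro sets.Diff sets_haar_open) (simp_all add: compactin_iff_closedin closedin_def topspace_eq[symmetric])
  then have "K \<in> sets haar" using Kc by (simp add: double_diff)
  then have UK: "U - K \<in> sets haar" using KU sets_haar_open by auto
  show "\<exists>V\<in>nbhds. \<forall>g\<in>V. shift_norm g (indicator A) < e"
  proof (intro bexI[OF _ V(1)] ballI)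
    fix g assume gV: "g \<in> V"
    then have g: "g \<in> carrier G" using nbhds_subset[OF V(1)] by blast
    define D where "D = (translate g A - A) \<union> (A - translate g A)"
    have "K \<subseteq> translate g U"
      using V(2)[OF gV] translate_mono[of "translate (inv g) K" U g] Kc g by (simp add: translate_inv)
    moreover have "translate g K \<subseteq> U" using V(2)[OF gV] by simp
    ultimately have D: "D \<subseteq> (U - K) \<union> translate g (U - K)"
    proof (intro subsetI)
      fix x assume x: "x \<in> D" and sub: "K \<subseteq> translate g U" "translate g K \<subseteq> U"
      have "translate g A \<subseteq> carrier G" using Ac g by (intro translate_subset)
      then have xc: "x \<in> carrier G" using x Ac by (auto simp: D_def)
      define y where "y = inv g \<otimes> x"
      have mem: "x \<in> translate g B \<longleftrightarrow> y \<in> B" if "B \<subseteq> carrier G" for B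
        using in_translate_iff[OF g that] xc by (simp add: y_def)
      have "U - K \<subseteq> carrier G" using Uc by blast
      note m = mem[OF this] mem[OF Ac] mem[OF Kc] mem[OF Uc]
      have "y \<in> A \<longleftrightarrow> x \<notin> A" using x m(2) by (auto simp: D_def)
      moreover have "x \<in> K \<Longrightarrow> y \<in> U" "y \<in> K \<Longrightarrow> x \<in> U" using sub m by auto
      ultimately show "x \<in> (U - K) \<union> translate g (U - K)" using m(1) KU(3,4) by auto
    qed
    have Ds: "D \<in> sets haar" using A translate_sets[OF g A] by (auto simp: D_def)
    have "(shift_norm g (indicator A))\<^sup>2 = (\<integral>x. indicator D x \<partial>haar)"
      unfolding L2_norm_power2
      by (rule Bochner_Integration.integral_cong)
        (use g Ac in \<open>auto simp: D_def left_regular_def indicator_def space_haar in_translate_iff\<close>)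
    also have "\<dots> = measure haar D" using Ds by simp
    also have "\<dots> \<le> measure haar ((U - K) \<union> translate g (U - K))"
      using D UK translate_sets[OF g UK] by (intro haar.finite_measure_mono) auto
    also have "\<dots> \<le> measure haar (U - K) + measure haar (translate g (U - K))"
      using UK translate_sets[OF g UK] by (intro measure_Un_le)
    also have "\<dots> < e\<^sup>2"
      using emeasure_haar_translate[OF g UK] KU(5) by (simp add: measure_def)
    finally show "shift_norm g (indicator A) < e"
      using e by (meson less_imp_le power2_less_imp_less)
  qed
qed

lemma L2_continuous_linear:
  assumes f: "L2_continuous f" and h: "L2_continuous h"
  shows "L2_continuous (\<lambda>x. c * f x + h x)" (is "L2_continuous ?k")
  unfolding L2_continuous_def
proof (intro conjI allI impI)
  have L: "f \<in> L2 haar" "h \<in> L2 haar" using f h by (auto simp: L2_continuous_def)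
  then show "?k \<in> L2 haar" by (intro L2_add L2_mult)
  fix e :: real assume e: "e > 0"
  \<comment> \<open>The added 1 keeps the divisor positive when c = 0.\<close>
  define d where "d = e / (cmod c + 1)"
  have c1: "cmod c + 1 > 0" by (simp add: add_nonneg_pos)
  then have d: "d / 2 > 0" "e / 2 > 0" "(cmod c + 1) * d = e" using e by (simp_all add: d_def)
  obtain V where V: "V \<in> nbhds" "\<And>g. g \<in> V \<Longrightarrow> shift_norm g f < d / 2"
    using f d(1) unfolding L2_continuous_def by blast
  obtain W where W: "W \<in> nbhds" "\<And>g. g \<in> W \<Longrightarrow> shift_norm g h < e / 2"
    using h d(2) unfolding L2_continuous_def by blast
  show "\<exists>V\<in>nbhds. \<forall>g\<in>V. shift_norm g ?k < e"
  proof (intro bexI[OF _ nbhds_Int[OF V(1) W(1)]] ballI)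
    fix g assume g: "g \<in> V \<inter> W"
    then have gc: "g \<in> carrier G" using nbhds_subset[OF V(1)] by blast
    have "shift_norm g ?k =
      norm2 (\<lambda>x. c * (left_regular G g f x - f x) + (left_regular G g h x - h x))"
      by (rule arg_cong[where f = "norm2"]) (simp add: fun_eq_iff left_regular_def algebra_simps)
    also have "\<dots> \<le> norm2 (\<lambda>x. c * (left_regular G g f x - f x)) + shift_norm g h"
      using L gc by (intro L2_norm_triangle L2_mult L2_diff left_regular_L2)
    also have "\<dots> \<le> (cmod c + 1) * shift_norm g f + shift_norm g h"
      unfolding L2_norm_mult by (intro add_right_mono mult_right_mono) auto
    also have "\<dots> < (cmod c + 1) * (d / 2) + e / 2"
      using V(2)[of g] W(2)[of g] g c1 by (intro add_strict_mono mult_strict_left_mono) auto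
    also have "\<dots> = e" using d(3) by simp
    finally show "shift_norm g ?k < e" .
  qed
qed

text \<open>Translations are isometric, so the approximation error enters twice and the shift of h
  once, each below e / 3.\<close>

lemma L2_continuous_limit:
  assumes L: "f \<in> L2 haar"
    and ap: "\<And>e. e > 0 \<Longrightarrow> \<exists>h. L2_continuous h \<and> norm2 (\<lambda>x. f x - h x) < e"
  shows "L2_continuous f"
  unfolding L2_continuous_def
proof (intro conjI allI impI L)
  fix e :: real assume e: "e > 0"
  then have e3: "e / 3 > 0" by simp
  obtain h where h: "L2_continuous h" "norm2 (\<lambda>x. f x - h x) < e / 3" using ap[OF e3] by blast
  obtain V where V: "V \<in> nbhds" "\<And>g. g \<in> V \<Longrightarrow> shift_norm g h < e / 3"
    using h e3 unfolding L2_continuous_def by blast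
  have hL: "h \<in> L2 haar" using h by (simp add: L2_continuous_def)
  have d: "(\<lambda>x. f x - h x) \<in> L2 haar" using L hL by (rule L2_diff)
  show "\<exists>V\<in>nbhds. \<forall>g\<in>V. shift_norm g f < e"
  proof (intro bexI[OF _ V(1)] ballI)
    fix g assume gV: "g \<in> V"
    then have g: "g \<in> carrier G" using nbhds_subset[OF V(1)] by blast
    let ?a = "\<lambda>x. left_regular G g (\<lambda>x. f x - h x) x"
    let ?b = "\<lambda>x. left_regular G g h x - h x"
    let ?c = "\<lambda>x. - 1 * (f x - h x)"
    have "shift_norm g f = norm2 (\<lambda>x. ?a x + (?b x + ?c x))"
      by (rule arg_cong[where f = "norm2"]) (simp add: fun_eq_iff left_regular_def)
    also have "\<dots> \<le> norm2 ?a + norm2 (\<lambda>x. ?b x + ?c x)"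
      using d hL g by (intro L2_norm_triangle L2_add L2_diff L2_mult left_regular_L2) (auto simp: L)
    also have "norm2 (\<lambda>x. ?b x + ?c x) \<le> norm2 ?b + norm2 ?c"
      using d hL g by (intro L2_norm_triangle L2_diff L2_mult left_regular_L2) (auto simp: L)
    also have "norm2 ?a = norm2 (\<lambda>x. f x - h x)"
      using L2_norm_left_regular[OF g L2_measurable[OF d]] by simp
    also have "norm2 ?c = norm2 (\<lambda>x. f x - h x)"
      unfolding L2_norm_mult by simp
    finally show "shift_norm g f < e"
      using h(2) V(2)[OF gV] by linarith
  qed
qed

lemma L2_continuous_simple:
  assumes "finite Y" "\<And>y. y \<in> Y \<Longrightarrow> B y \<in> sets haar"
  shows "L2_continuous (\<lambda>x. \<Sum>y\<in>Y. y * indicator (B y) x)"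
  using assms
proof (induction Y rule: finite_induct)
  case empty
  show ?case using L2_continuous_indicator[of "{}"] by (simp add: indicator_def[abs_def])
next
  case (insert y Y)
  then show ?case
    unfolding sum.insert[OF insert(1,2)]
    by (intro L2_continuous_linear L2_continuous_indicator) auto
qed

text \<open>Simple functions dominated by twice the modulus of f converge to f pointwise, hence in
  L^2 by dominated convergence, and each of them is a finite combination of indicators.\<close>

lemma left_regular_strongly_continuous:
  assumes f: "f \<in> L2 haar"
  shows "L2_continuous f"
proof (rule L2_continuous_limit[OF f])
  fix e :: real assume e: "e > 0"
  obtain F where F: "\<And>i. simple_function haar (F i)" "\<And>x. x \<in> space haar \<Longrightarrow> (\<lambda>i. F i x) \<longlonglongrightarrow> f x"
    "\<And>i x. x \<in> space haar \<Longrightarrow> dist (F i x) 0 \<le> 2 * dist (f x) 0"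
    using borel_measurable_implies_sequence_metric[OF L2_measurable[OF f], of 0] by blast
  have fm: "F i \<in> borel_measurable haar" for i using F(1) by (rule borel_measurable_simple_function)
  have fL: "F i \<in> L2 haar" for i
  proof (rule L2_dominated[OF fm])
    show "integrable haar (\<lambda>x. 4 * (cmod (f x))\<^sup>2)" using f by (simp add: L2_def)
    show "(cmod (F i x))\<^sup>2 \<le> 4 * (cmod (f x))\<^sup>2" if "x \<in> space haar" for x
      using power_mono[OF F(3)[OF that, of i], of 2] by (simp add: power_mult_distrib)
  qed
  have "(\<lambda>i. \<integral>x. (cmod (f x - F i x))\<^sup>2 \<partial>haar) \<longlonglongrightarrow> (\<integral>x. 0 \<partial>haar)"
  proof (rule integral_dominated_convergence)
    \<comment> \<open>The factor is (1 + 2)^2, from the triangle inequality and the domination of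
      \<open>F i\<close> by 2 times the modulus of f.\<close>
    show "integrable haar (\<lambda>x. 9 * (cmod (f x))\<^sup>2)" using f by (simp add: L2_def)
    show "(\<lambda>x. (cmod (f x - F i x))\<^sup>2) \<in> borel_measurable haar" for i
      using L2_measurable[OF L2_diff[OF f fL]] by measurable
    show "AE x in haar. (\<lambda>i. (cmod (f x - F i x))\<^sup>2) \<longlonglongrightarrow> 0"
    proof (rule AE_I2)
      fix x assume "x \<in> space haar"
      have "(\<lambda>i. (cmod (f x - F i x))\<^sup>2) \<longlonglongrightarrow> (cmod (f x - f x))\<^sup>2"
        by (intro tendsto_intros F(2) \<open>x \<in> space haar\<close>)
      then show "(\<lambda>i. (cmod (f x - F i x))\<^sup>2) \<longlonglongrightarrow> 0" by simp
    qed
    show "AE x in haar. norm ((cmod (f x - F i x))\<^sup>2) \<le> 9 * (cmod (f x))\<^sup>2" for i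
    proof (rule AE_I2)
      fix x assume "x \<in> space haar"
      then have "cmod (f x - F i x) \<le> 3 * cmod (f x)"
        using F(3)[of x i] norm_triangle_ineq4[of "f x" "F i x"] by simp
      from power_mono[OF this norm_ge_zero, of 2]
      show "norm ((cmod (f x - F i x))\<^sup>2) \<le> 9 * (cmod (f x))\<^sup>2" by (simp add: power_mult_distrib)
    qed
  qed simp
  then have "eventually (\<lambda>i. (\<integral>x. (cmod (f x - F i x))\<^sup>2 \<partial>haar) < e\<^sup>2) sequentially"
    using e by (intro order_tendstoD(2)) auto
  then obtain i where "(\<integral>x. (cmod (f x - F i x))\<^sup>2 \<partial>haar) < e\<^sup>2"
    by (meson eventually_happens trivial_limit_sequentially)
  then have i: "norm2 (\<lambda>x. f x - F i x) < e"
    using e unfolding L2_norm_power2[symmetric] by (meson less_imp_le power2_less_imp_less)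
  define F' where "F' x = (\<Sum>y\<in>F i ` space haar. y * indicator (F i -` {y} \<inter> space haar) x)" for x
  have "L2_continuous F'"
    unfolding F'_def using F(1)[of i] by (intro L2_continuous_simple) (auto simp: simple_function_def)
  moreover have "norm2 (\<lambda>x. f x - F' x) = norm2 (\<lambda>x. f x - F i x)"
  proof -
    have "F' x = F i x" if x: "x \<in> space haar" for x
    proof -
      have "F' x = (\<Sum>y\<in>F i ` space haar. if y = F i x then y else 0)"
        unfolding F'_def using x by (intro sum.cong) (auto simp: indicator_def)
      also have "\<dots> = F i x" using F(1)[of i] x by (simp add: simple_function_def)
      finally show ?thesis .
    qed
    then show ?thesis unfolding L2_norm_def by (simp cong: Bochner_Integration.integral_cong)
  qed
  ultimately show "\<exists>h. L2_continuous h \<and> norm2 (\<lambda>x. f x - h x) < e" using i by metis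
qed

text \<open>For \<open>y = a \<otimes> v\<close> the difference of the shifts of f by y and by a is
  the shift by a of \<open>left_regular G v f - f\<close>, so continuity at the identity carries
  over to a.\<close>

lemma continuous_map_coefficient:
  assumes f: "f \<in> L2 haar" and h: "h \<in> L2 haar"
  shows "continuous_map T euclidean (\<lambda>g. inner2 (left_regular G g f) h)"
  unfolding mtopology_is_euclidean[symmetric] Met_TC.continuous_map_to_metric
proof (intro ballI allI impI)
  fix a and e :: real assume "a \<in> topspace T" and e: "e > 0"
  then have a: "a \<in> carrier G" by (simp add: topspace_eq)
  define d where "d = e / (norm2 h + 1)"
  have d: "d > 0" using e by (simp add: d_def add_nonneg_pos)
  obtain V where V: "V \<in> nbhds" "\<And>g. g \<in> V \<Longrightarrow> shift_norm g f < d"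
    using left_regular_strongly_continuous[OF f] d unfolding L2_continuous_def by blast
  show "\<exists>U. openin T U \<and> a \<in> U \<and>
      (\<forall>y\<in>U. inner2 (left_regular G y f) h \<in> Met_TC.mball (inner2 (left_regular G a f) h) e)"
  proof (intro exI conjI ballI)
    show "openin T (translate a V)" using openin_translate[OF a] V(1) by (simp add: nbhds_def)
    show "a \<in> translate a V" using a V(1) by (force simp: translate_def nbhds_def)
    fix y assume "y \<in> translate a V"
    then obtain v where v: "v \<in> V" "y = a \<otimes> v" by (auto simp: translate_def)
    then have vc: "v \<in> carrier G" using nbhds_subset[OF V(1)] by blast
    then have y: "y \<in> carrier G" using a v by simp
    let ?k = "\<lambda>x. left_regular G v f x - f x"
    have k: "?k \<in> L2 haar" using f vc by (intro L2_diff left_regular_L2)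
    have "norm2 (\<lambda>x. left_regular G y f x - left_regular G a f x) = norm2 (left_regular G a ?k)"
      unfolding L2_norm_def
      by (intro arg_cong[where f = sqrt] Bochner_Integration.integral_cong)
        (use a vc in \<open>simp_all add: v space_haar left_regular_def inv_mult_group m_assoc\<close>)
    also have "\<dots> = norm2 ?k" by (rule L2_norm_left_regular[OF a L2_measurable[OF k]])
    also have "\<dots> < d" by (rule V(2)[OF v(1)])
    finally have "norm2 (\<lambda>x. left_regular G y f x - left_regular G a f x) \<le> d" by simp
    have "dist (inner2 (left_regular G a f) h) (inner2 (left_regular G y f) h) =
      cmod (inner2 (\<lambda>x. left_regular G y f x - left_regular G a f x) h)"
      using a y f h by (simp add: dist_norm norm_minus_commute L2_inner_diff_left left_regular_L2)
    also have "\<dots> \<le> norm2 (\<lambda>x. left_regular G y f x - left_regular G a f x) * norm2 h"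
      using a y f h by (intro L2_Cauchy_Schwarz L2_diff left_regular_L2)
    also have "\<dots> \<le> d * norm2 h"
      by (intro mult_right_mono) (fact, simp)
    also have "\<dots> < d * (norm2 h + 1)" using d by simp
    also have "\<dots> = e"
    proof -
      have "norm2 h + 1 \<noteq> 0" using L2_norm_nonneg[of haar h] by linarith
      then show ?thesis by (simp add: d_def)
    qed
    finally show "inner2 (left_regular G y f) h \<in> Met_TC.mball (inner2 (left_regular G a f) h) e"
      by simp
  qed
qed

text \<open>Since all translations are isometric, the series of coefficients has a summable majorant
  that does not depend on g, and its sum is a uniform limit of continuous functions.\<close>

theorem fourier_algebra_continuous:
  assumes "u \<in> fourier_algebra G T"
  shows "continuous_map T euclidean u"
proof -
  obtain \<phi> where "\<phi> \<in> VN_predual G T" and u: "u = predual_function G \<phi>"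
    using assms by (auto simp: fourier_algebra_def)
  then obtain \<xi> \<eta> where 1: "\<And>k::nat. \<xi> k \<in> L2 haar" "\<And>k. \<eta> k \<in> L2 haar"
    "summable (\<lambda>k. (norm2 (\<xi> k))\<^sup>2)" "summable (\<lambda>k. (norm2 (\<eta> k))\<^sup>2)"
    "\<And>S. S \<in> group_VN G T \<Longrightarrow> \<phi> S = (\<Sum>k. inner2 (S (\<xi> k)) (\<eta> k))"
    unfolding VN_predual_def Let_def by blast
  let ?c = "\<lambda>k g. inner2 (left_regular G g (\<xi> k)) (\<eta> k)"
  have lim: "uniform_limit (carrier G) (\<lambda>n g. \<Sum>k<n. ?c k g) (\<lambda>g. \<Sum>k. ?c k g) sequentially"
  proof (rule Weierstrass_m_test)
    show "summable (\<lambda>k. 1 * ((norm2 (\<xi> k))\<^sup>2 + (norm2 (\<eta> k))\<^sup>2))"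
      using 1 by (intro summable_mult summable_add)
    show "norm (?c k g) \<le> 1 * ((norm2 (\<xi> k))\<^sup>2 + (norm2 (\<eta> k))\<^sup>2)" if "g \<in> carrier G" for k g
      using 1 that by (intro L2_inner_bound) (auto simp: L2_norm_left_regular L2_measurable left_regular_L2)
  qed
  have "continuous_map T Met_TC.mtopology u"
  proof (rule Met_TC.continuous_map_uniform_limit[where F = sequentially and f = "\<lambda>n g. \<Sum>k<n. ?c k g"])
    show "\<forall>\<^sub>F n in sequentially. continuous_map T Met_TC.mtopology (\<lambda>g. \<Sum>k<n. ?c k g)"
      using continuous_map_coefficient 1 by (auto intro!: always_eventually continuous_map_sum)
    fix e :: real assume "e > 0"
    with lim have "\<forall>\<^sub>F n in sequentially. \<forall>g\<in>carrier G. dist (\<Sum>k<n. ?c k g) (\<Sum>k. ?c k g) < e"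
      by (simp add: uniform_limit_iff)
    then show "\<forall>\<^sub>F n in sequentially. \<forall>g\<in>topspace T. u g \<in> UNIV \<and> dist (\<Sum>k<n. ?c k g) (u g) < e"
      by (rule eventually_mono) (auto simp: topspace_eq u predual_function_def 1(5) left_regular_group_VN)
  qed simp
  then show ?thesis by simp
qed

end

section \<open>Coefficients of unitary representations\<close>

locale unitary_representation = compact_group +
  fixes N :: nat and \<pi> :: "'a \<Rightarrow> nat \<Rightarrow> nat \<Rightarrow> complex"
  assumes continuous_coefficient: "\<And>i j. \<lbrakk>i < N; j < N\<rbrakk> \<Longrightarrow> continuous_map T euclidean (\<lambda>g. \<pi> g i j)"
    and rows_orthonormal: "\<And>g i j. \<lbrakk>g \<in> carrier G; i < N; j < N\<rbrakk> \<Longrightarrow>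
          (\<Sum>r<N. \<pi> g i r * cnj (\<pi> g j r)) = (if i = j then 1 else 0)"
    and representation_mult: "\<And>g x i j. \<lbrakk>g \<in> carrier G; x \<in> carrier G; i < N; j < N\<rbrakk> \<Longrightarrow>
          \<pi> (g \<otimes> x) i j = (\<Sum>r<N. \<pi> g i r * \<pi> x r j)"
begin

text \<open>Parseval for a combination of orthonormal rows. The map q selects the rows, and its
  injectivity turns the Kronecker delta of row numbers into one of the indices j.\<close>

lemma rows_isometry:
  fixes n :: nat
  assumes x: "x \<in> carrier G" and q: "inj_on q {..<n}" "q ` {..<n} \<subseteq> {..<N}"
  shows "(\<Sum>r<N. (cmod (\<Sum>j<n. v j * cnj (\<pi> x (q j) r)))\<^sup>2) = (\<Sum>j<n. (cmod (v j))\<^sup>2)"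
proof -
  have "complex_of_real (\<Sum>r<N. (cmod (\<Sum>j<n. v j * cnj (\<pi> x (q j) r)))\<^sup>2) =
    (\<Sum>r<N. \<Sum>j<n. \<Sum>k<n. v j * cnj (v k) * (\<pi> x (q k) r * cnj (\<pi> x (q j) r)))"
    unfolding of_real_sum complex_norm_square cnj_sum sum_product
    by (intro sum.cong refl) (simp add: mult_ac)
  also have "\<dots> = (\<Sum>j<n. \<Sum>r<N. \<Sum>k<n. v j * cnj (v k) * (\<pi> x (q k) r * cnj (\<pi> x (q j) r)))"
    by (rule sum.swap)
  also have "\<dots> = (\<Sum>j<n. \<Sum>k<n. \<Sum>r<N. v j * cnj (v k) * (\<pi> x (q k) r * cnj (\<pi> x (q j) r)))"
    by (intro sum.cong refl sum.swap)
  also have "\<dots> = (\<Sum>j<n. \<Sum>k<n. if k = j then v j * cnj (v k) else 0)"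
  proof (intro sum.cong refl)
    fix j k assume jk: "j \<in> {..<n}" "k \<in> {..<n}"
    have "q j < N" "q k < N" using q(2) jk by auto
    then have "(\<Sum>r<N. \<pi> x (q k) r * cnj (\<pi> x (q j) r)) = (if q k = q j then 1 else 0)"
      using x by (intro rows_orthonormal) auto
    moreover have "q k = q j \<longleftrightarrow> k = j" using q(1) jk by (auto dest: inj_onD)
    ultimately show "(\<Sum>r<N. v j * cnj (v k) * (\<pi> x (q k) r * cnj (\<pi> x (q j) r))) = (if k = j then v j * cnj (v k) else 0)"
      by (simp add: sum_distrib_left[symmetric])
  qed
  also have "\<dots> = (\<Sum>j<n. v j * cnj (v j))"
    by (intro sum.cong refl) (simp add: sum.delta)
  also have "\<dots> = complex_of_real (\<Sum>j<n. (cmod (v j))\<^sup>2)"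
    by (simp only: of_real_sum complex_norm_square)
  finally show ?thesis by (simp only: of_real_eq_iff)
qed

text \<open>For fixed q these N functions are the components of the vector in N copies of L^2
  assigned to the q-th basis vector of C^N; up to normalisation by \<open>mass\<close> this is the
  compressing isometry.\<close>

definition row_fun :: "nat \<Rightarrow> nat \<Rightarrow> 'a \<Rightarrow> complex" where
  "row_fun q r = (\<lambda>x. cnj (\<pi> x q r))"

lemma row_fun_L2:
  assumes "q < N" "r < N"
  shows "row_fun q r \<in> L2 haar"
proof (rule L2_dominated[where h = "\<lambda>_. 1"])
  show "row_fun q r \<in> borel_measurable haar"
    unfolding row_fun_def
    by (intro borel_measurable_cnj continuous_map_measurable continuous_coefficient assms)
  show "(cmod (row_fun q r x))\<^sup>2 \<le> 1" if "x \<in> space haar" for x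
  proof -
    have "(cmod (row_fun q r x))\<^sup>2 \<le> (\<Sum>r<N. (cmod (row_fun q r x))\<^sup>2)"
      using assms by (intro member_le_sum) auto
    also have "\<dots> = 1"
      using rows_isometry[of x "\<lambda>_. q" 1 "\<lambda>_. 1"] assms that
      by (auto simp: space_haar row_fun_def inj_on_def)
    finally show ?thesis .
  qed
qed simp

lemma row_combination_norm:
  fixes n :: nat
  assumes q: "inj_on q {..<n}" "q ` {..<n} \<subseteq> {..<N}"
  shows "(\<Sum>r<N. (norm2 (\<lambda>x. \<Sum>j<n. v j * row_fun (q j) r x))\<^sup>2) = mass * (\<Sum>j<n. (cmod (v j))\<^sup>2)"
proof -
  have "(\<lambda>x. \<Sum>j<n. v j * row_fun (q j) r x) \<in> L2 haar" if "r < N" for r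
    using q that by (intro L2_sum L2_mult row_fun_L2) auto
  then have "(\<Sum>r<N. (norm2 (\<lambda>x. \<Sum>j<n. v j * row_fun (q j) r x))\<^sup>2) =
      (\<integral>x. (\<Sum>r<N. (cmod (\<Sum>j<n. v j * row_fun (q j) r x))\<^sup>2) \<partial>haar)"
    unfolding L2_norm_power2 by (intro Bochner_Integration.integral_sum[symmetric] L2_integrable) auto
  also have "\<dots> = (\<integral>x. (\<Sum>j<n. (cmod (v j))\<^sup>2) \<partial>haar)"
    by (rule Bochner_Integration.integral_cong) (use q in \<open>auto simp: row_fun_def space_haar rows_isometry\<close>)
  also have "\<dots> = mass * (\<Sum>j<n. (cmod (v j))\<^sup>2)"
    by (simp add: mass_def space_haar)
  finally show ?thesis .
qed

text \<open>This bounds the adjoint of the map in \<open>row_combination_norm\<close>. Pairing F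
  with the combination w whose coefficients are the \<open>b i\<close> gives s, while Cauchy-Schwarz
  bounds the pairing by the norm of F times sqrt (mass s); squaring and cancelling s leaves the
  claim.\<close>

lemma row_Bessel:
  fixes n :: nat
  assumes p: "inj_on p {..<n}" "p ` {..<n} \<subseteq> {..<N}" and F: "\<And>r. r < N \<Longrightarrow> F r \<in> L2 haar"
  shows "(\<Sum>i<n. (cmod (\<Sum>r<N. inner2 (F r) (row_fun (p i) r)))\<^sup>2) \<le> mass * (\<Sum>r<N. (norm2 (F r))\<^sup>2)"
proof -
  define b where "b i = (\<Sum>r<N. inner2 (F r) (row_fun (p i) r))" for i
  define s where "s = (\<Sum>i<n. (cmod (b i))\<^sup>2)"
  define w where "w r x = (\<Sum>i<n. b i * row_fun (p i) r x)" for r x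
  have pN: "p i < N" if "i < n" for i using p(2) that by auto
  have wL: "w r \<in> L2 haar" if "r < N" for r
    unfolding w_def using that pN by (intro L2_sum L2_mult row_fun_L2) auto
  have s0: "0 \<le> s" by (simp add: s_def sum_nonneg)
  have "complex_of_real s = (\<Sum>i<n. cnj (b i) * b i)"
    unfolding s_def of_real_sum complex_norm_square by (simp add: mult.commute)
  also have "\<dots> = (\<Sum>i<n. \<Sum>r<N. inner2 (F r) (\<lambda>x. b i * row_fun (p i) r x))"
    by (subst (2) b_def) (simp add: sum_distrib_left L2_inner_mult_right)
  also have "\<dots> = (\<Sum>r<N. \<Sum>i<n. inner2 (F r) (\<lambda>x. b i * row_fun (p i) r x))"
    by (rule sum.swap)
  also have "\<dots> = (\<Sum>r<N. inner2 (F r) (w r))"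
    unfolding w_def using F pN
    by (intro sum.cong refl L2_inner_sum_right[symmetric]) (auto intro: L2_mult row_fun_L2)
  finally have "s = cmod (\<Sum>r<N. inner2 (F r) (w r))"
    using s0 by (metis abs_of_nonneg norm_of_real)
  also have "\<dots> \<le> (\<Sum>r<N. cmod (inner2 (F r) (w r)))" by (rule norm_sum)
  also have "\<dots> \<le> (\<Sum>r<N. \<bar>norm2 (F r)\<bar> * \<bar>norm2 (w r)\<bar>)"
    using F wL by (intro sum_mono) (auto intro: L2_Cauchy_Schwarz)
  also have "\<dots> \<le> L2_set (\<lambda>r. norm2 (F r)) {..<N} * L2_set (\<lambda>r. norm2 (w r)) {..<N}"
    by (rule L2_set_mult_ineq)
  finally have "s\<^sup>2 \<le> (L2_set (\<lambda>r. norm2 (F r)) {..<N} * L2_set (\<lambda>r. norm2 (w r)) {..<N})\<^sup>2"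
    using s0 by (intro power_mono) auto
  also have "\<dots> = (\<Sum>r<N. (norm2 (F r))\<^sup>2) * (mass * s)"
    using row_combination_norm[OF p, of b] s0 mass_pos
    by (simp add: power_mult_distrib L2_set_def sum_nonneg w_def[symmetric] s_def[symmetric])
  finally have "s * s \<le> (mass * (\<Sum>r<N. (norm2 (F r))\<^sup>2)) * s"
    by (simp add: power2_eq_square mult_ac)
  moreover have "0 \<le> mass * (\<Sum>r<N. (norm2 (F r))\<^sup>2)"
    using mass_pos by (intro mult_nonneg_nonneg sum_nonneg) auto
  ultimately have "s \<le> mass * (\<Sum>r<N. (norm2 (F r))\<^sup>2)"
    using s0 by (cases "s = 0") (auto simp: mult_le_cancel_right)
  then show ?thesis by (simp add: s_def b_def)
qed

text \<open>Up to the factor a, this is the matrix entry in row i and column q of the compression of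
  S, acting on N copies of L^2, by the isometry of the rows; the divisor \<open>mass\<close>
  normalises that isometry.\<close>

definition coefficient_functional :: "real \<Rightarrow> nat \<Rightarrow> nat \<Rightarrow> 'a operator \<Rightarrow> complex" where
  "coefficient_functional a i q S =
     complex_of_real (a / mass) * (\<Sum>r<N. inner2 (S (row_fun q r)) (row_fun i r))"

lemma coefficient_functional_VN_predual:
  assumes "i < N" "q < N"
  shows "coefficient_functional a i q \<in> VN_predual G T"
proof -
  define X where "X k = (if k < N then row_fun q k else (\<lambda>_. 0))" for k
  define Y where "Y k = (if k < N then (\<lambda>x. complex_of_real (a / mass) * row_fun i k x) else (\<lambda>_. 0))" for k
  have "X k \<in> L2 haar" "Y k \<in> L2 haar" for k
    using assms unfolding X_def Y_def by (auto intro: row_fun_L2 L2_zero L2_mult simp del: of_real_divide)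
  moreover have "summable (\<lambda>k. (norm2 (X k))\<^sup>2)" "summable (\<lambda>k. (norm2 (Y k))\<^sup>2)"
    by (rule summable_finite[of "{..<N}"]; simp add: X_def Y_def L2_norm_zero)+
  moreover have "coefficient_functional a i q S = (\<Sum>k. inner2 (S (X k)) (Y k))" for S
  proof -
    \<comment> \<open>From N on the second vector is 0, and so is the inner product, whatever S does
      to the zero function.\<close>
    have "(\<Sum>k. inner2 (S (X k)) (Y k)) = (\<Sum>k<N. inner2 (S (X k)) (Y k))"
      by (rule suminf_finite) (auto simp: Y_def L2_inner_def)
    also have "\<dots> = (\<Sum>k<N. complex_of_real (a / mass) * inner2 (S (row_fun q k)) (row_fun i k))"
      by (rule sum.cong) (auto simp: X_def Y_def L2_inner_mult_right simp del: of_real_divide)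
    finally show ?thesis by (simp add: coefficient_functional_def sum_distrib_left)
  qed
  ultimately show ?thesis unfolding VN_predual_def Let_def by blast
qed

text \<open>Writing \<open>x = g \<otimes> y\<close> expands the i-th row of \<pi> at x in the rows
  of \<pi> at y; orthonormality of the latter leaves the entry of \<pi> at g, constant in x, and
  integration multiplies it by \<open>mass\<close>.\<close>

lemma coefficient_functional_left_regular:
  assumes g: "g \<in> carrier G" and i: "i < N" and q: "q < N"
  shows "coefficient_functional a i q (left_regular G g) = complex_of_real a * \<pi> g i q"
proof -
  have "(\<Sum>r<N. inner2 (left_regular G g (row_fun q r)) (row_fun i r)) =
    (\<integral>x. (\<Sum>r<N. left_regular G g (row_fun q r) x * cnj (row_fun i r x)) \<partial>haar)"
    unfolding L2_inner_def
    by (rule Bochner_Integration.integral_sum[symmetric], rule L2_mult_integrable)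
      (use g i q in \<open>auto intro: left_regular_L2 row_fun_L2\<close>)
  also have "\<dots> = (\<integral>x. \<pi> g i q \<partial>haar)"
  proof (rule Bochner_Integration.integral_cong[OF refl])
    fix x assume "x \<in> space haar"
    then have x: "x \<in> carrier G" by (simp add: space_haar)
    define y where "y = inv g \<otimes> x"
    have y: "y \<in> carrier G" "x = g \<otimes> y" using g x by (auto simp: y_def m_assoc[symmetric])
    have "(\<Sum>r<N. left_regular G g (row_fun q r) x * cnj (row_fun i r x)) =
      (\<Sum>r<N. \<Sum>s<N. \<pi> g i s * (\<pi> y s r * cnj (\<pi> y q r)))"
    proof (rule sum.cong[OF refl])
      fix r assume "r \<in> {..<N}"
      then have "\<pi> x i r = (\<Sum>s<N. \<pi> g i s * \<pi> y s r)"
        using y g i by (simp add: representation_mult)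
      then show "left_regular G g (row_fun q r) x * cnj (row_fun i r x) = (\<Sum>s<N. \<pi> g i s * (\<pi> y s r * cnj (\<pi> y q r)))"
        by (simp add: left_regular_def row_fun_def y_def[symmetric] sum_distrib_left mult_ac)
    qed
    also have "\<dots> = (\<Sum>s<N. \<pi> g i s * (\<Sum>r<N. \<pi> y s r * cnj (\<pi> y q r)))"
      unfolding sum_distrib_left by (rule sum.swap)
    also have "\<dots> = (\<Sum>s<N. if s = q then \<pi> g i s else 0)"
      using y q by (intro sum.cong refl) (simp add: rows_orthonormal)
    also have "\<dots> = \<pi> g i q" using q by simp
    finally show "(\<Sum>r<N. left_regular G g (row_fun q r) x * cnj (row_fun i r x)) = \<pi> g i q" .
  qed
  also have "\<dots> = complex_of_real mass * \<pi> g i q"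
    by (simp add: mass_def space_haar scaleR_conv_of_real)
  finally show ?thesis using mass_pos by (simp add: coefficient_functional_def)
qed

text \<open>The matrix is a / mass times the row map for q, followed by S on N copies of L^2 and the
  adjoint of the row map for p. Each row map has norm at most sqrt mass and S is a contraction,
  which leaves a.\<close>

lemma VN_predual_norm_coefficient_functional:
  assumes a: "0 \<le> a" and p: "inj_on p {..<n}" "p ` {..<n} \<subseteq> {..<N}"
    and q: "inj_on q {..<n}" "q ` {..<n} \<subseteq> {..<N}"
  shows "VN_predual_norm G T n (\<lambda>i j. coefficient_functional a (p i) (q j)) \<le> ennreal a"
  unfolding VN_predual_norm_def
proof (rule SUP_least, clarify)
  fix m :: nat and S :: "nat \<Rightarrow> nat \<Rightarrow> 'a operator"
  assume S: "\<forall>k<m. \<forall>l<m. S k l \<in> group_VN G T" and le: "op_mat_norm haar m S \<le> 1"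
  have Sb: "S k l \<in> bounded_ops haar" if "k < m" "l < m" for k l
    using S that group_VN_bounded_ops by blast
  have pN: "p i < N" "q i < N" if "i < n" for i using p(2) q(2) that by auto
  show "scalar_mat_norm ({..<n} \<times> {..<m}) (\<lambda>(i, k) (j, l). coefficient_functional a (p i) (q j) (S k l)) \<le> ennreal a"
    unfolding scalar_mat_norm_def
  proof (rule SUP_least)
    fix v :: "nat \<times> nat \<Rightarrow> complex"
    assume "v \<in> {v. (\<Sum>i\<in>{..<n} \<times> {..<m}. (cmod (v i))\<^sup>2) \<le> 1}"
    then have v: "(\<Sum>j<n. \<Sum>l<m. (cmod (v (j, l)))\<^sup>2) \<le> 1"
      by (simp add: sum.cartesian_product case_prod_unfold)
    \<comment> \<open>\<open>z l\<close> is the image of the l-th slice of v under the row map for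
      q, and F is the result of applying the operator matrix S to it in each of the N
      copies.\<close>
    define z where "z l r x = (\<Sum>j<n. v (j, l) * row_fun (q j) r x)" for l r x
    define F where "F k r x = (\<Sum>l<m. S k l (z l r) x)" for k r x
    have zL: "z l r \<in> L2 haar" if "r < N" for l r
      unfolding z_def using that pN by (intro L2_sum L2_mult row_fun_L2) auto
    have FL: "F k r \<in> L2 haar" if "r < N" "k < m" for k r
      unfolding F_def using that by (intro L2_sum) (auto intro: bounded_ops_L2 Sb zL)
    have entry: "(\<Sum>(j, l)\<in>{..<n} \<times> {..<m}. coefficient_functional a (p i) (q j) (S k l) * v (j, l)) =
      complex_of_real (a / mass) * (\<Sum>r<N. inner2 (F k r) (row_fun (p i) r))"
      if i: "i < n" and k: "k < m" for i k
    proof -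
      let ?s = "\<lambda>j l r. S k l (row_fun (q j) r)" and ?e = "\<lambda>r. row_fun (p i) r"
      let ?t = "\<lambda>j l r. v (j, l) * inner2 (?s j l r) (?e r)"
      have inner: "inner2 (F k r) (?e r) =
        (\<Sum>l<m. \<Sum>j<n. ?t j l r)"
        if r: "r < N" for r
      proof -
        have "inner2 (F k r) (?e r) = (\<Sum>l<m. inner2 (S k l (z l r)) (?e r))"
          unfolding F_def using r i k pN by (intro L2_inner_sum_left) (auto intro: bounded_ops_L2 Sb zL row_fun_L2)
        \<comment> \<open>An operator passes through the finite sum in z only almost everywhere,
          which inner products do not notice.\<close>
        also have "\<dots> = (\<Sum>l<m. inner2 (\<lambda>x. \<Sum>j<n. v (j, l) * ?s j l r x) (?e r))"
        proof (intro sum.cong refl L2_inner_cong_AE L2_measurable)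
          fix l assume "l \<in> {..<m}"
          then have Skl: "S k l \<in> bounded_ops haar" using k Sb by simp
          have rl: "row_fun (q j) r \<in> L2 haar" if "j < n" for j using that r pN by (intro row_fun_L2) auto
          show "S k l (z l r) \<in> L2 haar" by (intro bounded_ops_L2[OF Skl] zL r)
          show "(\<lambda>x. \<Sum>j<n. v (j, l) * ?s j l r x) \<in> L2 haar"
            by (intro L2_sum L2_mult bounded_ops_L2[OF Skl] rl) simp
          show "?e r \<in> L2 haar" using r i pN by (intro row_fun_L2) auto
          show "AE x in haar. S k l (z l r) x = (\<Sum>j<n. v (j, l) * ?s j l r x)"
            unfolding z_def[abs_def] by (rule bounded_ops_sum[OF Skl]) (use rl in auto)
        qed
        also have "\<dots> = (\<Sum>l<m. \<Sum>j<n. ?t j l r)"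
        proof (rule sum.cong[OF refl])
          fix l assume "l \<in> {..<m}"
          then have Skl: "S k l \<in> bounded_ops haar" using k Sb by simp
          have rl: "row_fun (q j) r \<in> L2 haar" if "j < n" for j using that r pN by (intro row_fun_L2) auto
          have pl: "?e r \<in> L2 haar" using r i pN by (intro row_fun_L2) auto
          have "inner2 (\<lambda>x. \<Sum>j<n. v (j, l) * ?s j l r x) (?e r) =
            (\<Sum>j<n. inner2 (\<lambda>x. v (j, l) * ?s j l r x) (?e r))"
            by (intro L2_inner_sum_left pl L2_mult bounded_ops_L2[OF Skl] rl) simp
          then show "inner2 (\<lambda>x. \<Sum>j<n. v (j, l) * ?s j l r x) (?e r) =
            (\<Sum>j<n. ?t j l r)"
            by (simp add: L2_inner_mult_left)
        qed
        finally show ?thesis .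
      qed
      have "(\<Sum>(j, l)\<in>{..<n} \<times> {..<m}. coefficient_functional a (p i) (q j) (S k l) * v (j, l)) =
        complex_of_real (a / mass) * (\<Sum>j<n. \<Sum>l<m. \<Sum>r<N. ?t j l r)"
        unfolding coefficient_functional_def sum.cartesian_product[symmetric] sum_distrib_left sum_distrib_right
        by (intro sum.cong refl) (simp add: mult_ac)
      also have "(\<Sum>j<n. \<Sum>l<m. \<Sum>r<N. ?t j l r) = (\<Sum>j<n. \<Sum>r<N. \<Sum>l<m. ?t j l r)"
        by (intro sum.cong refl sum.swap)
      also have "\<dots> = (\<Sum>r<N. \<Sum>j<n. \<Sum>l<m. ?t j l r)" by (rule sum.swap)
      also have "\<dots> = (\<Sum>r<N. \<Sum>l<m. \<Sum>j<n. ?t j l r)" by (intro sum.cong refl sum.swap)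
      also have "\<dots> = (\<Sum>r<N. inner2 (F k r) (?e r))"
        by (intro sum.cong refl) (simp add: inner)
      finally show ?thesis .
    qed
    let ?w = "\<lambda>i k. \<Sum>(j, l)\<in>{..<n} \<times> {..<m}. coefficient_functional a (p i) (q j) (S k l) * v (j, l)"
    have "(\<Sum>i<n. \<Sum>k<m. (cmod (?w i k))\<^sup>2) =
      (\<Sum>i<n. \<Sum>k<m. (a / mass)\<^sup>2 * (cmod (\<Sum>r<N. inner2 (F k r) (row_fun (p i) r)))\<^sup>2)"
      by (intro sum.cong refl) (simp add: entry norm_mult norm_divide power_mult_distrib power_divide)
    also have "\<dots> = (a / mass)\<^sup>2 * (\<Sum>k<m. \<Sum>i<n. (cmod (\<Sum>r<N. inner2 (F k r) (row_fun (p i) r)))\<^sup>2)"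
      unfolding sum_distrib_left by (rule sum.swap)
    also have "\<dots> \<le> (a / mass)\<^sup>2 * (\<Sum>k<m. mass * (\<Sum>r<N. (norm2 (F k r))\<^sup>2))"
      using FL by (intro mult_left_mono sum_mono row_Bessel p) auto
    also have "\<dots> = (a / mass)\<^sup>2 * (mass * (\<Sum>r<N. \<Sum>k<m. (norm2 (F k r))\<^sup>2))"
      unfolding sum_distrib_left[symmetric] by (subst (2) sum.swap) (rule refl)
    also have "\<dots> \<le> (a / mass)\<^sup>2 * (mass * (\<Sum>r<N. \<Sum>l<m. (norm2 (z l r))\<^sup>2))"
    \<comment> \<open>The contraction acts separately for each r: amplification by the identity of
      C^N does not increase the norm.\<close>
    proof (rule mult_left_mono[OF mult_left_mono[OF sum_mono]])
      fix r assume "r \<in> {..<N}"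
      then show "(\<Sum>k<m. (norm2 (F k r))\<^sup>2) \<le> (\<Sum>l<m. (norm2 (z l r))\<^sup>2)"
        unfolding F_def[abs_def] by (intro op_mat_norm_le_oneD Sb le zL) auto
    qed (use mass_pos in auto)
    also have "(\<Sum>r<N. \<Sum>l<m. (norm2 (z l r))\<^sup>2) = (\<Sum>l<m. \<Sum>r<N. (norm2 (z l r))\<^sup>2)"
      by (rule sum.swap)
    also have "\<dots> = mass * (\<Sum>l<m. \<Sum>j<n. (cmod (v (j, l)))\<^sup>2)"
      unfolding z_def[abs_def] by (simp add: row_combination_norm[OF q] sum_distrib_left)
    also have "(\<Sum>l<m. \<Sum>j<n. (cmod (v (j, l)))\<^sup>2) = (\<Sum>j<n. \<Sum>l<m. (cmod (v (j, l)))\<^sup>2)"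
      by (rule sum.swap)
    also have "(a / mass)\<^sup>2 * (mass * (mass * (\<Sum>j<n. \<Sum>l<m. (cmod (v (j, l)))\<^sup>2))) =
      a\<^sup>2 * (\<Sum>j<n. \<Sum>l<m. (cmod (v (j, l)))\<^sup>2)"
      using mass_pos by (simp add: power2_eq_square field_simps)
    also have "\<dots> \<le> a\<^sup>2 * 1" by (intro mult_left_mono v) simp
    finally have "(\<Sum>i<n. \<Sum>k<m. (cmod (?w i k))\<^sup>2) \<le> a\<^sup>2" by simp
    then have "sqrt (\<Sum>i<n. \<Sum>k<m. (cmod (?w i k))\<^sup>2) \<le> a"
      using a by (intro real_le_lsqrt)
    then show "ennreal (sqrt (\<Sum>i\<in>{..<n} \<times> {..<m}. (cmod (\<Sum>j\<in>{..<n} \<times> {..<m}.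
        (case i of (i, k) \<Rightarrow> \<lambda>(j, l). coefficient_functional a (p i) (q j) (S k l)) j * v j))\<^sup>2)) \<le> ennreal a"
      by (intro ennreal_leI) (simp add: sum.cartesian_product case_prod_unfold)
  qed
qed

text \<open>The injections cut an n x n block out of a representation of larger dimension; the
  application takes the first half of the indices for the rows and the second half for the
  columns.\<close>

theorem fourier_norm_coefficients:
  assumes a: "0 \<le> a" and p: "inj_on p {..<n}" "p ` {..<n} \<subseteq> {..<N}"
    and q: "inj_on q {..<n}" "q ` {..<n} \<subseteq> {..<N}"
  defines "u \<equiv> \<lambda>i j. \<lambda>g\<in>carrier G. complex_of_real a * \<pi> g (p i) (q j)"
  shows "\<And>i j. \<lbrakk>i < n; j < n\<rbrakk> \<Longrightarrow> u i j \<in> fourier_algebra G T"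
    and "fourier_norm G T n u \<le> ennreal a"
proof -
  have u: "predual_function G (coefficient_functional a (p i) (q j)) = u i j" if "i < n" "j < n" for i j
    using p q that coefficient_functional_left_regular
    by (auto simp: u_def predual_function_def fun_eq_iff image_subset_iff)
  have mem: "coefficient_functional a (p i) (q j) \<in> VN_predual G T" if "i < n" "j < n" for i j
    using p q that by (intro coefficient_functional_VN_predual) auto
  show "u i j \<in> fourier_algebra G T" if "i < n" "j < n" for i j
    using u[OF that] mem[OF that] unfolding fourier_algebra_def by (metis imageI)
  have "fourier_norm G T n u \<le> VN_predual_norm G T n (\<lambda>i j. coefficient_functional a (p i) (q j))"
    unfolding fourier_norm_def by (rule INF_lower) (simp add: u mem)
  also have "\<dots> \<le> ennreal a" by (rule VN_predual_norm_coefficient_functional[OF a p q])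
  finally show "fourier_norm G T n u \<le> ennreal a" .
qed

end

section \<open>A criterion for cb-Helson sets\<close>

context compact_group
begin

definition coset_rel :: "'a set \<Rightarrow> (('a \<Rightarrow> complex) \<times> ('a \<Rightarrow> complex)) set" where
  "coset_rel E = {(u, v). u \<in> fourier_algebra G T \<and> v \<in> fourier_algebra G T \<and>
              (\<lambda>g\<in>carrier G. u g - v g) \<in> fourier_ideal G T E}"

text \<open>Differences stay in the Fourier algebra, so lying in the ideal reduces to vanishing on
  E, and cosets can be handled through restrictions alone.\<close>

lemma coset_rel_iff:
  assumes "E \<subseteq> carrier G"
  shows "(u, v) \<in> coset_rel E \<longleftrightarrow>
    u \<in> fourier_algebra G T \<and> v \<in> fourier_algebra G T \<and> restrict u E = restrict v E"
proof -
  have "restrict u E = restrict v E \<longleftrightarrow> (\<forall>g\<in>E. (\<lambda>g\<in>carrier G. u g - v g) g = 0)"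
    using assms by (auto simp: restrict_def fun_eq_iff subset_iff)
  then show ?thesis
    using fourier_algebra_diff by (auto simp: coset_rel_def fourier_ideal_def)
qed

lemma fourier_quotient_eq: "fourier_quotient G T E = fourier_algebra G T // coset_rel E"
  by (simp add: fourier_quotient_def coset_rel_def)

lemma inc_map_eq:
  assumes E: "E \<subseteq> carrier G" and U: "U \<in> fourier_quotient G T E" and u: "u \<in> U"
  shows "inc_map E U = restrict u E"
proof -
  obtain w where w: "U = coset_rel E `` {w}"
    using U unfolding fourier_quotient_eq by (auto elim: quotientE)
  have "(SOME u. u \<in> U) \<in> U" using someI[of "\<lambda>u. u \<in> U"] u by blast
  with u show ?thesis
    unfolding w inc_map_def by (simp add: coset_rel_iff[OF E])
qed

lemma coset_in_quotient:
  assumes E: "E \<subseteq> carrier G" and u: "u \<in> fourier_algebra G T"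
  shows "coset_rel E `` {u} \<in> fourier_quotient G T E" "u \<in> coset_rel E `` {u}"
  using u by (auto simp: fourier_quotient_eq coset_rel_iff[OF E] intro: quotientI)

lemma quotient_member:
  assumes E: "E \<subseteq> carrier G" and U: "U \<in> fourier_quotient G T E"
  obtains u where "u \<in> fourier_algebra G T" "U = coset_rel E `` {u}" "u \<in> U"
proof -
  obtain w where w: "U = coset_rel E `` {w}" "w \<in> fourier_algebra G T"
    using U unfolding fourier_quotient_eq by (auto elim: quotientE)
  then show ?thesis using that[of w] coset_in_quotient[OF E] by simp
qed

lemma inj_on_inc_map:
  assumes E: "E \<subseteq> carrier G"
  shows "inj_on (inc_map E) (fourier_quotient G T E)"
proof (rule inj_onI)
  fix U V assume UV: "U \<in> fourier_quotient G T E" "V \<in> fourier_quotient G T E" "inc_map E U = inc_map E V"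
  obtain u where u: "U = coset_rel E `` {u}" "u \<in> U" by (rule quotient_member[OF E UV(1)])
  obtain v where v: "V = coset_rel E `` {v}" "v \<in> V" by (rule quotient_member[OF E UV(2)])
  have "restrict u E = restrict v E"
    using UV inc_map_eq[OF E] u(2) v(2) by metis
  then show "U = V" using u v by (auto simp: coset_rel_iff[OF E])
qed

lemma scalar_mat_norm_cong:
  "(\<And>i j. \<lbrakk>i \<in> I; j \<in> I\<rbrakk> \<Longrightarrow> a i j = b i j) \<Longrightarrow> scalar_mat_norm I a = scalar_mat_norm I b"
  unfolding scalar_mat_norm_def by (intro SUP_cong refl) (simp cong: sum.cong)

text \<open>Evaluation at a point is completely contractive on the Fourier algebra, and any choice
  of representatives takes on E the values of the given functions. Hence the restriction map is a
  complete contraction.\<close>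

lemma C0_norm_inc_map_le:
  assumes E: "E \<subseteq> carrier G" and V: "\<forall>i<n. \<forall>j<n. V i j \<in> fourier_quotient G T E"
  shows "C0_norm E n (\<lambda>i j. inc_map E (V i j)) \<le> fourier_quotient_norm G T n V"
  unfolding fourier_quotient_norm_def
proof (rule INF_greatest)
  fix u assume "u \<in> {u. \<forall>i<n. \<forall>j<n. u i j \<in> V i j}"
  then have u: "inc_map E (V i j) = restrict (u i j) E" if "i < n" "j < n" for i j
    using inc_map_eq[OF E] V that by blast
  show "C0_norm E n (\<lambda>i j. inc_map E (V i j)) \<le> fourier_norm G T n u"
    unfolding C0_norm_def
  proof (rule SUP_least)
    fix x assume x: "x \<in> E"
    have "scalar_mat_norm {..<n} (\<lambda>i j. inc_map E (V i j) x) = scalar_mat_norm {..<n} (\<lambda>i j. u i j x)"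
      by (rule scalar_mat_norm_cong) (simp add: u x)
    also have "\<dots> \<le> fourier_norm G T n u"
      using x E by (intro scalar_mat_norm_le_fourier_norm) auto
    finally show "scalar_mat_norm {..<n} (\<lambda>i j. inc_map E (V i j) x) \<le> fourier_norm G T n u" .
  qed
qed

text \<open>A closed subset of a compact space is compact, so the decay condition in
  \<open>C0\<close> holds for every continuous function.\<close>

lemma C0_eq:
  assumes E: "closedin T E"
  shows "f \<in> C0 T E \<longleftrightarrow> f \<in> extensional E \<and> continuous_map (subtopology T E) euclidean f"
proof -
  have "compactin T {x \<in> E. e \<le> cmod (f x)}" if f: "continuous_map (subtopology T E) euclidean f" for e
  proof -
    have "closedin (subtopology T E) {x \<in> topspace (subtopology T E). f x \<in> {z. e \<le> cmod z}}"
      by (rule closedin_continuous_map_preimage[OF f])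
        (simp add: closed_Collect_le continuous_on_norm continuous_on_id continuous_on_const)
    moreover have "{x \<in> topspace (subtopology T E). f x \<in> {z. e \<le> cmod z}} = {x \<in> E. e \<le> cmod (f x)}"
      using closedin_subset[OF E] by auto
    ultimately show ?thesis
      using closedin_closed_subtopology[OF E] compactin_iff_closedin by simp
  qed
  then show ?thesis by (auto simp: C0_def)
qed

text \<open>This supplies a bound to which a lifting property under strict inequality can be
  applied; the 1 added at the end makes it strict and positive.\<close>

lemma C0_norm_finite:
  assumes E: "closedin T E" and f: "f \<in> C0 T E"
  shows "\<exists>c>0. C0_norm E 1 (\<lambda>i j. f) < ennreal c"
proof -
  have c: "compactin (subtopology T E) E"
    using E by (simp add: compactin_subtopology compactin_iff_closedin)
  have "compact (f ` E)"
    using image_compactin[OF c, of euclidean f] f C0_eq[OF E] by (simp add: compactin_euclidean_iff)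
  then obtain b where b: "\<And>x. x \<in> E \<Longrightarrow> cmod (f x) \<le> b"
    using compact_imp_bounded bounded_iff by (metis imageI)
  define B where "B = max b 0"
  have "C0_norm E 1 (\<lambda>i j. f) \<le> ennreal B"
    unfolding C0_norm_def scalar_mat_norm_def
  proof (intro SUP_least ennreal_leI)
    fix x and v :: "nat \<Rightarrow> complex"
    assume x: "x \<in> E" and v: "v \<in> {v. (\<Sum>i<1. (cmod (v i))\<^sup>2) \<le> 1}"
    then have "cmod (v 0) \<le> 1" by (simp add: power_le_one_iff)
    then have "cmod (f x) * cmod (v 0) \<le> B * 1"
      using b[OF x] by (intro mult_mono) (auto simp: B_def)
    then show "sqrt (\<Sum>i<(1::nat). (cmod (\<Sum>j<1. f x * v j))\<^sup>2) \<le> B" by (simp add: norm_mult)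
  qed
  also have "\<dots> < ennreal (B + 1)" by (simp add: B_def ennreal_lessI del: ennreal_plus)
  finally show ?thesis by (intro exI[of _ "B + 1"]) (auto simp: B_def)
qed

text \<open>Liftings of 1 x 1 matrices give surjectivity, those of all sizes bound the inverse,
  since a lift is a choice of representatives in the quotient norm. Continuity of the Fourier
  algebra is what puts the restrictions into \<open>C0\<close>.\<close>

theorem cb_HelsonI:
  assumes closed: "closedin T E" and C: "0 \<le> C"
    and lift: "\<And>n f c. \<lbrakk>\<And>i j. \<lbrakk>i < n; j < n\<rbrakk> \<Longrightarrow> f i j \<in> C0 T E; 0 < c; C0_norm E n f < ennreal c\<rbrakk> \<Longrightarrow>
      \<exists>u. (\<forall>i<n. \<forall>j<n. u i j \<in> fourier_algebra G T \<and> restrict (u i j) E = f i j) \<and>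
          fourier_norm G T n u \<le> ennreal (C * c)"
  shows "cb_Helson G T E"
proof -
  have E: "E \<subseteq> carrier G" using closedin_subset[OF closed] by (simp add: topspace_eq)
  have sub: "inc_map E U \<in> C0 T E" if U: "U \<in> fourier_quotient G T E" for U
  proof -
    obtain u where u: "u \<in> fourier_algebra G T" "u \<in> U" by (rule quotient_member[OF E U])
    have "continuous_map (subtopology T E) euclidean u"
      using fourier_algebra_continuous[OF u(1)] by (rule continuous_map_from_subtopology)
    then have "continuous_map (subtopology T E) euclidean (restrict u E)"
      by (rule continuous_map_eq) auto
    then show ?thesis using C0_eq[OF closed] inc_map_eq[OF E U u(2)] by simp
  qed
  have surj: "f \<in> inc_map E ` fourier_quotient G T E" if f: "f \<in> C0 T E" for f
  proof -
    obtain c where "c > 0" "C0_norm E 1 (\<lambda>i j. f) < ennreal c" using C0_norm_finite[OF closed f] by blast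
    with lift[of 1 "\<lambda>i j. f" c] f obtain u where u: "u 0 0 \<in> fourier_algebra G T" "restrict (u 0 0) E = f"
      by auto
    show ?thesis
      using coset_in_quotient[OF E u(1)] inc_map_eq[OF E] u(2) by (metis imageI)
  qed
  have bij: "bij_betw (inc_map E) (fourier_quotient G T E) (C0 T E)"
    unfolding bij_betw_def using inj_on_inc_map[OF E] sub surj by blast
  have "completely_bounded (fourier_quotient G T E) (fourier_quotient_norm G T) (C0_norm E) (inc_map E)"
    unfolding completely_bounded_def using C0_norm_inc_map_le[OF E] by (intro exI[of _ 1]) simp
  moreover have "completely_bounded (C0 T E) (C0_norm E) (fourier_quotient_norm G T)
      (inv_into (fourier_quotient G T E) (inc_map E))"
    unfolding completely_bounded_def
  \<comment> \<open>The constant has to be nonzero: for C = 0 the product with an infinite norm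
    would be 0.\<close>
  proof (intro exI[of _ "C + 1"] allI impI)
    fix n and f :: "nat \<Rightarrow> nat \<Rightarrow> 'a \<Rightarrow> complex"
    assume f: "\<forall>i<n. \<forall>j<n. f i j \<in> C0 T E"
    let ?W = "\<lambda>i j. inv_into (fourier_quotient G T E) (inc_map E) (f i j)"
    have le: "fourier_quotient_norm G T n ?W \<le> ennreal (C * c)"
      if c: "0 < c" "C0_norm E n f < ennreal c" for c
    proof -
      obtain u where u: "\<And>i j. \<lbrakk>i < n; j < n\<rbrakk> \<Longrightarrow> u i j \<in> fourier_algebra G T \<and> restrict (u i j) E = f i j"
        "fourier_norm G T n u \<le> ennreal (C * c)"
        using lift[OF _ c] f by blast
      have "u i j \<in> ?W i j" if ij: "i < n" "j < n" for i j
      proof -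
        have uA: "u i j \<in> fourier_algebra G T" using u(1)[OF ij] by simp
        note q = coset_in_quotient[OF E uA]
        have "f i j = inc_map E (coset_rel E `` {u i j})"
          using inc_map_eq[OF E q] u(1)[OF ij] by simp
        then have "?W i j = coset_rel E `` {u i j}"
          using inv_into_f_f[OF inj_on_inc_map[OF E] q(1)] by simp
        then show ?thesis using q(2) by simp
      qed
      then have "fourier_quotient_norm G T n ?W \<le> fourier_norm G T n u"
        unfolding fourier_quotient_norm_def by (intro INF_lower) simp
      with u(2) show ?thesis by (rule order_trans[rotated])
    qed
    show "fourier_quotient_norm G T n ?W \<le> ennreal (C + 1) * C0_norm E n f"
    proof (cases "C0_norm E n f")
      case (real r)
      have "fourier_quotient_norm G T n ?W \<le> ennreal ((C + 1) * r)"
      proof (rule ennreal_le_epsilon)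
        fix e :: real assume e: "0 < e"
        \<comment> \<open>The value r + d is positive and strictly above the norm even for r = 0,
          and its excess costs at most e.\<close>
        define d where "d = e / (C + 1)"
        have d: "0 < d" "(C + 1) * d = e" using e C by (simp_all add: d_def)
        have "C0_norm E n f < ennreal (r + d)"
          unfolding real(2) by (rule ennreal_lessI) (use real(1) d(1) in auto)
        then have "fourier_quotient_norm G T n ?W \<le> ennreal (C * (r + d))"
          using d(1) real(1) by (intro le) auto
        also have "\<dots> \<le> ennreal ((C + 1) * r + e)"
          unfolding d(2)[symmetric] using d(1) real(1) C by (intro ennreal_leI) (simp add: algebra_simps)
        also have "\<dots> = ennreal ((C + 1) * r) + ennreal e"
          using real(1) C e by (intro ennreal_plus) auto
        finally show "fourier_quotient_norm G T n ?W \<le> ennreal ((C + 1) * r) + ennreal e" .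
      qed
      then show ?thesis using real C by (simp add: ennreal_mult)
    next
      case top
      then show ?thesis using C by (simp add: ennreal_mult_top ennreal_eq_0_iff)
    qed
  qed
  ultimately show ?thesis
    unfolding cb_Helson_def cb_isomorphism_def using closed bij by blast
qed

end

section \<open>Unitary matrices with prescribed corner\<close>

type_synonym cmat = "nat \<Rightarrow> nat \<Rightarrow> complex"

text \<open>Entries outside the block vanish, so that equality of functions is equality of matrices
  and the group laws hold literally.\<close>

definition mats :: "nat \<Rightarrow> cmat set" where
  "mats n = {A. \<forall>i j. n \<le> i \<or> n \<le> j \<longrightarrow> A i j = 0}"

definition mat_mult :: "nat \<Rightarrow> cmat \<Rightarrow> cmat \<Rightarrow> cmat" where
  "mat_mult n A B = (\<lambda>i j. \<Sum>k<n. A i k * B k j)"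

definition mat_one :: "nat \<Rightarrow> cmat" where
  "mat_one n = (\<lambda>i j. if i = j \<and> i < n then 1 else 0)"

definition mat_adjoint :: "cmat \<Rightarrow> cmat" where
  "mat_adjoint A = (\<lambda>i j. cnj (A j i))"

definition unitaries :: "nat \<Rightarrow> cmat set" where
  "unitaries n = {A \<in> mats n. mat_mult n A (mat_adjoint A) = mat_one n \<and> mat_mult n (mat_adjoint A) A = mat_one n}"

lemma mat_mult_assoc: "mat_mult n (mat_mult n A B) C = mat_mult n A (mat_mult n B C)"
proof (intro ext)
  fix i j
  have "mat_mult n (mat_mult n A B) C i j = (\<Sum>k<n. \<Sum>l<n. A i l * B l k * C k j)"
    by (simp add: mat_mult_def sum_distrib_right)
  also have "\<dots> = (\<Sum>l<n. \<Sum>k<n. A i l * B l k * C k j)" by (rule sum.swap)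
  also have "\<dots> = mat_mult n A (mat_mult n B C) i j"
    by (simp add: mat_mult_def sum_distrib_left mult.assoc)
  finally show "mat_mult n (mat_mult n A B) C i j = mat_mult n A (mat_mult n B C) i j" .
qed

lemma mat_mult_mats: "A \<in> mats n \<Longrightarrow> B \<in> mats n \<Longrightarrow> mat_mult n A B \<in> mats n"
  by (auto simp: mats_def mat_mult_def)

lemma mat_one_mats: "mat_one n \<in> mats n"
  by (auto simp: mats_def mat_one_def)

lemma adjoint_mats: "A \<in> mats n \<Longrightarrow> mat_adjoint A \<in> mats n"
  by (auto simp: mats_def mat_adjoint_def)

lemma mat_mult_one_left:
  assumes "A \<in> mats n" shows "mat_mult n (mat_one n) A = A"
proof (intro ext)
  fix i j
  have "mat_mult n (mat_one n) A i j = (\<Sum>k<n. if k = i then A k j else 0)"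
    unfolding mat_mult_def mat_one_def by (intro sum.cong refl) auto
  also have "\<dots> = A i j" using assms by (auto simp: mats_def)
  finally show "mat_mult n (mat_one n) A i j = A i j" .
qed

lemma mat_mult_one_right:
  assumes "A \<in> mats n" shows "mat_mult n A (mat_one n) = A"
proof (intro ext)
  fix i j
  have "mat_mult n A (mat_one n) i j = (\<Sum>k<n. if k = j then A i k else 0)"
    unfolding mat_mult_def mat_one_def by (intro sum.cong refl) auto
  also have "\<dots> = A i j" using assms by (auto simp: mats_def)
  finally show "mat_mult n A (mat_one n) i j = A i j" .
qed

lemma mat_adjoint_adjoint [simp]: "mat_adjoint (mat_adjoint A) = A"
  by (simp add: mat_adjoint_def)

lemma adjoint_mult: "mat_adjoint (mat_mult n A B) = mat_mult n (mat_adjoint B) (mat_adjoint A)"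
  by (simp add: mat_adjoint_def mat_mult_def mult.commute fun_eq_iff)

lemma adjoint_one [simp]: "mat_adjoint (mat_one n) = mat_one n"
  by (auto simp: mat_adjoint_def mat_one_def fun_eq_iff)

lemma unitaries_mats: "A \<in> unitaries n \<Longrightarrow> A \<in> mats n"
  by (simp add: unitaries_def)

lemma unitaries_one: "mat_one n \<in> unitaries n"
  by (simp add: unitaries_def mat_one_mats mat_mult_one_left)

lemma unitaries_adjoint: "A \<in> unitaries n \<Longrightarrow> mat_adjoint A \<in> unitaries n"
  by (simp add: unitaries_def adjoint_mats)

lemma unitaries_mult:
  assumes A: "A \<in> unitaries n" and B: "B \<in> unitaries n"
  shows "mat_mult n A B \<in> unitaries n"
proof -
  have c: "mat_mult n (mat_mult n A B) (mat_mult n C D) = mat_mult n A (mat_mult n (mat_mult n B C) D)" for A B C D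
    by (simp add: mat_mult_assoc)
  show ?thesis
    using A B by (simp add: unitaries_def adjoint_mult c mat_mult_mats mat_mult_one_left adjoint_mats)
qed

lemma unitaries_rows:
  assumes "A \<in> unitaries n" "i < n" "j < n"
  shows "(\<Sum>k<n. A i k * cnj (A j k)) = (if i = j then 1 else 0)"
proof -
  have "mat_mult n A (mat_adjoint A) i j = mat_one n i j" using assms by (simp add: unitaries_def)
  then show ?thesis using assms by (auto simp: mat_mult_def mat_adjoint_def mat_one_def)
qed

lemma unitaries_entry_le:
  assumes A: "A \<in> unitaries n"
  shows "cmod (A i j) \<le> 1"
proof (cases "i < n \<and> j < n")
  case True
  have "complex_of_real (\<Sum>k<n. (cmod (A i k))\<^sup>2) = 1"
    unfolding of_real_sum complex_norm_square using unitaries_rows[OF A, of i i] True by simp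
  then have "(\<Sum>k<n. (cmod (A i k))\<^sup>2) = 1" by (simp only: of_real_eq_1_iff)
  moreover have "(cmod (A i j))\<^sup>2 \<le> (\<Sum>k<n. (cmod (A i k))\<^sup>2)"
    using True by (intro member_le_sum) auto
  ultimately show ?thesis by (simp add: power_le_one_iff)
next
  case False
  then show ?thesis using unitaries_mats[OF A] by (auto simp: mats_def not_less)
qed

section \<open>Operator norm bounds\<close>

definition vec_norm :: "nat \<Rightarrow> (nat \<Rightarrow> complex) \<Rightarrow> real" where
  "vec_norm n v = L2_set (\<lambda>i. cmod (v i)) {..<n}"

definition mat_vec :: "nat \<Rightarrow> cmat \<Rightarrow> (nat \<Rightarrow> complex) \<Rightarrow> nat \<Rightarrow> complex" where
  "mat_vec n A v = (\<lambda>i. \<Sum>j<n. A i j * v j)"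

text \<open>For c at least 0 this says that the operator norm on C^n is at most c; stated for all
  vectors, it composes and adds without suprema.\<close>

definition norm_bound :: "nat \<Rightarrow> real \<Rightarrow> cmat \<Rightarrow> bool" where
  "norm_bound n c A \<longleftrightarrow> (\<forall>v. vec_norm n (mat_vec n A v) \<le> c * vec_norm n v)"

lemma vec_norm_nonneg [simp]: "0 \<le> vec_norm n v"
  by (simp add: vec_norm_def)

lemma vec_norm_triangle: "vec_norm n (\<lambda>i. v i + w i) \<le> vec_norm n v + vec_norm n w"
proof -
  have "vec_norm n (\<lambda>i. v i + w i) \<le> L2_set (\<lambda>i. cmod (v i) + cmod (w i)) {..<n}"
    unfolding vec_norm_def by (intro L2_set_mono norm_triangle_ineq) auto
  also have "\<dots> \<le> vec_norm n v + vec_norm n w"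
    unfolding vec_norm_def by (rule L2_set_triangle_ineq)
  finally show ?thesis .
qed

lemma vec_norm_scale: "vec_norm n (\<lambda>i. a * v i) = cmod a * vec_norm n v"
  by (simp add: vec_norm_def norm_mult L2_set_right_distrib)

lemma mat_vec_scale: "mat_vec n A (\<lambda>i. a * v i) = (\<lambda>i. a * mat_vec n A v i)"
  by (simp add: mat_vec_def sum_distrib_left mult_ac)

lemma norm_boundD: "norm_bound n c A \<Longrightarrow> vec_norm n (mat_vec n A v) \<le> c * vec_norm n v"
  by (simp add: norm_bound_def)

lemma norm_bound_add:
  assumes "norm_bound n c A" "norm_bound n d B"
  shows "norm_bound n (c + d) (\<lambda>i j. A i j + B i j)"
  unfolding norm_bound_def
proof
  fix v
  have "vec_norm n (mat_vec n (\<lambda>i j. A i j + B i j) v) = vec_norm n (\<lambda>i. mat_vec n A v i + mat_vec n B v i)"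
    by (simp add: mat_vec_def distrib_right sum.distrib)
  also have "\<dots> \<le> c * vec_norm n v + d * vec_norm n v"
    using vec_norm_triangle norm_boundD[OF assms(1)] norm_boundD[OF assms(2)] by (meson add_mono order_trans)
  finally show "vec_norm n (mat_vec n (\<lambda>i j. A i j + B i j) v) \<le> (c + d) * vec_norm n v"
    by (simp add: distrib_right)
qed

lemma norm_bound_scale:
  assumes "norm_bound n c A"
  shows "norm_bound n (cmod a * c) (\<lambda>i j. a * A i j)"
  unfolding norm_bound_def
proof
  fix v
  have "vec_norm n (mat_vec n (\<lambda>i j. a * A i j) v) = cmod a * vec_norm n (mat_vec n A v)"
    unfolding vec_norm_scale[symmetric] by (simp add: mat_vec_def sum_distrib_left mult.assoc)
  also have "\<dots> \<le> cmod a * (c * vec_norm n v)"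
    by (intro mult_left_mono norm_boundD assms) simp
  finally show "vec_norm n (mat_vec n (\<lambda>i j. a * A i j) v) \<le> cmod a * c * vec_norm n v"
    by (simp add: mult.assoc)
qed

lemma norm_bound_mult:
  assumes "norm_bound n c A" "norm_bound n d B" "0 \<le> c"
  shows "norm_bound n (c * d) (mat_mult n A B)"
  unfolding norm_bound_def
proof
  fix v
  have eq: "mat_vec n (mat_mult n A B) v = mat_vec n A (mat_vec n B v)"
  proof
    fix i
    have "mat_vec n (mat_mult n A B) v i = (\<Sum>j<n. \<Sum>k<n. A i k * B k j * v j)"
      by (simp add: mat_vec_def mat_mult_def sum_distrib_right)
    also have "\<dots> = (\<Sum>k<n. \<Sum>j<n. A i k * B k j * v j)" by (rule sum.swap)
    finally show "mat_vec n (mat_mult n A B) v i = mat_vec n A (mat_vec n B v) i"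
      by (simp add: mat_vec_def sum_distrib_left mult.assoc)
  qed
  have "vec_norm n (mat_vec n (mat_mult n A B) v) \<le> c * vec_norm n (mat_vec n B v)"
    unfolding eq by (rule norm_boundD[OF assms(1)])
  also have "\<dots> \<le> c * (d * vec_norm n v)"
    by (intro mult_left_mono norm_boundD assms)
  finally show "vec_norm n (mat_vec n (mat_mult n A B) v) \<le> c * d * vec_norm n v"
    by (simp add: mult.assoc)
qed

lemma norm_bound_mono:
  assumes "norm_bound n c A" "c \<le> d"
  shows "norm_bound n d A"
  using assms unfolding norm_bound_def by (meson mult_right_mono order_trans vec_norm_nonneg)

lemma norm_bound_zero: "0 \<le> c \<Longrightarrow> norm_bound n c (\<lambda>i j. 0)"
  by (simp add: norm_bound_def mat_vec_def vec_norm_def L2_set_def sum_nonneg)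

lemma norm_bound_entry:
  assumes A: "norm_bound n c A" and ij: "i < n" "j < n"
  shows "cmod (A i j) \<le> c"
proof -
  let ?e = "\<lambda>k. if k = j then 1 else 0 :: complex"
  have "vec_norm n ?e = 1"
    using ij by (simp add: vec_norm_def L2_set_def if_distrib[of cmod] if_distrib[of "\<lambda>x. x\<^sup>2"] cong: if_cong)
  moreover have "mat_vec n A ?e i = A i j"
    using ij by (simp add: mat_vec_def if_distrib[of "\<lambda>x. _ * x"] cong: if_cong)
  moreover have "cmod (mat_vec n A ?e i) \<le> vec_norm n (mat_vec n A ?e)"
    unfolding vec_norm_def using ij by (intro member_le_L2_set) auto
  ultimately show ?thesis using norm_boundD[OF A, of ?e] by simp
qed

lemma vec_norm_power2: "complex_of_real ((vec_norm n v)\<^sup>2) = (\<Sum>i<n. v i * cnj (v i))"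
proof -
  have "(vec_norm n v)\<^sup>2 = (\<Sum>i<n. (cmod (v i))\<^sup>2)"
    by (simp add: vec_norm_def L2_set_def sum_nonneg)
  then show ?thesis by (simp only: of_real_sum complex_norm_square)
qed

text \<open>For w the image of v under the adjoint, the squared norm of w is the inner product of A
  w with v, hence at most c times the norms of w and v; one factor cancels.\<close>

lemma norm_bound_adjoint:
  assumes A: "norm_bound n c A" and c: "0 \<le> c"
  shows "norm_bound n c (mat_adjoint A)"
  unfolding norm_bound_def
proof
  fix v
  define w where "w = mat_vec n (mat_adjoint A) v"
  have "complex_of_real ((vec_norm n w)\<^sup>2) = (\<Sum>i<n. w i * cnj (w i))" by (rule vec_norm_power2)
  also have "\<dots> = (\<Sum>i<n. \<Sum>j<n. w i * (A j i * cnj (v j)))"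
    by (subst (2) w_def) (simp add: mat_vec_def mat_adjoint_def sum_distrib_left)
  also have "\<dots> = (\<Sum>j<n. \<Sum>i<n. w i * (A j i * cnj (v j)))" by (rule sum.swap)
  also have "\<dots> = (\<Sum>j<n. mat_vec n A w j * cnj (v j))"
    unfolding mat_vec_def sum_distrib_right by (intro sum.cong refl) (simp add: mult_ac)
  finally have "(vec_norm n w)\<^sup>2 = cmod (\<Sum>j<n. mat_vec n A w j * cnj (v j))"
    by (metis abs_of_nonneg norm_of_real zero_le_power2)
  also have "\<dots> \<le> (\<Sum>j<n. cmod (mat_vec n A w j * cnj (v j)))" by (rule norm_sum)
  also have "\<dots> = (\<Sum>j<n. \<bar>cmod (mat_vec n A w j)\<bar> * \<bar>cmod (v j)\<bar>)" by (simp add: norm_mult)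
  also have "\<dots> \<le> vec_norm n (mat_vec n A w) * vec_norm n v"
    unfolding vec_norm_def by (rule L2_set_mult_ineq)
  also have "\<dots> \<le> (c * vec_norm n w) * vec_norm n v"
    by (intro mult_right_mono norm_boundD[OF A]) simp
  finally have "vec_norm n w * vec_norm n w \<le> (c * vec_norm n v) * vec_norm n w"
    by (simp add: power2_eq_square mult_ac)
  then show "vec_norm n (mat_vec n (mat_adjoint A) v) \<le> c * vec_norm n v"
    unfolding w_def[symmetric] using c vec_norm_nonneg[of n w]
    by (cases "vec_norm n w = 0") (auto simp: mult_le_cancel_right)
qed

lemma norm_bound_scalar_mat_norm:
  assumes le: "scalar_mat_norm {..<n} A \<le> ennreal c" and c: "0 \<le> c"
  shows "norm_bound n c A"
  unfolding norm_bound_def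
proof
  have unit: "vec_norm n (mat_vec n A v) \<le> c" if v: "vec_norm n v \<le> 1" for v
  proof -
    have "(\<Sum>i<n. (cmod (v i))\<^sup>2) \<le> 1"
      using v unfolding vec_norm_def L2_set_def by (simp add: real_sqrt_le_1_iff)
    then have "ennreal (vec_norm n (mat_vec n A v)) \<le> scalar_mat_norm {..<n} A"
      unfolding scalar_mat_norm_def vec_norm_def L2_set_def mat_vec_def
      by (intro SUP_upper2[OF _ order_refl]) simp
    then have "ennreal (vec_norm n (mat_vec n A v)) \<le> ennreal c" using le by (rule order_trans)
    then show ?thesis using c by simp
  qed
  fix v
  show "vec_norm n (mat_vec n A v) \<le> c * vec_norm n v"
  proof (cases "vec_norm n v = 0")
    case True
    then have "\<forall>i<n. v i = 0" by (simp add: vec_norm_def L2_set_eq_0_iff)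
    then have "mat_vec n A v = (\<lambda>_. 0)" by (simp add: mat_vec_def)
    then show ?thesis using True by (simp add: vec_norm_def L2_set_def)
  next
    case False
    then have pos: "0 < vec_norm n v" using vec_norm_nonneg[of n v] by linarith
    let ?a = "complex_of_real (1 / vec_norm n v)"
    have "vec_norm n (\<lambda>i. ?a * v i) \<le> 1" unfolding vec_norm_scale using pos by (simp add: norm_divide)
    from unit[OF this] show ?thesis
      unfolding mat_vec_scale vec_norm_scale using pos by (simp add: norm_divide field_simps)
  qed
qed

text \<open>For small \<open>X\<close> the iteration converges to the solution \<open>Y\<close> of \<open>2 Y = X + Y\<^sup>2\<close>, that is,
  to \<open>1 - sqrt (1 - X)\<close>.\<close>

primrec sqrt_iter :: "nat \<Rightarrow> cmat \<Rightarrow> nat \<Rightarrow> cmat" where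
  "sqrt_iter n X 0 = (\<lambda>i j. 0)"
| "sqrt_iter n X (Suc k) = (\<lambda>i j. (X i j + mat_mult n (sqrt_iter n X k) (sqrt_iter n X k) i j) / 2)"

text \<open>Written as the telescoping series of the increments, so that one bound on these gives
  convergence and, by the M-test, continuity in a parameter.\<close>

definition sqrt_defect :: "nat \<Rightarrow> cmat \<Rightarrow> cmat" where
  "sqrt_defect n X = (\<lambda>i j. \<Sum>k. sqrt_iter n X (Suc k) i j - sqrt_iter n X k i j)"

lemma sqrt_iter_mats: "X \<in> mats n \<Longrightarrow> sqrt_iter n X k \<in> mats n"
  using mat_mult_mats by (induction k) (auto simp: mats_def)

text \<open>The ball of radius 1/4 is invariant, as (1/4 + 1/16) / 2 is less than 1/4.\<close>

lemma norm_bound_sqrt_iter: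
  assumes X: "norm_bound n (1/4) X"
  shows "norm_bound n (1/4) (sqrt_iter n X k)"
proof (induction k)
  case 0 show ?case by (simp add: norm_bound_zero)
next
  case (Suc k)
  have "norm_bound n (cmod (1/2) * (1/4 + 1/4 * (1/4))) (\<lambda>i j. 1/2 * (X i j + mat_mult n (sqrt_iter n X k) (sqrt_iter n X k) i j))"
    by (intro norm_bound_scale norm_bound_add X norm_bound_mult Suc) simp
  then show ?case by (auto elim: norm_bound_mono)
qed

text \<open>Without assuming that consecutive iterates y, z commute, z^2 - y^2 = z (z - y) + (z - y)
  y; as both have norm at most 1/4, each increment is at most (1/4 + 1/4) / 2 = 1/4 times the
  previous one.\<close>

lemma norm_bound_sqrt_iter_diff:
  assumes X: "norm_bound n (1/4) X"
  shows "norm_bound n ((1/4)^k) (\<lambda>i j. sqrt_iter n X (Suc k) i j - sqrt_iter n X k i j)"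
proof (induction k)
  case 0
  have "norm_bound n (cmod (1/2) * (1/4)) (\<lambda>i j. 1/2 * X i j)" by (intro norm_bound_scale X)
  then show ?case by (auto simp: mat_mult_def elim: norm_bound_mono)
next
  case (Suc k)
  let ?y = "sqrt_iter n X k" and ?z = "sqrt_iter n X (Suc k)"
  let ?d = "\<lambda>i j. ?z i j - ?y i j"
  note b = norm_bound_sqrt_iter[OF X]
  have "(1/4::real)^k \<ge> 0" by simp
  then have "norm_bound n (cmod (1/2) * (1/4 * (1/4)^k + (1/4)^k * (1/4)))
    (\<lambda>i j. 1/2 * (mat_mult n ?z ?d i j + mat_mult n ?d ?y i j))"
    by (intro norm_bound_scale norm_bound_add norm_bound_mult Suc.IH b) auto
  moreover have "(\<lambda>i j. 1/2 * (mat_mult n ?z ?d i j + mat_mult n ?d ?y i j)) =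
    (\<lambda>i j. sqrt_iter n X (Suc (Suc k)) i j - ?z i j)"
  proof (intro ext)
    fix i j
    have "mat_mult n ?z ?d i j + mat_mult n ?d ?y i j = mat_mult n ?z ?z i j - mat_mult n ?y ?y i j"
      unfolding mat_mult_def by (simp add: algebra_simps sum.distrib sum_subtractf del: sqrt_iter.simps)
    moreover have "sqrt_iter n X (Suc (Suc k)) i j = (X i j + mat_mult n ?z ?z i j) / 2" by (rule sqrt_iter.simps(2)[THEN fun_cong, THEN fun_cong])
    moreover have "?z i j = (X i j + mat_mult n ?y ?y i j) / 2" by (simp only: sqrt_iter.simps(2))
    ultimately show "1/2 * (mat_mult n ?z ?d i j + mat_mult n ?d ?y i j) = sqrt_iter n X (Suc (Suc k)) i j - ?z i j"
      by (simp add: diff_divide_distrib add_divide_distrib del: sqrt_iter.simps)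
  qed
  ultimately show ?case by (auto elim: norm_bound_mono simp del: sqrt_iter.simps)
qed

lemma sqrt_iter_diff_le:
  assumes X: "norm_bound n (1/4) X" "X \<in> mats n"
  shows "cmod (sqrt_iter n X (Suc k) i j - sqrt_iter n X k i j) \<le> (1/4)^k"
proof (cases "i < n \<and> j < n")
  case True
  then show ?thesis using norm_bound_entry[OF norm_bound_sqrt_iter_diff[OF X(1)]] by blast
next
  case False
  then show ?thesis
    using sqrt_iter_mats[OF X(2), of k] sqrt_iter_mats[OF X(2), of "Suc k"]
    by (auto simp: mats_def not_less simp del: sqrt_iter.simps)
qed

lemma sqrt_iter_LIMSEQ:
  assumes X: "norm_bound n (1/4) X" "X \<in> mats n"
  shows "(\<lambda>k. sqrt_iter n X k i j) \<longlonglongrightarrow> sqrt_defect n X i j"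
proof -
  have "summable (\<lambda>k. sqrt_iter n X (Suc k) i j - sqrt_iter n X k i j)"
    by (rule summable_comparison_test'[of "\<lambda>k. (1/4)^k"]) (use sqrt_iter_diff_le[OF X] in \<open>auto simp del: sqrt_iter.simps\<close>)
  from summable_LIMSEQ[OF this] show ?thesis
    unfolding sum_lessThan_telescope[of "\<lambda>k. sqrt_iter n X k i j"]
    by (simp add: sqrt_defect_def del: sqrt_iter.simps(2))
qed

lemma sqrt_defect_eq:
  assumes X: "norm_bound n (1/4) X" "X \<in> mats n"
  shows "2 * sqrt_defect n X i j = X i j + mat_mult n (sqrt_defect n X) (sqrt_defect n X) i j"
proof -
  have "(\<lambda>k. sqrt_iter n X (Suc k) i j) \<longlonglongrightarrow>
      (X i j + mat_mult n (sqrt_defect n X) (sqrt_defect n X) i j) / 2"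
    unfolding sqrt_iter.simps mat_mult_def by (intro tendsto_intros sqrt_iter_LIMSEQ X) auto
  moreover have "(\<lambda>k. sqrt_iter n X (Suc k) i j) \<longlonglongrightarrow> sqrt_defect n X i j"
    using sqrt_iter_LIMSEQ[OF X] by (rule LIMSEQ_Suc)
  ultimately have eq: "sqrt_defect n X i j = (X i j + mat_mult n (sqrt_defect n X) (sqrt_defect n X) i j) / 2"
    using LIMSEQ_unique by blast
  show ?thesis by (subst eq) simp
qed

lemma sqrt_defect_mats:
  assumes "X \<in> mats n"
  shows "sqrt_defect n X \<in> mats n"
  using sqrt_iter_mats[OF assms] by (simp add: sqrt_defect_def mats_def del: sqrt_iter.simps)

lemma sqrt_defect_adjoint:
  assumes X: "norm_bound n (1/4) X" "X \<in> mats n" "mat_adjoint X = X"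
  shows "mat_adjoint (sqrt_defect n X) = sqrt_defect n X"
proof (intro ext)
  fix i j
  have "mat_adjoint (sqrt_iter n X k) = sqrt_iter n X k" for k
  proof (induction k)
    case (Suc k)
    have "mat_adjoint (mat_mult n (sqrt_iter n X k) (sqrt_iter n X k)) = mat_mult n (sqrt_iter n X k) (sqrt_iter n X k)"
      by (simp add: adjoint_mult Suc)
    with X(3) show ?case by (simp add: mat_adjoint_def fun_eq_iff)
  qed (simp add: mat_adjoint_def)
  then have "cnj (sqrt_iter n X k j i) = sqrt_iter n X k i j" for k
    unfolding mat_adjoint_def by metis
  moreover have "(\<lambda>k. cnj (sqrt_iter n X k j i)) \<longlonglongrightarrow> cnj (sqrt_defect n X j i)"
    by (intro tendsto_intros sqrt_iter_LIMSEQ X)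
  ultimately show "mat_adjoint (sqrt_defect n X) i j = sqrt_defect n X i j"
    using sqrt_iter_LIMSEQ[OF X(1,2), of i j] by (simp add: mat_adjoint_def LIMSEQ_unique)
qed

text \<open>All iterates are polynomials in X and hence commute with whatever commutes with X;
  multiplication by h is continuous.\<close>

lemma sqrt_defect_commute:
  assumes X: "norm_bound n (1/4) X" "X \<in> mats n" and com: "mat_mult n h X = mat_mult n X h"
  shows "mat_mult n h (sqrt_defect n X) = mat_mult n (sqrt_defect n X) h"
proof (intro ext)
  fix i j
  have eq: "mat_mult n h (sqrt_iter n X k) = mat_mult n (sqrt_iter n X k) h" for k
  proof (induction k)
    case (Suc k)
    let ?y = "sqrt_iter n X k"
    have yy: "mat_mult n h (mat_mult n ?y ?y) = mat_mult n (mat_mult n ?y ?y) h"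
      by (metis Suc mat_mult_assoc)
    have "mat_mult n h (sqrt_iter n X (Suc k)) = (\<lambda>i j. (mat_mult n h X i j + mat_mult n h (mat_mult n ?y ?y) i j) / 2)"
      unfolding sqrt_iter.simps by (simp add: mat_mult_def[of n h] sum.distrib[symmetric] sum_divide_distrib distrib_left)
    also have "\<dots> = (\<lambda>i j. (mat_mult n X h i j + mat_mult n (mat_mult n ?y ?y) h i j) / 2)"
      by (simp only: com yy)
    also have "\<dots> = mat_mult n (sqrt_iter n X (Suc k)) h"
      unfolding sqrt_iter.simps by (simp add: mat_mult_def[of n _ h] sum.distrib[symmetric] sum_divide_distrib distrib_right)
    finally show ?case .
  qed (simp add: mat_mult_def)
  have "(\<lambda>k. mat_mult n h (sqrt_iter n X k) i j) \<longlonglongrightarrow> mat_mult n h (sqrt_defect n X) i j"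
    "(\<lambda>k. mat_mult n (sqrt_iter n X k) h i j) \<longlonglongrightarrow> mat_mult n (sqrt_defect n X) h i j"
    unfolding mat_mult_def by (intro tendsto_intros sqrt_iter_LIMSEQ X)+
  then show "mat_mult n h (sqrt_defect n X) i j = mat_mult n (sqrt_defect n X) h i j"
    unfolding eq by (rule LIMSEQ_unique)
qed

text \<open>Block diagonal matrices are closed under sums and products, so all iterates keep this
  shape. It will be used for the square of a dilation, with m half the size.\<close>

lemma sqrt_defect_block:
  assumes X: "\<And>i j. (i < m) \<noteq> (j < m) \<Longrightarrow> X i j = 0" and ij: "(i < m) \<noteq> (j < m)"
  shows "sqrt_defect n X i j = 0"
proof -
  have "(i < m) \<noteq> (j < m) \<Longrightarrow> sqrt_iter n X k i j = 0" for k i j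
  proof (induction k arbitrary: i j)
    case (Suc k)
    have z: "sqrt_iter n X k i l * sqrt_iter n X k l j = 0" for l
      using Suc.IH[of i l] Suc.IH[of l j] Suc.prems by (cases "(i < m) = (l < m)") auto
    have "mat_mult n (sqrt_iter n X k) (sqrt_iter n X k) i j = 0"
      unfolding mat_mult_def by (intro sum.neutral ballI z)
    then show ?case using X[OF Suc.prems] by simp
  qed simp
  then show ?thesis using ij by (simp add: sqrt_defect_def del: sqrt_iter.simps)
qed

text \<open>The unitary \<open>sqrt (1 - h\<^sup>2) + i h\<close>.\<close>

definition unitary_of :: "nat \<Rightarrow> cmat \<Rightarrow> cmat" where
  "unitary_of n h = (\<lambda>i j. mat_one n i j - sqrt_defect n (mat_mult n h h) i j + \<i> * h i j)"

text \<open>The bound 1/2 puts the square into the ball of radius 1/4 on which the iteration is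
  controlled.\<close>

definition small_hermitian :: "nat \<Rightarrow> cmat set" where
  "small_hermitian n = {h \<in> mats n. mat_adjoint h = h \<and> norm_bound n (1/2) h}"

lemma small_hermitian_square:
  assumes "h \<in> small_hermitian n"
  shows "norm_bound n (1/4) (mat_mult n h h)" "mat_mult n h h \<in> mats n"
    "mat_adjoint (mat_mult n h h) = mat_mult n h h"
  using assms norm_bound_mult[of n "1/2" h "1/2" h]
  by (auto simp: small_hermitian_def mat_mult_mats adjoint_mult)

text \<open>Put s = 1 - Y. The equation 2 Y = X + Y^2 says s^2 = 1 - h^2, and s is self-adjoint and
  commutes with h, so the cross terms in the product of s + \<i> h and s - \<i> h cancel. The second
  part recovers h from the unitary and serves the injectivity of the embedding.\<close>

lemma
  assumes h: "h \<in> small_hermitian n"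
  shows unitary_of_unitaries: "unitary_of n h \<in> unitaries n"
    and unitary_of_imaginary_part: "unitary_of n h i j - mat_adjoint (unitary_of n h) i j = 2 * \<i> * h i j"
proof -
  define X where "X = mat_mult n h h"
  define Y where "Y = sqrt_defect n X"
  define s where "s = (\<lambda>i j. mat_one n i j - Y i j)"
  note X = small_hermitian_square[OF h, folded X_def]
  have hm: "h \<in> mats n" and ha: "mat_adjoint h = h" using h by (auto simp: small_hermitian_def)
  have Ym: "Y \<in> mats n" unfolding Y_def by (rule sqrt_defect_mats[OF X(2)])
  have Ya: "mat_adjoint Y = Y" unfolding Y_def by (rule sqrt_defect_adjoint[OF X])
  have hY: "mat_mult n h Y = mat_mult n Y h"
    unfolding Y_def by (rule sqrt_defect_commute[OF X(1,2)]) (simp add: X_def mat_mult_assoc)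
  have YY: "2 * Y i j = X i j + mat_mult n Y Y i j" for i j
    unfolding Y_def by (rule sqrt_defect_eq[OF X(1,2)])
  have sm: "s \<in> mats n" using Ym mat_one_mats[of n] by (simp add: s_def mats_def)
  have sa: "cnj (s j i) = s i j" for i j
    using Ya adjoint_one[of n] unfolding s_def mat_adjoint_def fun_eq_iff by simp
  have ha': "cnj (h j i) = h i j" for i j using ha unfolding mat_adjoint_def fun_eq_iff by simp
  have left: "mat_mult n s B i j = mat_mult n (mat_one n) B i j - mat_mult n Y B i j" for B i j
    by (simp add: mat_mult_def s_def left_diff_distrib sum_subtractf)
  have right: "mat_mult n B s i j = mat_mult n B (mat_one n) i j - mat_mult n B Y i j" for B i j
    by (simp add: mat_mult_def s_def right_diff_distrib sum_subtractf)
  have ss: "mat_mult n s s i j = mat_one n i j - X i j" for i j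
    using YY[of i j] by (simp add: left right mat_mult_one_left mat_mult_one_right Ym sm mat_one_mats) (simp add: s_def)
  have hs: "mat_mult n h s i j = mat_mult n s h i j" for i j
    by (simp add: left right mat_mult_one_left mat_mult_one_right hm hY)
  have u: "unitary_of n h = (\<lambda>i j. s i j + \<i> * h i j)"
    by (simp add: unitary_of_def s_def Y_def X_def)
  have ua: "mat_adjoint (unitary_of n h) = (\<lambda>i j. s i j - \<i> * h i j)"
    unfolding u by (simp add: mat_adjoint_def ha' sa)
  have p1: "mat_mult n (\<lambda>i j. s i j + \<i> * h i j) (\<lambda>i j. s i j - \<i> * h i j) i j =
    mat_mult n s s i j + mat_mult n h h i j + \<i> * (mat_mult n h s i j - mat_mult n s h i j)" for i j
    unfolding mat_mult_def
    by (simp add: algebra_simps sum.distrib sum_subtractf sum_distrib_left)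
  have p2: "mat_mult n (\<lambda>i j. s i j - \<i> * h i j) (\<lambda>i j. s i j + \<i> * h i j) i j =
    mat_mult n s s i j + mat_mult n h h i j + \<i> * (mat_mult n s h i j - mat_mult n h s i j)" for i j
    unfolding mat_mult_def
    by (simp add: algebra_simps sum.distrib sum_subtractf sum_distrib_left)
  show "unitary_of n h i j - mat_adjoint (unitary_of n h) i j = 2 * \<i> * h i j"
    unfolding ua unfolding u by simp
  have "mat_mult n (unitary_of n h) (mat_adjoint (unitary_of n h)) = mat_one n"
    unfolding ua unfolding u by (intro ext) (simp add: p1 ss hs X_def)
  moreover have "mat_mult n (mat_adjoint (unitary_of n h)) (unitary_of n h) = mat_one n"
    unfolding ua unfolding u by (intro ext) (simp add: p2 ss hs X_def)
  moreover have "unitary_of n h \<in> mats n" using hm sm by (simp add: u mats_def)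
  ultimately show "unitary_of n h \<in> unitaries n" by (simp add: unitaries_def)
qed

lemma continuous_map_complex_mult:
  fixes f g :: "'x \<Rightarrow> complex"
  assumes "continuous_map X euclidean f" "continuous_map X euclidean g"
  shows "continuous_map X euclidean (\<lambda>x. f x * g x)"
  using assms by (simp add: continuous_map_atin tendsto_mult)

lemma continuous_map_sqrt_iter:
  assumes "\<And>i j. continuous_map X euclidean (\<lambda>x. h x i j)"
  shows "continuous_map X euclidean (\<lambda>x. sqrt_iter n (h x) k i j)"
proof (induction k arbitrary: i j)
  case (Suc k)
  then show ?case
    unfolding sqrt_iter.simps mat_mult_def divide_inverse
    by (intro continuous_map_complex_mult continuous_map_add continuous_map_sum assms) auto
qed simp

text \<open>The increments are bounded by \<open>(1/4)^k\<close> uniformly in x, so the partial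
  sums, polynomial in the entries, converge uniformly.\<close>

lemma continuous_map_sqrt_defect:
  assumes cont: "\<And>i j. continuous_map X euclidean (\<lambda>x. h x i j)"
    and h: "\<And>x. x \<in> topspace X \<Longrightarrow> norm_bound n (1/4) (h x) \<and> h x \<in> mats n"
  shows "continuous_map X euclidean (\<lambda>x. sqrt_defect n (h x) i j)"
proof -
  let ?D = "\<lambda>k x. sqrt_iter n (h x) (Suc k) i j - sqrt_iter n (h x) k i j"
  have lim: "uniform_limit (topspace X) (\<lambda>m x. \<Sum>k<m. ?D k x) (\<lambda>x. \<Sum>k. ?D k x) sequentially"
  proof (rule Weierstrass_m_test)
    show "summable (\<lambda>k. (1/4::real)^k)" by simp
    show "norm (?D k x) \<le> (1/4)^k" if "x \<in> topspace X" for k x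
      using h[OF that] by (intro sqrt_iter_diff_le) auto
  qed
  have "continuous_map X Met_TC.mtopology (\<lambda>x. sqrt_defect n (h x) i j)"
  proof (rule Met_TC.continuous_map_uniform_limit[where F = sequentially and f = "\<lambda>m x. \<Sum>k<m. ?D k x"])
    show "\<forall>\<^sub>F m in sequentially. continuous_map X Met_TC.mtopology (\<lambda>x. \<Sum>k<m. ?D k x)"
      unfolding mtopology_is_euclidean
      by (intro always_eventually allI continuous_map_sum continuous_map_diff continuous_map_sqrt_iter cont) auto
    fix e :: real assume "e > 0"
    with lim have "\<forall>\<^sub>F m in sequentially. \<forall>x\<in>topspace X. dist (\<Sum>k<m. ?D k x) (\<Sum>k. ?D k x) < e"
      by (simp add: uniform_limit_iff)
    then show "\<forall>\<^sub>F m in sequentially. \<forall>x\<in>topspace X. sqrt_defect n (h x) i j \<in> UNIV \<and>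
        dist (\<Sum>k<m. ?D k x) (sqrt_defect n (h x) i j) < e"
      by (rule eventually_mono) (simp add: sqrt_defect_def del: sqrt_iter.simps)
  qed simp
  then show ?thesis by simp
qed

lemma continuous_map_unitary_of:
  assumes cont: "\<And>i j. continuous_map X euclidean (\<lambda>x. h x i j)"
    and h: "\<And>x. x \<in> topspace X \<Longrightarrow> h x \<in> small_hermitian n"
  shows "continuous_map X euclidean (\<lambda>x. unitary_of n (h x) i j)"
proof -
  have "continuous_map X euclidean (\<lambda>x. mat_mult n (h x) (h x) i j)" for i j
    unfolding mat_mult_def by (intro continuous_map_sum continuous_map_complex_mult cont) auto
  then have "continuous_map X euclidean (\<lambda>x. sqrt_defect n (mat_mult n (h x) (h x)) i j)"
    using small_hermitian_square[OF h] by (intro continuous_map_sqrt_defect) auto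
  then show ?thesis
    unfolding unitary_of_def
    by (intro continuous_map_add continuous_map_complex_mult continuous_map_diff cont) auto
qed

lemma unitary_of_zero: "unitary_of n (\<lambda>i j. 0) = mat_one n"
proof -
  have "sqrt_iter n (\<lambda>i j. 0) k = (\<lambda>i j. 0)" for k
    by (induction k) (simp_all add: mat_mult_def)
  then have "sqrt_defect n (\<lambda>i j. 0) = (\<lambda>i j. 0)"
    by (simp add: sqrt_defect_def del: sqrt_iter.simps)
  then show ?thesis by (simp add: unitary_of_def mat_mult_def)
qed

lemma small_hermitian_scale:
  assumes h: "h \<in> small_hermitian n" and t: "0 \<le> t" "t \<le> 1"
  shows "(\<lambda>i j. complex_of_real t * h i j) \<in> small_hermitian n"
proof -
  have "norm_bound n (cmod (complex_of_real t) * (1/2)) (\<lambda>i j. complex_of_real t * h i j)"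
    using h by (intro norm_bound_scale) (simp add: small_hermitian_def)
  then have "norm_bound n (1/2) (\<lambda>i j. complex_of_real t * h i j)"
    by (rule norm_bound_mono) (use t in simp)
  moreover have "cnj (h j i) = h i j" for i j
    using h unfolding small_hermitian_def mat_adjoint_def by (auto simp: fun_eq_iff)
  ultimately show ?thesis
    using h by (simp add: small_hermitian_def mats_def mat_adjoint_def)
qed

section \<open>The self-adjoint dilation\<close>

lemma sum_split_half: "(\<Sum>j<n + n. f j) = (\<Sum>j<n. f j) + (\<Sum>j<n. f (n + j))"
  for f :: "nat \<Rightarrow> 'b::comm_monoid_add"
proof -
  have "{..<n + n} = {..<n} \<union> {n..<n + n}" by auto
  moreover have "(\<Sum>j = n..<n + n. f j) = (\<Sum>j<n. f (n + j))"
    using sum.shift_bounds_nat_ivl[of f 0 n n] by (simp add: add.commute lessThan_atLeast0)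
  ultimately show ?thesis by (simp add: sum.union_disjoint ivl_disj_int_one)
qed

lemma vec_norm_split: "(vec_norm (n + n) v)\<^sup>2 = (vec_norm n v)\<^sup>2 + (vec_norm n (\<lambda>i. v (n + i)))\<^sup>2"
  by (simp add: vec_norm_def L2_set_def sum_nonneg sum_split_half)

text \<open>F need not be supported on its block: entries with an index n or above are never
  read.\<close>

definition dilation :: "nat \<Rightarrow> cmat \<Rightarrow> cmat" where
  "dilation n F = (\<lambda>i j. if i < n \<and> n \<le> j \<and> j < n + n then F i (j - n)
     else if n \<le> i \<and> i < n + n \<and> j < n then cnj (F j (i - n)) else 0)"

text \<open>The dilation swaps the two halves of a vector while applying F to one and its adjoint to
  the other; squared norms add up, so the bound for F is kept.\<close>

lemma dilation_small_hermitian: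
  assumes F: "norm_bound n (1/2) F"
  shows "dilation n F \<in> small_hermitian (n + n)"
proof -
  have "norm_bound (n + n) (1/2) (dilation n F)"
    unfolding norm_bound_def
  proof
    fix v :: "nat \<Rightarrow> complex"
    let ?w = "\<lambda>j. v (n + j)"
    have "mat_vec (n + n) (dilation n F) v i = mat_vec n F ?w i" if "i < n" for i
      using that by (simp add: mat_vec_def sum_split_half dilation_def)
    then have 1: "vec_norm n (mat_vec (n + n) (dilation n F) v) = vec_norm n (mat_vec n F ?w)"
      unfolding vec_norm_def by (intro L2_set_cong) auto
    have "mat_vec (n + n) (dilation n F) v (n + i) = mat_vec n (mat_adjoint F) v i" if "i < n" for i
      using that by (simp add: mat_vec_def sum_split_half dilation_def mat_adjoint_def)
    then have 2: "vec_norm n (\<lambda>i. mat_vec (n + n) (dilation n F) v (n + i)) = vec_norm n (mat_vec n (mat_adjoint F) v)"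
      unfolding vec_norm_def by (intro L2_set_cong) auto
    have "(vec_norm (n + n) (mat_vec (n + n) (dilation n F) v))\<^sup>2 =
      (vec_norm n (mat_vec n F ?w))\<^sup>2 + (vec_norm n (mat_vec n (mat_adjoint F) v))\<^sup>2"
      unfolding vec_norm_split 1 2 ..
    also have "\<dots> \<le> (1/2 * vec_norm n ?w)\<^sup>2 + (1/2 * vec_norm n v)\<^sup>2"
      by (intro add_mono power_mono norm_boundD F norm_bound_adjoint) auto
    also have "\<dots> = (1/2 * vec_norm (n + n) v)\<^sup>2"
      unfolding power_mult_distrib vec_norm_split by (simp add: algebra_simps)
    finally show "vec_norm (n + n) (mat_vec (n + n) (dilation n F) v) \<le> 1/2 * vec_norm (n + n) v"
      by (rule power2_le_imp_le) simp
  qed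
  moreover have "dilation n F \<in> mats (n + n)" by (auto simp: mats_def dilation_def)
  moreover have "mat_adjoint (dilation n F) = dilation n F"
    by (auto simp: mat_adjoint_def dilation_def fun_eq_iff)
  ultimately show ?thesis by (simp add: small_hermitian_def)
qed

text \<open>In the off-diagonal blocks the identity and the square root defect vanish, so only the
  term with \<i> h survives.\<close>

lemma unitary_of_dilation_corner:
  assumes "i < n" "j < n"
  shows "unitary_of (n + n) (dilation n F) i (n + j) = \<i> * F i j"
proof -
  have "dilation n F i k * dilation n F k j = 0" if "(i < n) \<noteq> (j < n)" for i j k
    using that by (auto simp: dilation_def)
  then have "mat_mult (n + n) (dilation n F) (dilation n F) i j = 0" if "(i < n) \<noteq> (j < n)" for i j
    using that unfolding mat_mult_def by (intro sum.neutral) blast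
  then have "sqrt_defect (n + n) (mat_mult (n + n) (dilation n F) (dilation n F)) i (n + j) = 0"
    by (rule sqrt_defect_block) (use assms in auto)
  then show ?thesis using assms by (simp add: unitary_of_def mat_one_def dilation_def)
qed

section \<open>Embedding into a product of unitary groups\<close>

definition unitary_product :: "('i \<Rightarrow> nat) \<Rightarrow> ('i \<Rightarrow> cmat) set" where
  "unitary_product d = {p. \<forall>i. p i \<in> unitaries (d i)}"

definition product_mult :: "('i \<Rightarrow> nat) \<Rightarrow> ('i \<Rightarrow> cmat) \<Rightarrow> ('i \<Rightarrow> cmat) \<Rightarrow> ('i \<Rightarrow> cmat)" where
  "product_mult d p q = (\<lambda>i. mat_mult (d i) (p i) (q i))"

definition product_one :: "('i \<Rightarrow> nat) \<Rightarrow> ('i \<Rightarrow> cmat)" where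
  "product_one d = (\<lambda>i. mat_one (d i))"

definition product_inv :: "('i \<Rightarrow> cmat) \<Rightarrow> ('i \<Rightarrow> cmat)" where
  "product_inv p = (\<lambda>i. mat_adjoint (p i))"

definition identity_component :: "('i \<Rightarrow> nat) \<Rightarrow> ('i \<Rightarrow> cmat) set" where
  "identity_component d = connected_component_set (unitary_product d) (product_one d)"

definition component_group :: "('i \<Rightarrow> nat) \<Rightarrow> ('i \<Rightarrow> cmat) monoid" where
  "component_group d = \<lparr>carrier = identity_component d, mult = product_mult d, one = product_one d\<rparr>"

lemma continuous_on_entry:
  fixes f :: "'x::topological_space \<Rightarrow> 'i \<Rightarrow> cmat"
  assumes "continuous_on S f"
  shows "continuous_on S (\<lambda>x. f x i a b)"
  by (rule continuous_on_product_then_coordinatewise[OF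
        continuous_on_product_then_coordinatewise[OF
          continuous_on_product_then_coordinatewise[OF assms]]])

lemma continuous_on_entrywise:
  fixes f :: "'x::topological_space \<Rightarrow> 'i \<Rightarrow> cmat"
  assumes "\<And>i a b. continuous_on S (\<lambda>x. f x i a b)"
  shows "continuous_on S f"
  by (rule continuous_on_coordinatewise_then_product, rule continuous_on_coordinatewise_then_product,
      rule continuous_on_coordinatewise_then_product, rule assms)

text \<open>The source carries an abstract topology, so the product topology of the target is
  unfolded explicitly, one function arrow at a time.\<close>

lemma continuous_map_entrywise:
  fixes f :: "'x \<Rightarrow> 'i \<Rightarrow> cmat"
  assumes "\<And>i a b. continuous_map X euclidean (\<lambda>x. f x i a b)"
  shows "continuous_map X euclidean f"
proof -
  have "continuous_map X euclidean (\<lambda>x. f x i a)" for i a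
    unfolding euclidean_product_topology[symmetric]
    by (rule continuous_map_coordinatewise_then_product) (auto intro: assms)
  then have "continuous_map X euclidean (\<lambda>x. f x i)" for i
    unfolding euclidean_product_topology[symmetric, where 'b = "nat \<Rightarrow> complex"]
    by (intro continuous_map_coordinatewise_then_product) auto
  then show ?thesis
    unfolding euclidean_product_topology[symmetric, where 'b = cmat]
    by (intro continuous_map_coordinatewise_then_product) auto
qed

lemma Hausdorff_space_functions: "Hausdorff_space (euclidean :: ('i \<Rightarrow> cmat) topology)"
proof -
  have H: "Hausdorff_space (euclidean :: ('j \<Rightarrow> 'b::topological_space) topology)"
    if "Hausdorff_space (euclidean :: 'b topology)"
    unfolding euclidean_product_topology[symmetric, where 'b = 'b]
    using that by (simp add: Hausdorff_space_product_topology)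
  show ?thesis by (intro H Hausdorff_space_euclidean)
qed

lemma compact_functions:
  fixes S :: "'b::topological_space set"
  assumes "compact S"
  shows "compact {f :: 'i \<Rightarrow> 'b. \<forall>i. f i \<in> S}"
proof -
  have "compactin (product_topology (\<lambda>_. euclidean) UNIV) (PiE UNIV (\<lambda>_::'i. S))"
    using assms by (simp add: compactin_PiE)
  moreover have "PiE UNIV (\<lambda>_::'i. S) = {f. \<forall>i. f i \<in> S}" by auto
  ultimately show ?thesis by (simp add: euclidean_product_topology)
qed

text \<open>Membership is a family of closed conditions on finitely many entries each, and all
  entries lie in the closed unit disc, so Tychonoff applies.\<close>

lemma
  fixes d :: "'i \<Rightarrow> nat"
  shows closed_unitary_product: "closed (unitary_product d)"
    and compact_unitary_product: "compact (unitary_product d)"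
proof -
  have box: "compact {p :: 'i \<Rightarrow> cmat. \<forall>i. p i \<in> {A. \<forall>a. A a \<in> {r. \<forall>b. r b \<in> cball 0 1}}}"
    by (intro compact_functions compact_cball)
  have ent: "continuous_on UNIV (\<lambda>p :: 'i \<Rightarrow> cmat. p i a b)" for i a b
    by (rule continuous_on_entry[OF continuous_on_id])
  have "unitary_product d = {p. \<forall>i a b. (d i \<le> a \<or> d i \<le> b \<longrightarrow> p i a b = 0) \<and>
      mat_mult (d i) (p i) (mat_adjoint (p i)) a b = mat_one (d i) a b \<and>
      mat_mult (d i) (mat_adjoint (p i)) (p i) a b = mat_one (d i) a b}"
    by (auto simp: unitary_product_def unitaries_def mats_def fun_eq_iff)
  moreover have "closed \<dots>"
    unfolding mat_mult_def mat_adjoint_def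
    by (intro closed_Collect_all closed_Collect_conj closed_Collect_imp open_Collect_const closed_Collect_eq
        continuous_on_sum continuous_on_mult continuous_on_cnj ent continuous_on_const)
  ultimately show cl: "closed (unitary_product d)" by simp
  have "unitary_product d \<subseteq> {p. \<forall>i. p i \<in> {A. \<forall>a. A a \<in> {r. \<forall>b. r b \<in> cball 0 1}}}"
  proof (clarsimp simp: unitary_product_def)
    fix p :: "'i \<Rightarrow> cmat" and i a b assume "\<forall>i. p i \<in> unitaries (d i)"
    then show "cmod (p i a b) \<le> 1" using unitaries_entry_le by blast
  qed
  then show "compact (unitary_product d)"
    using compact_Int_closed[OF box cl] by (simp only: Int_absorb1)
qed

lemma continuous_on_product_mult:
  "continuous_on S (\<lambda>z :: ('i \<Rightarrow> cmat) \<times> ('i \<Rightarrow> cmat). product_mult d (fst z) (snd z))"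
proof (rule continuous_on_entrywise)
  fix i a b
  have "continuous_on S (\<lambda>z :: ('i \<Rightarrow> cmat) \<times> ('i \<Rightarrow> cmat). fst z i a k)"
    "continuous_on S (\<lambda>z :: ('i \<Rightarrow> cmat) \<times> ('i \<Rightarrow> cmat). snd z i k b)" for k
    by (rule continuous_on_entry[OF continuous_on_fst[OF continuous_on_id]],
        rule continuous_on_entry[OF continuous_on_snd[OF continuous_on_id]])
  then show "continuous_on S (\<lambda>z. product_mult d (fst z) (snd z) i a b)"
    unfolding product_mult_def mat_mult_def by (intro continuous_on_sum continuous_on_mult)
qed

lemma continuous_on_product_inv: "continuous_on S (product_inv :: ('i \<Rightarrow> cmat) \<Rightarrow> _)"
  unfolding product_inv_def[abs_def] mat_adjoint_def
  by (rule continuous_on_entrywise, rule continuous_on_cnj, rule continuous_on_entry[OF continuous_on_id])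

lemma product_mult_unitary: "p \<in> unitary_product d \<Longrightarrow> q \<in> unitary_product d \<Longrightarrow> product_mult d p q \<in> unitary_product d"
  by (simp add: unitary_product_def product_mult_def unitaries_mult)

lemma product_one_unitary: "product_one d \<in> unitary_product d"
  by (simp add: unitary_product_def product_one_def unitaries_one)

lemma product_inv_unitary: "p \<in> unitary_product d \<Longrightarrow> product_inv p \<in> unitary_product d"
  by (simp add: unitary_product_def product_inv_def unitaries_adjoint)

lemma product_laws:
  assumes "p \<in> unitary_product d"
  shows "product_mult d (product_one d) p = p" "product_mult d p (product_one d) = p"
    "product_mult d (product_inv p) p = product_one d"
proof -
  have p: "p i \<in> unitaries (d i)" for i using assms by (simp add: unitary_product_def)
  then have "p i \<in> mats (d i)" "mat_mult (d i) (mat_adjoint (p i)) (p i) = mat_one (d i)" for i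
    by (simp_all add: unitaries_def)
  then show "product_mult d (product_one d) p = p" "product_mult d p (product_one d) = p"
    "product_mult d (product_inv p) p = product_one d"
    by (simp_all add: product_mult_def product_one_def product_inv_def mat_mult_one_left mat_mult_one_right)
qed

lemma identity_component_subset: "identity_component d \<subseteq> unitary_product d"
  unfolding identity_component_def by (rule connected_component_subset)

lemma identity_component_one: "product_one d \<in> identity_component d"
  unfolding identity_component_def using product_one_unitary by simp

lemma connected_identity_component: "connected (identity_component d)"
  unfolding identity_component_def by (rule connected_connected_component)

text \<open>The common point q need not be the identity: closure under multiplication uses p,
  closure under inversion the identity.\<close>

lemma identity_componentI:
  assumes "connected S" "S \<subseteq> unitary_product d" "q \<in> S" "q \<in> identity_component d"
  shows "S \<subseteq> identity_component d"
  using assms connected_component_maximal connected_component_eq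
  unfolding identity_component_def by metis

lemma identity_component_mult:
  assumes p: "p \<in> identity_component d" and q: "q \<in> identity_component d"
  shows "product_mult d p q \<in> identity_component d"
proof -
  have pu: "p \<in> unitary_product d" using p identity_component_subset by blast
  have "continuous_on (identity_component d) (\<lambda>q. product_mult d p q)"
  proof -
    have "continuous_on (identity_component d) (\<lambda>q. (p, q))"
      by (intro continuous_on_Pair continuous_on_const continuous_on_id)
    from continuous_on_compose[OF this continuous_on_product_mult] show ?thesis by (simp add: o_def)
  qed
  then have "connected (product_mult d p ` identity_component d)"
    using connected_identity_component by (rule connected_continuous_image)
  moreover have "product_mult d p ` identity_component d \<subseteq> unitary_product d"
    using product_mult_unitary[OF pu] identity_component_subset by blast
  \<comment> \<open>The translate of the component by p meets the component in p, the image of the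
    identity.\<close>
  moreover have "p \<in> product_mult d p ` identity_component d"
    using product_laws(2)[OF pu] identity_component_one by (metis imageI)
  ultimately have "product_mult d p ` identity_component d \<subseteq> identity_component d"
    using p by (rule identity_componentI)
  then show ?thesis using q by blast
qed

lemma identity_component_inv:
  assumes p: "p \<in> identity_component d"
  shows "product_inv p \<in> identity_component d"
proof -
  have "connected (product_inv ` identity_component d)"
    using continuous_on_product_inv connected_identity_component by (rule connected_continuous_image)
  moreover have "product_inv ` identity_component d \<subseteq> unitary_product d"
    using product_inv_unitary identity_component_subset by blast
  moreover have "product_inv (product_one d) = product_one d"
    by (simp add: product_inv_def product_one_def)
  then have "product_one d \<in> product_inv ` identity_component d"
    using identity_component_one by (metis imageI)
  ultimately have "product_inv ` identity_component d \<subseteq> identity_component d"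
    using identity_component_one by (rule identity_componentI)
  then show ?thesis using p by blast
qed

lemma component_group_simps [simp]:
  "carrier (component_group d) = identity_component d"
  "mult (component_group d) = product_mult d"
  "one (component_group d) = product_one d"
  by (simp_all add: component_group_def)

lemma group_component_group: "group (component_group d)"
proof (rule groupI)
  fix p assume "p \<in> carrier (component_group d)"
  then have p: "p \<in> identity_component d" by simp
  then have pu: "p \<in> unitary_product d" using identity_component_subset by blast
  show "one (component_group d) \<otimes>\<^bsub>component_group d\<^esub> p = p" using product_laws(1)[OF pu] by simp
  show "\<exists>q\<in>carrier (component_group d). q \<otimes>\<^bsub>component_group d\<^esub> p = one (component_group d)"
    using product_laws(3)[OF pu] identity_component_inv[OF p] by auto
next
  fix p q r
  show "p \<otimes>\<^bsub>component_group d\<^esub> q \<otimes>\<^bsub>component_group d\<^esub> r = p \<otimes>\<^bsub>component_group d\<^esub> (q \<otimes>\<^bsub>component_group d\<^esub> r)"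
    by (simp add: product_mult_def mat_mult_assoc)
qed (auto simp: identity_component_mult identity_component_one)

abbreviation component_topology :: "('i \<Rightarrow> nat) \<Rightarrow> ('i \<Rightarrow> cmat) topology" where
  "component_topology d \<equiv> top_of_set (identity_component d)"

lemma topological_group_component: "topological_group (component_group d) (component_topology d)"
proof -
  interpret group "component_group d" by (rule group_component_group)
  show ?thesis
  proof
    show "topspace (component_topology d) = carrier (component_group d)" by simp
    show "Hausdorff_space (component_topology d)"
      by (intro Hausdorff_space_subtopology Hausdorff_space_functions)
    have "continuous_map (top_of_set (identity_component d \<times> identity_component d)) (component_topology d)
        (\<lambda>z. product_mult d (fst z) (snd z))"
      unfolding continuous_map_in_subtopology
      using continuous_on_product_mult identity_component_mult by (auto simp: continuous_map_iff_continuous)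
    then show "continuous_map (prod_topology (component_topology d) (component_topology d)) (component_topology d)
        (\<lambda>(x, y). x \<otimes>\<^bsub>component_group d\<^esub> y)"
      by (simp add: case_prod_unfold)
    have "continuous_map (component_topology d) (component_topology d) product_inv"
      unfolding continuous_map_in_subtopology
      using continuous_on_product_inv identity_component_inv by (auto simp: continuous_map_iff_continuous)
    moreover have "product_inv p = inv\<^bsub>component_group d\<^esub> p" if "p \<in> identity_component d" for p
      using that product_laws(3) identity_component_subset identity_component_inv
      by (intro inv_equality[symmetric]) auto
    ultimately show "continuous_map (component_topology d) (component_topology d) (\<lambda>x. inv\<^bsub>component_group d\<^esub> x)"
      by (rule continuous_map_eq) simp
  qed
qed

lemma compact_space_component: "compact_space (component_topology d)"
proof -
  have "closed (identity_component d)"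
    unfolding identity_component_def by (rule closed_connected_component[OF closed_unitary_product])
  then have "compact (unitary_product d \<inter> identity_component d)"
    by (intro compact_Int_closed compact_unitary_product)
  then have "compact (identity_component d)"
    by (simp only: Int_absorb1[OF identity_component_subset])
  then show ?thesis by (simp add: compact_space_subtopology)
qed

lemma compact_group_component: "compact_group (component_group d) (component_topology d)"
  by (simp add: compact_group_def compact_group_axioms_def topological_group_component compact_space_component)

lemma connected_space_component: "connected_space (component_topology d)"
  using connected_identity_component[of d] by (simp add: connectedin_def flip: connectedin_iff_connected)

text \<open>The embedding is constant in the coordinates \<open>(n, h)\<close> where \<open>h\<close> is not a continuous map into \<^term>\<open>small_hermitian n\<close>.\<close>

definition admissible :: "'a topology \<Rightarrow> nat \<times> ('a \<Rightarrow> cmat) \<Rightarrow> bool" where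
  "admissible X p \<longleftrightarrow> (\<forall>i j. continuous_map X euclidean (\<lambda>x. snd p x i j)) \<and>
     (\<forall>x\<in>topspace X. snd p x \<in> small_hermitian (fst p))"

definition embedding :: "'a topology \<Rightarrow> 'a \<Rightarrow> 'a matrix_family" where
  "embedding X x = (\<lambda>p. if admissible X p then unitary_of (fst p) (snd p x) else mat_one (fst p))"

lemma embedding_in_component:
  assumes x: "x \<in> topspace X"
  shows "embedding X x \<in> identity_component fst"
proof -
  \<comment> \<open>A single path scales all admissible coordinates at once, from the identity at t
    = 0 to the embedded point at t = 1; in the product topology its continuity is a matter of single
    entries.\<close>
  define c where "c t = (\<lambda>p. if admissible X p
      then unitary_of (fst p) (\<lambda>i j. complex_of_real t * snd p x i j) else mat_one (fst p))" for t
  have sh: "(\<lambda>i j. complex_of_real t * snd p x i j) \<in> small_hermitian (fst p)"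
    if "admissible X p" "t \<in> {0..1}" for t p
    using that x by (intro small_hermitian_scale) (auto simp: admissible_def)
  have "continuous_on {0..1} c"
  proof (rule continuous_on_entrywise)
    fix p :: "nat \<times> ('a \<Rightarrow> cmat)" and a b
    show "continuous_on {0..1} (\<lambda>t. c t p a b)"
    proof (cases "admissible X p")
      case True
      have "continuous_map (top_of_set {0..1}) euclidean
          (\<lambda>t. unitary_of (fst p) (\<lambda>i j. complex_of_real t * snd p x i j) a b)"
        by (rule continuous_map_unitary_of)
          (use sh[OF True] in \<open>auto simp: continuous_map_iff_continuous intro!: continuous_intros\<close>)
      then show ?thesis using True by (simp add: c_def continuous_map_iff_continuous)
    qed (simp add: c_def)
  qed
  then have conn: "connected (c ` {0..1})"
    by (rule connected_continuous_image) simp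
  have "c ` {0..1} \<subseteq> unitary_product fst"
    using unitary_of_unitaries[OF sh] unitaries_one by (auto simp: c_def unitary_product_def)
  moreover have "c 0 = product_one fst"
    by (auto simp: c_def product_one_def unitary_of_zero fun_eq_iff)
  then have "product_one fst \<in> c ` {0..1}" by (intro image_eqI[of _ _ 0]) auto
  ultimately have "c ` {0..1} \<subseteq> identity_component fst"
    using conn identity_component_one by (intro identity_componentI)
  moreover have "c 1 = embedding X x" by (simp add: c_def embedding_def cong: if_cong)
  then have "embedding X x \<in> c ` {0..1}" by (intro image_eqI[of _ _ 1]) auto
  ultimately show ?thesis by blast
qed

lemma continuous_map_embedding:
  "continuous_map X (component_topology fst) (embedding X)"
proof -
  have "continuous_map X euclidean (embedding X)"
  proof (rule continuous_map_entrywise)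
    fix p i j
    show "continuous_map X euclidean (\<lambda>x. embedding X x p i j)"
    proof (cases "admissible X p")
      case True
      have "continuous_map X euclidean (\<lambda>x. unitary_of (fst p) (snd p x) i j)"
        by (rule continuous_map_unitary_of) (use True in \<open>simp_all add: admissible_def\<close>)
      then show ?thesis using True by (simp add: embedding_def)
    qed (simp add: embedding_def)
  qed
  then show ?thesis
    using embedding_in_component by (auto simp: continuous_map_in_subtopology)
qed

lemma embedding_apply: "admissible X (n, h) \<Longrightarrow> embedding X x (n, h) = unitary_of n (h x)"
  by (simp add: embedding_def)

text \<open>A Urysohn function separating the two points, with values in the interval from 0 to 1/2,
  is an admissible 1 x 1 matrix function, and its unitary determines its value.\<close>

lemma inj_on_embedding:
  assumes "compact_space X" "Hausdorff_space X"
  shows "inj_on (embedding X) (topspace X)"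
proof (rule inj_onI, rule ccontr)
  fix x y assume xy: "x \<in> topspace X" "y \<in> topspace X" and eq: "embedding X x = embedding X y" and ne: "x \<noteq> y"
  have n: "normal_space X"
    using assms compact_Hausdorff_or_regular_imp_normal_space by blast
  have "closedin X {x}" "closedin X {y}"
    using assms xy by (simp_all add: closedin_Hausdorff_sing_eq)
  then obtain f where f: "continuous_map X (top_of_set {0..1/2::real}) f" "f ` {x} \<subseteq> {0}" "f ` {y} \<subseteq> {1/2}"
    by (rule Urysohn_lemma[OF n, of "{x}" "{y}" 0 "1/2"]) (use ne in auto)
  define h where "h z = (\<lambda>(i::nat) (j::nat). if i = 0 \<and> j = 0 then complex_of_real (f z) else 0)" for z
  have f01: "f z \<in> {0..1/2}" if "z \<in> topspace X" for z
    using f(1) that by (auto simp: continuous_map_in_subtopology)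
  have "h z \<in> small_hermitian 1" if z: "z \<in> topspace X" for z
  proof -
    have "norm_bound 1 (1/2) (h z)"
      unfolding norm_bound_def
    proof
      fix v :: "nat \<Rightarrow> complex"
      have one: "vec_norm 1 w = cmod (w 0)" for w by (simp add: vec_norm_def L2_set_def)
      have "cmod (mat_vec 1 (h z) v 0) = f z * cmod (v 0)"
        using f01[OF z] by (simp add: mat_vec_def h_def norm_mult)
      also have "\<dots> \<le> 1/2 * cmod (v 0)" using f01[OF z] by (intro mult_right_mono) auto
      finally show "vec_norm 1 (mat_vec 1 (h z) v) \<le> 1/2 * vec_norm 1 v" unfolding one .
    qed
    then show ?thesis by (auto simp: small_hermitian_def mats_def h_def mat_adjoint_def fun_eq_iff)
  qed
  moreover have "continuous_map X euclidean (\<lambda>z. h z i j)" for i j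
  proof -
    have "continuous_map X euclidean f" using f(1) by (simp add: continuous_map_in_subtopology)
    then have "continuous_map X euclidean (\<lambda>z. complex_of_real (f z))"
      by (simp add: continuous_map_atin tendsto_of_real)
    then show ?thesis by (cases "i = 0 \<and> j = 0") (auto simp: h_def)
  qed
  ultimately have adm: "admissible X (1, h)" and sh: "\<And>z. z \<in> topspace X \<Longrightarrow> h z \<in> small_hermitian 1"
    by (auto simp: admissible_def)
  have "unitary_of 1 (h x) = unitary_of 1 (h y)"
    using eq embedding_apply[OF adm] by metis
  then have "2 * \<i> * h x 0 0 = 2 * \<i> * h y 0 0"
    using unitary_of_imaginary_part[OF sh[OF xy(1)], of 0 0] unitary_of_imaginary_part[OF sh[OF xy(2)], of 0 0]
    by simp
  then show False using f(2,3) by (simp add: h_def)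
qed

text \<open>Multiplication is coordinatewise and \<open>fst\<close> is the size function, so every
  coordinate (n, h), admissible or not, is a representation of dimension n.\<close>

lemma unitary_representation_coordinate:
  "unitary_representation (component_group fst) (component_topology fst) n (\<lambda>g. g (n, h))"
proof -
  interpret compact_group "component_group fst" "component_topology fst" by (rule compact_group_component)
  show ?thesis
  proof
    fix i j
    show "continuous_map (component_topology fst) euclidean (\<lambda>g. g (n, h) i j)"
      unfolding continuous_map_iff_continuous by (rule continuous_on_entry[OF continuous_on_id])
    show "(\<Sum>r<n. g (n, h) i r * cnj (g (n, h) j r)) = (if i = j then 1 else 0)"
      if "g \<in> carrier (component_group fst)" "i < n" "j < n" for g
    proof (rule unitaries_rows[OF _ that(2,3)])
      have "g \<in> unitary_product fst" using that(1) identity_component_subset by auto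
      then have "g (n, h) \<in> unitaries (fst (n, h))" unfolding unitary_product_def by blast
      then show "g (n, h) \<in> unitaries n" by simp
    qed
    show "(g \<otimes>\<^bsub>component_group fst\<^esub> x) (n, h) i j = (\<Sum>r<n. g (n, h) i r * x (n, h) r j)" for g x
      by (simp add: product_mult_def mat_mult_def)
  qed
qed

lemma admissible_dilation:
  assumes cont: "\<And>i j. \<lbrakk>i < n; j < n\<rbrakk> \<Longrightarrow> continuous_map X euclidean (\<lambda>x. F x i j)"
    and F: "\<And>x. x \<in> topspace X \<Longrightarrow> norm_bound n (1/2) (F x)"
  shows "admissible X (n + n, \<lambda>x. dilation n (F x))"
proof -
  have "continuous_map X euclidean (\<lambda>x. dilation n (F x) i j)" for i j
  proof -
    have "continuous_map X euclidean (\<lambda>x. cnj (F x a b))" if "a < n" "b < n" for a b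
      using cont[OF that] by (simp add: continuous_map_atin tendsto_cnj)
    then show ?thesis
      using cont unfolding dilation_def
      by (cases "i < n \<and> n \<le> j \<and> j < n + n"; cases "n \<le> i \<and> i < n + n \<and> j < n") auto
  qed
  then show ?thesis using dilation_small_hermitian[OF F] by (simp add: admissible_def)
qed

lemma cb_Helson_embedding:
  assumes X: "compact_space X"
  shows "cb_Helson (component_group fst) (component_topology fst) (embedding X ` topspace X)"
proof -
  let ?T = "component_topology fst :: 'a matrix_family topology"
  let ?E = "embedding X ` topspace X"
  interpret compact_group "component_group fst" ?T by (rule compact_group_component)
  have "compactin ?T ?E"
    using X continuous_map_embedding by (auto simp: compact_space_def intro: image_compactin)
  then have closed: "closedin ?T ?E" by (simp add: compactin_iff_closedin)
  have emb: "continuous_map X (subtopology ?T ?E) (embedding X)"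
    using continuous_map_embedding by (simp add: continuous_map_in_subtopology image_subset_iff continuous_map_into_subtopology)
  show ?thesis
  proof (rule cb_HelsonI[where C = 2, OF closed])
    fix n and f :: "nat \<Rightarrow> nat \<Rightarrow> 'a matrix_family \<Rightarrow> complex" and c :: real
    assume f: "\<And>i j. \<lbrakk>i < n; j < n\<rbrakk> \<Longrightarrow> f i j \<in> C0 ?T ?E" and c: "0 < c" and less: "C0_norm ?E n f < ennreal c"
    \<comment> \<open>The modulus 1 / (2 c) brings the norm from c down to 1/2, and the phase -\<i>
      cancels the \<i> in front of h in \<open>unitary_of\<close>.\<close>
    define F where "F x = (\<lambda>i j. (- \<i> / (2 * complex_of_real c)) * f i j (embedding X x))" for x
    define h where "h x = dilation n (F x)" for x
    have "norm_bound n (1/2) (F x)" if x: "x \<in> topspace X" for x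
    proof -
      have "scalar_mat_norm {..<n} (\<lambda>i j. f i j (embedding X x)) \<le> C0_norm ?E n f"
        unfolding C0_norm_def by (rule SUP_upper) (use x in simp)
      then have "scalar_mat_norm {..<n} (\<lambda>i j. f i j (embedding X x)) \<le> ennreal c"
        using less by simp
      then have "norm_bound n c (\<lambda>i j. f i j (embedding X x))"
        using c by (intro norm_bound_scalar_mat_norm) auto
      then have "norm_bound n (cmod (- \<i> / (2 * complex_of_real c)) * c) (F x)"
        unfolding F_def by (rule norm_bound_scale)
      then show ?thesis using c by (simp add: norm_divide norm_mult)
    qed
    moreover have "continuous_map X euclidean (\<lambda>x. F x i j)" if "i < n" "j < n" for i j
    proof -
      have "continuous_map (subtopology ?T ?E) euclidean (f i j)"
        using f[OF that] C0_eq[OF closed] by simp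
      from continuous_map_compose[OF emb this]
      have "continuous_map X euclidean (\<lambda>x. f i j (embedding X x))" by (simp add: o_def)
      then show ?thesis unfolding F_def by (intro continuous_map_complex_mult) auto
    qed
    ultimately have adm: "admissible X (n + n, h)"
      unfolding h_def[abs_def] by (intro admissible_dilation)
    interpret unitary_representation "component_group fst" ?T "n + n" "\<lambda>g. g (n + n, h)"
      by (rule unitary_representation_coordinate)
    \<comment> \<open>Row i and column n + j address the upper right block; the factor 2 c undoes
      the scaling in F and becomes the norm of the lift.\<close>
    define u where "u i j = (\<lambda>g\<in>carrier (component_group fst). complex_of_real (2 * c) * g (n + n, h) i (n + j))"
      for i j
    have u: "\<And>i j. \<lbrakk>i < n; j < n\<rbrakk> \<Longrightarrow> u i j \<in> fourier_algebra (component_group fst) ?T"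
      "fourier_norm (component_group fst) ?T n u \<le> ennreal (2 * c)"
      using fourier_norm_coefficients[of "2 * c" "\<lambda>i. i" n "\<lambda>j. n + j"] c
      unfolding u_def[abs_def] by (auto simp: inj_on_def image_subset_iff)
    have "restrict (u i j) ?E = f i j" if ij: "i < n" "j < n" for i j
    proof
      fix g
      show "restrict (u i j) ?E g = f i j g"
      proof (cases "g \<in> ?E")
        case True
        then obtain x where x: "x \<in> topspace X" "g = embedding X x" by blast
        have "g \<in> identity_component fst"
          unfolding x(2) by (rule embedding_in_component[OF x(1)])
        then have "u i j g = complex_of_real (2 * c) * unitary_of (n + n) (h x) i (n + j)"
          using embedding_apply[OF adm, of x] by (simp add: u_def x)
        also have "\<dots> = f i j g"
          using unitary_of_dilation_corner[OF ij, of "F x"] c by (simp add: h_def F_def x field_simps)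
        finally show ?thesis using True by simp
      next
        \<comment> \<open>Off E the restriction and the extensional function \<open>f i j\<close>
          are both \<open>undefined\<close>.\<close>
        case False
        then show ?thesis using f[OF ij] C0_eq[OF closed] by (simp add: extensional_def)
      qed
    qed
    with u show "\<exists>u. (\<forall>i<n. \<forall>j<n. u i j \<in> fourier_algebra (component_group fst) ?T \<and> restrict (u i j) ?E = f i j) \<and>
        fourier_norm (component_group fst) ?T n u \<le> ennreal (2 * c)"
      by (intro exI[of _ u]) auto
  qed simp
qed

theorem theorem1p3:
  fixes \<Omega> :: "'a topology"
  assumes "compact_space \<Omega>" and "Hausdorff_space \<Omega>"
  shows "\<exists>(G :: 'a matrix_family monoid) T E.
           topological_group G T \<and> compact_space T \<and> connected_space T \<and>
           cb_Helson G T E \<and> subtopology T E homeomorphic_space \<Omega>"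
proof (intro exI conjI)
  \<comment> \<open>With \<open>fst\<close> as size function the factor at the index (n, h) is U(n).
    The group depends only on the type of the points; the topology of \<Omega> enters through the
    embedding alone, by way of \<open>admissible\<close>.\<close>
  let ?T = "component_topology fst :: 'a matrix_family topology"
  let ?E = "embedding \<Omega> ` topspace \<Omega>"
  show "topological_group (component_group fst) ?T" by (rule topological_group_component)
  show "compact_space ?T" by (rule compact_space_component)
  show "connected_space ?T" by (rule connected_space_component)
  show "cb_Helson (component_group fst) ?T ?E" by (rule cb_Helson_embedding[OF assms(1)])
  have "homeomorphic_map \<Omega> (subtopology ?T ?E) (embedding \<Omega>)"
  proof (rule continuous_imp_homeomorphic_map)
    show "continuous_map \<Omega> (subtopology ?T ?E) (embedding \<Omega>)"
      using continuous_map_embedding by (simp add: continuous_map_in_subtopology image_subset_iff continuous_map_into_subtopology)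
    show "Hausdorff_space (subtopology ?T ?E)"
      by (intro Hausdorff_space_subtopology Hausdorff_space_functions)
    show "embedding \<Omega> ` topspace \<Omega> = topspace (subtopology ?T ?E)"
      using embedding_in_component by auto
  qed (use assms inj_on_embedding in auto)
  then show "subtopology ?T ?E homeomorphic_space \<Omega>"
    using homeomorphic_map_imp_homeomorphic_space homeomorphic_space_sym by blast
qed

end
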